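(* Let $T:\mathcal J\to\mathcal J$ be an expanding random map over $(X,\mathcal F,m,\theta)$, let $\varphi\in\mathcal H^\alpha(\mathcal J)$, and let $\{\nu_x\}_{x\in X}$ and $\{\mu_x\}_{x\in X}$ be the families of measures associated with $\varphi$ described in the context. Then $\{\nu_x\}_{x\in X}$ and $\{\mu_x\}_{x\in X}$ are Gibbs families for $\varphi$. Moreover, if $\mathcal J$ satisfies the condition of measurability of cardinality of covers and if $\{\nu_x'\}_{x\in X}$ is a Gibbs family for $\varphi$, then $\nu_x'$ and $\nu_x$ are equivalent for almost every $x\in X$.
   Context: Setting. $(X,\mathcal F,m)$ is a probability space and $\theta:X\to X$ is an invertible, $m$-preserving, ergodic map. For each $x\in X$, $(\mathcal J_x,\varrho_x)$ is a nonempty compact metric space of diameter at most $1$, $B_x(z,r)$ (also written $B(y,r)$ for $y=(x,z)$) is the ball in it, and $\mathcal J=\bigcup_{x\in X}\{x\}\times\mathcal J_x$. Given maps $T_x:\mathcal J_x\to\mathcal J_{\theta(x)}$, set $T(x,z)=(\theta(x),T_x(z))$ and $T_x^n=T_{\theta^{n-1}(x)}\circ\dots\circ T_x$. $T$ is an expanding random map if the $T_x$ are continuous, open and surjective and there are $\eta:X\to(0,\infty)$ and $\xi>0$ such that: (i) $T_x(B_x(z,\eta_x))\supset B_{\theta(x)}(T_x(z),\xi)$ for every $(x,z)\in\mathcal J$; (ii) there is a measurable $\gamma:X\to(1,\infty)$ such that for $m$-a.e. $x$, $\varrho_{\theta(x)}(T_x(z_1),T_x(z_2))\ge\gamma_x\varrho_x(z_1,z_2)$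 whenever $z_1,z_2\in\mathcal J_x$, $\varrho_x(z_1,z_2)<\eta_x$; (iii) $x\mapsto\deg(T_x):=\sup_{y\in\mathcal J_{\theta(x)}}\#T_x^{-1}(y)$ is measurable; (iv) there is a measurable $x\mapsto n_\xi(x)\in\mathbb N$ such that for a.e. $x$, $T_x^{n_\xi(x)}(B_x(z,\xi))=\mathcal J_{\theta^{n_\xi(x)}(x)}$ for every $z\in\mathcal J_x$. For $y=(x,z)$, (i)-(ii) give a unique continuous inverse branch $T_y^{-1}:B_{\theta(x)}(T_x(z),\xi)\to B_x(z,\eta_x)$ of $T_x$ sending $T_x(z)$ to $z$, and $T_y^{-n}=T_y^{-1}\circ T_{T(y)}^{-1}\circ\dots\circ T_{T^{n-1}(y)}^{-1}:B_{\theta^n(x)}(T_x^n(z),\xi)\to B_x(z,\xi)$. Function spaces. $\mathcal C^0(\mathcal J)$: functions $g:\mathcal J\to\mathbb R$ with $g_x:=g|_{\mathcal J_x}$ continuous for a.e. $x$ and $x\mapsto\|g_x\|_\infty$ measurable; $\mathcal C^1(\mathcal J)$: those with $\int_X\|g_x\|_\infty dm(x)<\infty$. Fix $\alpha\in(0,1]$. $v_\alpha(g_x)$ is the infimum of constants $C$ with $|g_x(z_1)-g_x(z_2)|\le C\varrho_x(z_1,z_2)^\alpha$ for all $z_1,z_2\in\mathcal J_x$ with $\varrho_x(z_1,z_2)\le\eta_x$. $\mathcal H^\alpha(\mathcal J)$: the $\varphi\in\mathcal C^1(\mathcal J)$ for which there is a measurable $H:X\to[1,\infty)$ with $\log H\in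 L^1(m)$ and $v_\alpha(\varphi_x)\le H_x$ for a.e. $x$. Associated measures. $\mathcal L_xg_x(w)=\sum_{T_x(z)=w}g_x(z)e^{\varphi_x(z)}$; $\{\nu_x\}$ is the ($m$-a.e. unique) family of Borel probability measures on $\mathcal J_x$ with $\mathcal L_x^*\nu_{\theta(x)}=\lambda_x\nu_x$ a.e., $\lambda_x=\nu_{\theta(x)}(\mathcal L_x1)$; $q\in\mathcal C^0(\mathcal J)$ is the ($m$-a.e. unique) function with $\mathcal L_xq_x=\lambda_xq_{\theta(x)}$, $\nu_x(q_x)=1$ a.e.; $\mu_x=q_x\nu_x$. Gibbs family. A family of Borel probability measures $\{\mu'_x\}_{x\in X}$, $\mu_x'$ on $\mathcal J_x$, is a Gibbs family for $\varphi$ if there exist a measurable $D_\varphi:X\to[1,\infty)$ and a function $x\mapsto P_x\in\mathbb R$ (pseudo-pressure function) such that $$\big(D_\varphi(x)D_\varphi(\theta^n(x))\big)^{-1}\le\frac{\mu'_x\big(T_y^{-n}(B(T^n(y),\xi))\big)}{\exp(S_n\varphi(y)-S_nP_x)}\le D_\varphi(x)D_\varphi(\theta^n(x))$$ for every $n\ge0$, a.e. $x\in X$, every $z\in\mathcal J_x$, with $y=(x,z)$; here $S_n\varphi(y)=\sum_{j=0}^{n-1}\varphi(T^j(y))$ and $S_nP_x=\sum_{j=0}^{n-1}P_{\theta^j(x)}$. Measurability of cardinality of covers: there is a measurable $X\ni x\mapsto a_x\in\mathbb N$ such that for every $x\in X$ there are $w_x^1,\dots,w_x^{a_x}\in\mathcal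 J_x$ with $\bigcup_{j=1}^{a_x}B_x(w_x^j,\xi)=\mathcal J_x$.
   Formalization: Two assumptions are added: for a.e. x, every point of B(T_x(z),ξ) has exactly one T_x-preimage in B_x(z,η_x) (not implied by (i)-(ii)); and, for the claim on μ_x only, x ↦ inf q_x is measurable (without it q need not be unique and μ_x may fail to be Gibbs). *)

theory Defs
  imports "HOL-Probability.Probability"
begin

text \<open>
  The fibre \<open>(\<J>\<^sub>x, \<rho>\<^sub>x)\<close> is the abstract metric space \<open>J x\<close>, and its ball \<open>B\<^sub>x(z, r)\<close> is
  \<open>mball_of (J x) z r\<close>. All fibres live in one ambient type, which costs no generality.
  A function on the union of the fibres is written \<open>g x z\<close>; only its values at
  \<open>x \<in> space M\<close>, \<open>z \<in> mspace (J x)\<close> matter. Everything that is only defined almost everywhere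
  (families of measures in particular) is constrained only almost everywhere.
\<close>

text \<open>Invertibility is meant in the measurable category: the inverse of \<open>\<theta>\<close> is measurable, too.\<close>

definition ergodic_base :: "'x measure \<Rightarrow> ('x \<Rightarrow> 'x) \<Rightarrow> bool" where
  "ergodic_base M \<theta> \<longleftrightarrow>
     prob_space M \<and>
     bij_betw \<theta> (space M) (space M) \<and> \<theta> \<in> measurable M M \<and>
     inv_into (space M) \<theta> \<in> measurable M M \<and>
     distr M M \<theta> = M \<and>
     (\<forall>A\<in>sets M. \<theta> -` A \<inter> space M = A \<longrightarrow> measure M A = 0 \<or> measure M A = 1)"

primrec fibre_iter :: "('x \<Rightarrow> 'x) \<Rightarrow> ('x \<Rightarrow> 'z \<Rightarrow> 'z) \<Rightarrow> nat \<Rightarrow> 'x \<Rightarrow> 'z \<Rightarrow> 'z" where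
  "fibre_iter \<theta> T 0 x z = z"
| "fibre_iter \<theta> T (Suc n) x z = T ((\<theta> ^^ n) x) (fibre_iter \<theta> T n x z)"

definition fibre_degree ::
    "('x \<Rightarrow> 'x) \<Rightarrow> ('x \<Rightarrow> 'z metric) \<Rightarrow> ('x \<Rightarrow> 'z \<Rightarrow> 'z) \<Rightarrow> 'x \<Rightarrow> ennreal" where
  "fibre_degree \<theta> J T x =
     (SUP w\<in>mspace (J (\<theta> x)). emeasure (count_space UNIV) {z \<in> mspace (J x). T x z = w})"

definition expanding_random_map ::
    "'x measure \<Rightarrow> ('x \<Rightarrow> 'x) \<Rightarrow> ('x \<Rightarrow> 'z metric) \<Rightarrow> ('x \<Rightarrow> 'z \<Rightarrow> 'z) \<Rightarrow> ('x \<Rightarrow> real) \<Rightarrow> real \<Rightarrow> bool"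
  where
  "expanding_random_map M \<theta> J T \<eta> \<xi> \<longleftrightarrow>
     (\<forall>x\<in>space M.
        mspace (J x) \<noteq> {} \<and> compact_space (mtopology_of (J x)) \<and>
        (\<forall>z1\<in>mspace (J x). \<forall>z2\<in>mspace (J x). mdist (J x) z1 z2 \<le> 1) \<and>
        continuous_map (mtopology_of (J x)) (mtopology_of (J (\<theta> x))) (T x) \<and>
        open_map (mtopology_of (J x)) (mtopology_of (J (\<theta> x))) (T x) \<and>
        T x ` mspace (J x) = mspace (J (\<theta> x))) \<and>
     (\<forall>x\<in>space M. \<eta> x > 0) \<and> \<xi> > 0 \<and>
     (\<forall>x\<in>space M. \<forall>z\<in>mspace (J x).
        mball_of (J (\<theta> x)) (T x z) \<xi> \<subseteq> T x ` mball_of (J x) z (\<eta> x)) \<and>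
     (\<exists>\<gamma>\<in>borel_measurable M. (\<forall>x\<in>space M. \<gamma> x > 1) \<and>
        (AE x in M. \<forall>z1\<in>mspace (J x). \<forall>z2\<in>mspace (J x). mdist (J x) z1 z2 < \<eta> x \<longrightarrow>
           mdist (J (\<theta> x)) (T x z1) (T x z2) \<ge> \<gamma> x * mdist (J x) z1 z2)) \<and>
     fibre_degree \<theta> J T \<in> borel_measurable M \<and>
     (\<exists>N\<in>measurable M (count_space (UNIV :: nat set)).
        AE x in M. \<forall>z\<in>mspace (J x).
          fibre_iter \<theta> T (N x) x ` mball_of (J x) z \<xi> = mspace (J ((\<theta> ^^ N x) x)))"

text \<open>
  Inverse branches. Existence of a preimage in \<open>B\<^sub>x(z, \<eta> x)\<close> of every point of the \<open>\<xi>\<close>-ball is part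
  of the definition of an expanding random map. Its uniqueness follows from the expansion
  property when \<open>\<eta> x\<close> is not too small compared with \<open>\<xi>\<close>, but not in general: two preimages in
  \<open>B\<^sub>x(z, \<eta> x)\<close> may have distance at least \<open>\<eta> x\<close> (for the doubling map and large \<open>\<xi>\<close> there is then
  not even a continuous branch). So the standing assertion that inverse branches are
  uniquely determined is a hypothesis here. Continuity is a consequence.
\<close>

definition unique_inverse_branches ::
    "'x measure \<Rightarrow> ('x \<Rightarrow> 'x) \<Rightarrow> ('x \<Rightarrow> 'z metric) \<Rightarrow> ('x \<Rightarrow> 'z \<Rightarrow> 'z) \<Rightarrow> ('x \<Rightarrow> real) \<Rightarrow> real \<Rightarrow> bool"
  where
  "unique_inverse_branches M \<theta> J T \<eta> \<xi> \<longleftrightarrow>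
     (AE x in M. \<forall>z\<in>mspace (J x). \<forall>w\<in>mball_of (J (\<theta> x)) (T x z) \<xi>.
        \<exists>!u. u \<in> mball_of (J x) z (\<eta> x) \<and> T x u = w)"

definition inverse_branch ::
    "('x \<Rightarrow> 'z metric) \<Rightarrow> ('x \<Rightarrow> 'z \<Rightarrow> 'z) \<Rightarrow> ('x \<Rightarrow> real) \<Rightarrow> 'x \<Rightarrow> 'z \<Rightarrow> 'z \<Rightarrow> 'z" where
  "inverse_branch J T \<eta> x z w = (THE u. u \<in> mball_of (J x) z (\<eta> x) \<and> T x u = w)"

primrec inverse_branch_iter ::
    "('x \<Rightarrow> 'x) \<Rightarrow> ('x \<Rightarrow> 'z metric) \<Rightarrow> ('x \<Rightarrow> 'z \<Rightarrow> 'z) \<Rightarrow> ('x \<Rightarrow> real) \<Rightarrow> nat \<Rightarrow> 'x \<Rightarrow> 'z \<Rightarrow> 'z \<Rightarrow> 'z"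
  where
  "inverse_branch_iter \<theta> J T \<eta> 0 x z w = w"
| "inverse_branch_iter \<theta> J T \<eta> (Suc n) x z w =
     inverse_branch J T \<eta> x z (inverse_branch_iter \<theta> J T \<eta> n (\<theta> x) (T x z) w)"

definition fibre_norm :: "('x \<Rightarrow> 'z metric) \<Rightarrow> ('x \<Rightarrow> 'z \<Rightarrow> real) \<Rightarrow> 'x \<Rightarrow> ennreal" where
  "fibre_norm J g x = (SUP z\<in>mspace (J x). ennreal \<bar>g x z\<bar>)"

definition C0_space :: "'x measure \<Rightarrow> ('x \<Rightarrow> 'z metric) \<Rightarrow> ('x \<Rightarrow> 'z \<Rightarrow> real) set" where
  "C0_space M J =
     {g. (AE x in M. continuous_map (mtopology_of (J x)) euclideanreal (g x)) \<and>
         fibre_norm J g \<in> borel_measurable M}"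

definition C1_space :: "'x measure \<Rightarrow> ('x \<Rightarrow> 'z metric) \<Rightarrow> ('x \<Rightarrow> 'z \<Rightarrow> real) set" where
  "C1_space M J = {g \<in> C0_space M J. (\<integral>\<^sup>+x. fibre_norm J g x \<partial>M) < \<infinity>}"

definition holder_seminorm ::
    "('x \<Rightarrow> 'z metric) \<Rightarrow> ('x \<Rightarrow> real) \<Rightarrow> real \<Rightarrow> ('x \<Rightarrow> 'z \<Rightarrow> real) \<Rightarrow> 'x \<Rightarrow> ennreal" where
  "holder_seminorm J \<eta> \<alpha> g x =
     Inf {ennreal C |C. 0 \<le> C \<and>
       (\<forall>z1\<in>mspace (J x). \<forall>z2\<in>mspace (J x). mdist (J x) z1 z2 \<le> \<eta> x \<longrightarrow>
          \<bar>g x z1 - g x z2\<bar> \<le> C * mdist (J x) z1 z2 powr \<alpha>)}"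

definition holder_space ::
    "'x measure \<Rightarrow> ('x \<Rightarrow> 'z metric) \<Rightarrow> ('x \<Rightarrow> real) \<Rightarrow> real \<Rightarrow> ('x \<Rightarrow> 'z \<Rightarrow> real) set" where
  "holder_space M J \<eta> \<alpha> =
     {g \<in> C1_space M J. \<exists>H\<in>borel_measurable M.
        (\<forall>x\<in>space M. H x \<ge> 1) \<and> integrable M (\<lambda>x. ln (H x)) \<and>
        (AE x in M. holder_seminorm J \<eta> \<alpha> g x \<le> ennreal (H x))}"

text \<open>For almost every \<open>x\<close> the sum below is finite, because the fibres of \<open>T x\<close> are finite then.\<close>

definition transfer_operator ::
    "('x \<Rightarrow> 'z metric) \<Rightarrow> ('x \<Rightarrow> 'z \<Rightarrow> 'z) \<Rightarrow> ('x \<Rightarrow> 'z \<Rightarrow> real) \<Rightarrow> 'x \<Rightarrow> ('z \<Rightarrow> real) \<Rightarrow> 'z \<Rightarrow> real" where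
  "transfer_operator J T \<phi> x g w = (\<Sum>z | z \<in> mspace (J x) \<and> T x z = w. g z * exp (\<phi> x z))"

definition fibre_borel :: "'z metric \<Rightarrow> 'z measure" where
  "fibre_borel m = sigma (mspace m) {U. openin (mtopology_of m) U}"

definition borel_probability_on :: "'z metric \<Rightarrow> 'z measure \<Rightarrow> bool" where
  "borel_probability_on m \<mu> \<longleftrightarrow> prob_space \<mu> \<and> sets \<mu> = sets (fibre_borel m)"

definition eigenvalue ::
    "('x \<Rightarrow> 'x) \<Rightarrow> ('x \<Rightarrow> 'z metric) \<Rightarrow> ('x \<Rightarrow> 'z \<Rightarrow> 'z) \<Rightarrow> ('x \<Rightarrow> 'z \<Rightarrow> real) \<Rightarrow> ('x \<Rightarrow> 'z measure) \<Rightarrow> 'x \<Rightarrow> real"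
  where
  "eigenvalue \<theta> J T \<phi> \<nu> x = (\<integral>w. transfer_operator J T \<phi> x (\<lambda>_. 1) w \<partial>\<nu> (\<theta> x))"

text \<open>The dual identity \<open>\<L>\<^sub>x\<^sup>* \<nu> (\<theta> x) = \<lambda>\<^sub>x \<nu> x\<close> is an identity of functionals on \<open>C(\<J>\<^sub>x)\<close>.\<close>

definition eigenmeasures ::
    "'x measure \<Rightarrow> ('x \<Rightarrow> 'x) \<Rightarrow> ('x \<Rightarrow> 'z metric) \<Rightarrow> ('x \<Rightarrow> 'z \<Rightarrow> 'z) \<Rightarrow> ('x \<Rightarrow> 'z \<Rightarrow> real) \<Rightarrow>
     ('x \<Rightarrow> 'z measure) \<Rightarrow> bool" where
  "eigenmeasures M \<theta> J T \<phi> \<nu> \<longleftrightarrow>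
     (AE x in M. borel_probability_on (J x) (\<nu> x)) \<and>
     (AE x in M. \<forall>g. continuous_map (mtopology_of (J x)) euclideanreal g \<longrightarrow>
        (\<integral>w. transfer_operator J T \<phi> x g w \<partial>\<nu> (\<theta> x)) = eigenvalue \<theta> J T \<phi> \<nu> x * (\<integral>z. g z \<partial>\<nu> x))"

definition eigenfunction ::
    "'x measure \<Rightarrow> ('x \<Rightarrow> 'x) \<Rightarrow> ('x \<Rightarrow> 'z metric) \<Rightarrow> ('x \<Rightarrow> 'z \<Rightarrow> 'z) \<Rightarrow> ('x \<Rightarrow> 'z \<Rightarrow> real) \<Rightarrow>
     ('x \<Rightarrow> 'z measure) \<Rightarrow> ('x \<Rightarrow> 'z \<Rightarrow> real) \<Rightarrow> bool" where
  "eigenfunction M \<theta> J T \<phi> \<nu> q \<longleftrightarrow>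
     q \<in> C0_space M J \<and>
     (AE x in M. \<forall>w\<in>mspace (J (\<theta> x)).
        transfer_operator J T \<phi> x (q x) w = eigenvalue \<theta> J T \<phi> \<nu> x * q (\<theta> x) w) \<and>
     (AE x in M. (\<integral>z. q x z \<partial>\<nu> x) = 1)"

text \<open>
  Membership of \<open>q\<close> in \<open>C0_space\<close> only makes \<open>sup |q x|\<close> measurable. Without measurability of
  \<open>inf (q x)\<close> an eigenfunction may be perturbed along the orbits of a non-measurable section of
  \<open>\<theta>\<close> so that \<open>sup |q x|\<close> remains constant but the set of all \<open>x\<close> for which \<open>q x\<close> vanishes on a
  nonempty open set is not null; then \<open>q\<close> is not unique and \<open>q x \<nu> x\<close> is not a Gibbs family.
\<close>

definition measurable_fibre_inf ::
    "'x measure \<Rightarrow> ('x \<Rightarrow> 'z metric) \<Rightarrow> ('x \<Rightarrow> 'z \<Rightarrow> real) \<Rightarrow> bool" where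
  "measurable_fibre_inf M J g \<longleftrightarrow> (\<lambda>x. INF z\<in>mspace (J x). ereal (g x z)) \<in> borel_measurable M"

text \<open>
  \<open>\<mu> x = q x \<nu> x\<close>. Nonnegativity of \<open>q\<close> is not assumed separately, it follows from \<open>\<mu> x\<close> being a
  measure. The constant \<open>density\<close> would silently replace negative values of \<open>q x\<close> by \<open>0\<close>.
\<close>

definition has_densities ::
    "'x measure \<Rightarrow> ('x \<Rightarrow> 'z metric) \<Rightarrow> ('x \<Rightarrow> 'z measure) \<Rightarrow> ('x \<Rightarrow> 'z \<Rightarrow> real) \<Rightarrow> ('x \<Rightarrow> 'z measure) \<Rightarrow> bool"
  where
  "has_densities M J \<nu> q \<mu> \<longleftrightarrow>
     (AE x in M. sets (\<mu> x) = sets (fibre_borel (J x)) \<and>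
        (\<forall>A\<in>sets (fibre_borel (J x)). measure (\<mu> x) A = (LINT z:A|\<nu> x. q x z)))"

definition gibbs_family ::
    "'x measure \<Rightarrow> ('x \<Rightarrow> 'x) \<Rightarrow> ('x \<Rightarrow> 'z metric) \<Rightarrow> ('x \<Rightarrow> 'z \<Rightarrow> 'z) \<Rightarrow> ('x \<Rightarrow> real) \<Rightarrow> real \<Rightarrow>
     ('x \<Rightarrow> 'z \<Rightarrow> real) \<Rightarrow> ('x \<Rightarrow> 'z measure) \<Rightarrow> bool" where
  "gibbs_family M \<theta> J T \<eta> \<xi> \<phi> \<mu> \<longleftrightarrow>
     (AE x in M. borel_probability_on (J x) (\<mu> x)) \<and>
     (\<exists>D\<in>borel_measurable M. \<exists>P :: 'x \<Rightarrow> real. (\<forall>x\<in>space M. D x \<ge> 1) \<and>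
        (\<forall>n. AE x in M. \<forall>z\<in>mspace (J x).
           let A = inverse_branch_iter \<theta> J T \<eta> n x z `
                     mball_of (J ((\<theta> ^^ n) x)) (fibre_iter \<theta> T n x z) \<xi>;
               S\<phi> = (\<Sum>j<n. \<phi> ((\<theta> ^^ j) x) (fibre_iter \<theta> T j x z));
               SP = (\<Sum>j<n. P ((\<theta> ^^ j) x));
               r = measure (\<mu> x) A / exp (S\<phi> - SP)
           in inverse (D x * D ((\<theta> ^^ n) x)) \<le> r \<and> r \<le> D x * D ((\<theta> ^^ n) x)))"

definition measurable_cover_cardinality ::
    "'x measure \<Rightarrow> ('x \<Rightarrow> 'z metric) \<Rightarrow> real \<Rightarrow> bool" where
  "measurable_cover_cardinality M J \<xi> \<longleftrightarrow>
     (\<exists>a\<in>measurable M (count_space (UNIV :: nat set)). \<forall>x\<in>space M. \<exists>w :: nat \<Rightarrow> 'z.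
        (\<forall>j\<in>{1..a x}. w j \<in> mspace (J x)) \<and>
        (\<Union>j\<in>{1..a x}. mball_of (J x) (w j) \<xi>) = mspace (J x))"

definition equivalent_measures :: "'z measure \<Rightarrow> 'z measure \<Rightarrow> bool" where
  "equivalent_measures \<mu> \<nu> \<longleftrightarrow> absolutely_continuous \<mu> \<nu> \<and> absolutely_continuous \<nu> \<mu>"

end

theory Submission
  imports Defs
begin

text \<open>
  By duality, passing from \<open>x\<close> to \<open>\<theta> x\<close> multiplies the \<open>\<nu>\<close>-mass of an \<open>n\<close>-cylinder by \<open>\<lambda>\<^sub>x e\<^bsup>-\<phi>\<^esup>\<close> up to
  the oscillation of \<open>\<phi> x\<close> on it. These oscillations add up to at most a series in the backward orbit of
  \<open>\<theta>\<^sup>n x\<close> which converges almost everywhere: the expansion rates have positive logarithm, so by ergodicity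
  their products grow exponentially, while \<open>ln H \<in> L\<^sup>1\<close> makes \<open>H\<close> subexponential along orbits. After
  \<open>n\<close> steps the cylinder has become a \<open>\<xi>\<close>-ball, whose mass is bounded below by exactness.
  Since cylinders shrink, \<open>\<nu> x\<close> has full support, and a nonnegative eigenfunction is bounded below by a positive
  constant on the fibre over \<open>\<theta>\<^sup>n x\<close> for all large \<open>n\<close>, hence by invariance of \<open>M\<close> on almost every fibre.
  Two Gibbs families are compared at the times when their constants and the cardinality of the cover are
  bounded: the total masses being \<open>1\<close> forces the normalising factors to agree up to a bounded
  factor, so each measure of a closed set is at most a constant times the other one.
\<close>

section \<open>Ergodic theory of the base\<close>

text \<open>Expansion rates and Hoelder constants vary from fibre to fibre, so the distortion of a
  cylinder has no bound uniform in the base point. It has one uniform in the depth \<open>n\<close>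
  if the bound may depend on the end point \<open>(\<theta> ^^ n) x\<close>: this is why the inverse
  of \<open>\<theta>\<close> enters and why the Gibbs constant of \<open>\<nu>\<close> is a function
  of the end point alone. Almost everywhere statements serve to find a forward invariant set
  \<open>G\<close> containing almost every point; along an orbit in \<open>G\<close> all arguments
  are deterministic and are carried out in locales. The dual identity is available for continuous
  functions only. Since cylinders are open and the maps \<open>T x\<close> are open, it suffices to
  extend it to indicators of open sets. Ergodicity is used through one consequence of the maximal
  inequality: orbit sums of a function with negative mean are bounded above. The pseudo-pressure of
  a second Gibbs family is an arbitrary function, so its growth cannot be estimated along the orbit;
  it is eliminated at each single \<open>n\<close> by comparing total masses.\<close>

lemma (in prob_space) AE_preserving:
  assumes "\<tau> \<in> measurable M M" "distr M M \<tau> = M" "AE x in M. P x"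
  shows "AE x in M. P (\<tau> x)"
  by (rule AE_distrD[OF assms(1), of P, unfolded assms(2), OF assms(3)])

lemma funpow_measurable:
  assumes "\<tau> \<in> measurable M M"
  shows "(\<tau> ^^ n) \<in> measurable M M"
proof (induction n)
  case (Suc n)
  then show ?case using measurable_comp[OF Suc assms] by (simp add: comp_def)
qed simp

lemma distr_funpow:
  assumes "\<tau> \<in> measurable M M" "distr M M \<tau> = M"
  shows "distr M M (\<tau> ^^ n) = M"
proof (induction n)
  case 0
  then show ?case by (simp add: id_def)
next
  case (Suc n)
  have "distr M M (\<tau> \<circ> (\<tau> ^^ n)) = distr (distr M M (\<tau> ^^ n)) M \<tau>"
    by (rule distr_distr[symmetric]) (auto intro: assms funpow_measurable)
  then show ?case using Suc assms(2) by (simp only: funpow.simps)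
qed

lemma (in prob_space) AE_orbit:
  assumes "\<tau> \<in> measurable M M" "distr M M \<tau> = M" "AE x in M. P x"
  shows "AE x in M. \<forall>n. P ((\<tau> ^^ n) x)"
  using AE_preserving[OF funpow_measurable[OF assms(1)] distr_funpow[OF assms(1,2)] assms(3)]
  by (simp add: AE_all_countable)

section \<open>Invariant integrals and the maximal inequality\<close>

lemma integral_preserving:
  fixes f :: "'x \<Rightarrow> real"
  assumes "\<tau> \<in> measurable M M" "distr M M \<tau> = M" "f \<in> borel_measurable M"
  shows "(\<integral>x. f (\<tau> x) \<partial>M) = (\<integral>x. f x \<partial>M)"
  using integral_distr[OF assms(1,3)] assms(2) by simp

lemma integrable_preserving:
  fixes f :: "'x \<Rightarrow> real"
  assumes "\<tau> \<in> measurable M M" "distr M M \<tau> = M" "integrable M f"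
  shows "integrable M (\<lambda>x. f (\<tau> x))"
  using integrable_distr[OF assms(1)] assms(2,3) by metis

text \<open>\<open>max_orbit_sum \<tau> f N\<close> is the maximum of the orbit sums \<open>\<Sum>i<k. f (\<tau>\<^sup>i x)\<close> over \<open>k \<le> N\<close>.\<close>

primrec max_orbit_sum :: "('x \<Rightarrow> 'x) \<Rightarrow> ('x \<Rightarrow> real) \<Rightarrow> nat \<Rightarrow> 'x \<Rightarrow> real" where
  "max_orbit_sum \<tau> f 0 x = 0"
| "max_orbit_sum \<tau> f (Suc n) x = max 0 (f x + max_orbit_sum \<tau> f n (\<tau> x))"

lemma max_orbit_sum_nonneg: "max_orbit_sum \<tau> f n x \<ge> 0"
  by (induction n) auto

lemma max_orbit_sum_Suc_mono: "max_orbit_sum \<tau> f n x \<le> max_orbit_sum \<tau> f (Suc n) x"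
proof (induction n arbitrary: x)
  case (Suc n)
  show ?case using Suc[of "\<tau> x"] by (simp add: max_def)
qed simp

lemma orbit_sum_le_max: "(\<Sum>i<n. f ((\<tau> ^^ i) x)) \<le> max_orbit_sum \<tau> f n x"
proof (induction n arbitrary: x)
  case (Suc n)
  have "(\<Sum>i<Suc n. f ((\<tau> ^^ i) x)) = f x + (\<Sum>i<n. f ((\<tau> ^^ i) (\<tau> x)))"
    by (simp add: sum.lessThan_Suc_shift funpow_swap1 del: sum.lessThan_Suc)
  then show ?case using Suc[of "\<tau> x"] by simp
qed simp

lemma max_orbit_sum_integrable:
  assumes "\<tau> \<in> measurable M M" "distr M M \<tau> = M" "integrable M f"
  shows "integrable M (max_orbit_sum \<tau> f n)"
proof (induction n)
  case (Suc n)
  have "integrable M (\<lambda>x. max 0 (f x + max_orbit_sum \<tau> f n (\<tau> x)))"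
    by (intro integrable_max integrable_zero Bochner_Integration.integrable_add assms(3)
        integrable_preserving[OF assms(1,2) Suc])
  then show ?case by simp
qed simp

text \<open>Garsia's argument: writing \<open>F\<^sub>n\<close> for \<^term>\<open>max_orbit_sum \<tau> f n\<close>, one has
  \<open>F\<^sub>n\<^sub>+\<^sub>1 - F\<^sub>n \<circ> \<tau> \<le> f\<close> where \<open>F\<^sub>n\<^sub>+\<^sub>1 > 0\<close>, and the left-hand side is nonpositive elsewhere.\<close>

lemma maximal_ergodic:
  assumes \<tau>: "\<tau> \<in> measurable M M" "distr M M \<tau> = M" and f: "integrable M f"
  shows "0 \<le> (\<integral>x. indicator {x. max_orbit_sum \<tau> f (Suc n) x > 0} x * f x \<partial>M)"
proof -
  let ?F = "max_orbit_sum \<tau> f" and ?E = "{x. max_orbit_sum \<tau> f (Suc n) x > 0}"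
  note intF = max_orbit_sum_integrable[OF \<tau> f]
  have [measurable]: "f \<in> borel_measurable M" "?F k \<in> borel_measurable M" for k
    by (rule borel_measurable_integrable[OF f], rule borel_measurable_integrable[OF intF])
  note [measurable] = \<tau>(1)
  have int1: "integrable M (\<lambda>x. indicator ?E x * f x)"
    by (rule Bochner_Integration.integrable_bound[OF f]) (auto simp: indicator_def simp del: max_orbit_sum.simps)
  have int2: "integrable M (\<lambda>x. ?F n (\<tau> x))"
    by (rule integrable_preserving[OF \<tau> intF])
  have "(\<integral>x. ?F (Suc n) x \<partial>M) \<le> (\<integral>x. indicator ?E x * f x + ?F n (\<tau> x) \<partial>M)"
  proof (intro integral_mono intF Bochner_Integration.integrable_add int1 int2)
    fix x
    show "?F (Suc n) x \<le> indicator ?E x * f x + ?F n (\<tau> x)"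
      using max_orbit_sum_nonneg[of \<tau> f n "\<tau> x"] by (auto simp: indicator_def max_def)
  qed
  also have "\<dots> = (\<integral>x. indicator ?E x * f x \<partial>M) + (\<integral>x. ?F n x \<partial>M)"
    using int1 int2 integral_preserving[OF \<tau>, of "?F n"] by simp
  also have "(\<integral>x. ?F n x \<partial>M) \<le> (\<integral>x. ?F (Suc n) x \<partial>M)"
    by (intro integral_mono intF max_orbit_sum_Suc_mono)
  finally show ?thesis by linarith
qed

text \<open>Bijectivity is left out so that the same lemmas serve \<open>\<theta>\<close> and its
  inverse.\<close>

definition ergodic_map :: "'x measure \<Rightarrow> ('x \<Rightarrow> 'x) \<Rightarrow> bool" where
  "ergodic_map M \<tau> \<longleftrightarrow> prob_space M \<and> \<tau> \<in> measurable M M \<and> distr M M \<tau> = M \<and>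
     (\<forall>A\<in>sets M. \<tau> -` A \<inter> space M = A \<longrightarrow> measure M A = 0 \<or> measure M A = 1)"

lemma ergodic_mapD:
  assumes "ergodic_map M \<tau>"
  shows "prob_space M" "\<tau> \<in> measurable M M" "distr M M \<tau> = M"
    "A \<in> sets M \<Longrightarrow> \<tau> -` A \<inter> space M = A \<Longrightarrow> measure M A = 0 \<or> measure M A = 1"
  using assms unfolding ergodic_map_def by blast+

text \<open>If the sums were unbounded on a set of full measure, the indicators in
  \<open>maximal_ergodic\<close> would tend to 1 almost everywhere, and in the limit the mean of
  \<open>f\<close> would be nonnegative. By ergodicity the only alternative is unboundedness on a
  null set.\<close>

lemma ergodic_sums_bounded_above:
  fixes f :: "'x \<Rightarrow> real"
  assumes erg: "ergodic_map M \<tau>" and f: "integrable M f" and neg: "(\<integral>x. f x \<partial>M) < 0"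
  shows "AE x in M. \<exists>C. \<forall>n. (\<Sum>i<n. f ((\<tau> ^^ i) x)) \<le> C"
proof -
  interpret prob_space M by (rule ergodic_mapD[OF erg])
  have \<tau>: "\<tau> \<in> measurable M M" "distr M M \<tau> = M" by (rule ergodic_mapD[OF erg])+
  note [measurable] = \<tau>(1)
  let ?F = "max_orbit_sum \<tau> f"
  note intF = max_orbit_sum_integrable[OF \<tau> f]
  have [measurable]: "f \<in> borel_measurable M" "?F k \<in> borel_measurable M" for k
    by (rule borel_measurable_integrable[OF f], rule borel_measurable_integrable[OF intF])
  \<comment> \<open>Thresholds run over the naturals, which keeps \<open>E\<close> a countable
    combination of measurable sets.\<close>
  define E where "E = {x\<in>space M. \<forall>C::nat. \<exists>n. ?F n x > real C}"
  have E[measurable]: "E \<in> sets M" unfolding E_def by measurable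
  \<comment> \<open>Passing from \<open>\<tau> x\<close> to \<open>x\<close> changes the sums by the
    single term \<open>f x\<close>, which \<open>K\<close> absorbs; hence \<open>E\<close> is
    invariant.\<close>
  have unb: "(\<forall>C::nat. \<exists>n. ?F n x > real C) \<longleftrightarrow> (\<forall>C::nat. \<exists>n. ?F n (\<tau> x) > real C)" for x
  proof safe
    fix C :: nat assume H: "\<forall>C::nat. \<exists>n. ?F n x > real C"
    obtain K :: nat where K: "real C + \<bar>f x\<bar> \<le> real K" using real_arch_simple by blast
    obtain n where "?F n x > real K" using H by blast
    moreover then obtain k where "n = Suc k" by (cases n) auto
    ultimately have "?F k (\<tau> x) > real C" using K by (auto simp: max_def split: if_splits)
    then show "\<exists>n. ?F n (\<tau> x) > real C" by blast
  next
    fix C :: nat assume H: "\<forall>C::nat. \<exists>n. ?F n (\<tau> x) > real C"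
    obtain K :: nat where K: "real C + \<bar>f x\<bar> \<le> real K" using real_arch_simple by blast
    obtain n where "?F n (\<tau> x) > real K" using H by blast
    then have "?F (Suc n) x > real C" using K by auto
    then show "\<exists>n. ?F n x > real C" by blast
  qed
  have "\<tau> -` E \<inter> space M = E"
    using unb measurable_space[OF \<tau>(1)] by (auto simp: E_def)
  then have "prob E = 0 \<or> prob E = 1" using ergodic_mapD(4)[OF erg E] by blast
  moreover have "prob E \<noteq> 1"
  proof
    assume "prob E = 1"
    then have AE_E: "AE x in M. x \<in> E" using E by (simp add: prob_eq_1)
    let ?E = "\<lambda>n. {x. ?F (Suc n) x > 0}"
    have "(\<lambda>n. \<integral>x. indicator (?E n) x * f x \<partial>M) \<longlonglongrightarrow> (\<integral>x. f x \<partial>M)"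
    proof (rule integral_dominated_convergence)
      show "integrable M (\<lambda>x. \<bar>f x\<bar>)" using f by simp
      show "AE x in M. (\<lambda>n. indicator (?E n) x * f x) \<longlonglongrightarrow> f x"
        using AE_E
      proof eventually_elim
        fix x assume "x \<in> E"
        then obtain n where n: "?F n x > 0" by (auto simp: E_def dest: spec[of _ 0])
        have inc: "incseq (\<lambda>n. ?F n x)"
          by (rule incseq_SucI) (rule max_orbit_sum_Suc_mono)
        have "?F (Suc k) x > 0" if "k \<ge> n" for k
          using n incseqD[OF inc, of n "Suc k"] that by auto
        then have "eventually (\<lambda>k. indicator (?E k) x * f x = f x) sequentially"
          unfolding eventually_sequentially by (intro exI[of _ n]) (auto simp del: max_orbit_sum.simps)
        then show "(\<lambda>n. indicator (?E n) x * f x) \<longlonglongrightarrow> f x"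
          by (rule tendsto_eventually)
      qed
    qed (auto simp: indicator_def simp del: max_orbit_sum.simps)
    then have "0 \<le> (\<integral>x. f x \<partial>M)"
      by (rule LIMSEQ_le_const) (use maximal_ergodic[OF \<tau> f] in auto)
    then show False using neg by simp
  qed
  ultimately have "AE x in M. x \<notin> E" using E by (simp add: prob_eq_0)
  then show ?thesis
  proof (rule AE_mp, intro AE_I2 impI)
    fix x assume "x \<in> space M" "x \<notin> E"
    then obtain C :: nat where C: "\<And>n. ?F n x \<le> real C" by (auto simp: E_def not_less)
    show "\<exists>C. \<forall>n. (\<Sum>i<n. f ((\<tau> ^^ i) x)) \<le> C"
      using order_trans[OF orbit_sum_le_max C] by blast
  qed
qed

text \<open>With \<open>a\<close> half the mean of \<open>g\<close> truncated at 1, the function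
  \<open>a - min 1 g\<close> has mean \<open>- a\<close>, so its orbit sums are bounded above. The
  truncation makes the measurable function \<open>g\<close> integrable and only lowers its
  sums.\<close>

lemma ergodic_sums_linear_growth:
  fixes g :: "'x \<Rightarrow> real"
  assumes erg: "ergodic_map M \<tau>" and g: "g \<in> borel_measurable M" and pos: "\<And>x. x \<in> space M \<Longrightarrow> g x > 0"
  obtains a :: real where "a > 0" "AE x in M. \<exists>C. \<forall>n. a * real n - C \<le> (\<Sum>i<n. g ((\<tau> ^^ i) x))"
proof -
  interpret prob_space M by (rule ergodic_mapD[OF erg])
  have \<tau>: "\<tau> \<in> measurable M M" by (rule ergodic_mapD[OF erg])+
  note [measurable] = g
  let ?h = "\<lambda>x. min 1 (g x)"
  have int: "integrable M ?h"
    by (rule integrable_const_bound[of _ 1]) (auto intro!: AE_I2 simp: min_def less_imp_le pos)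
  define a where "a = (\<integral>x. ?h x \<partial>M) / 2"
  have "0 < (\<integral>x. ?h x \<partial>M)"
    using integral_less_AE_space[of "\<lambda>_. 0" ?h] int pos emeasure_space_1 by simp
  then have a: "a > 0" by (simp add: a_def)
  have "AE x in M. \<exists>C. \<forall>n. (\<Sum>i<n. a - ?h ((\<tau> ^^ i) x)) \<le> C"
    by (rule ergodic_sums_bounded_above[OF erg]) (use int a in \<open>auto simp: a_def prob_space\<close>)
  then have "AE x in M. \<exists>C. \<forall>n. a * real n - C \<le> (\<Sum>i<n. g ((\<tau> ^^ i) x))"
  proof eventually_elim
    fix x assume "\<exists>C. \<forall>n. (\<Sum>i<n. a - ?h ((\<tau> ^^ i) x)) \<le> C"
    then obtain C where C: "(\<Sum>i<n. a - ?h ((\<tau> ^^ i) x)) \<le> C" for n by blast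
    have "a * real n - C \<le> (\<Sum>i<n. g ((\<tau> ^^ i) x))" for n
    proof -
      have "(\<Sum>i<n. ?h ((\<tau> ^^ i) x)) \<le> (\<Sum>i<n. g ((\<tau> ^^ i) x))" by (intro sum_mono) auto
      then show ?thesis using C[of n] by (simp add: sum_subtractf mult.commute)
    qed
    then show "\<exists>C. \<forall>n. a * real n - C \<le> (\<Sum>i<n. g ((\<tau> ^^ i) x))" by blast
  qed
  with a show thesis by (rule that)
qed

text \<open>If an orbit avoided \<open>A\<close> from time \<open>k\<close> on, the sums of
  \<open>a - indicator A\<close> would be at least \<open>a * n - k\<close>, although this function
  has the negative mean \<open>- a\<close>.\<close>

lemma ergodic_infinitely_often:
  assumes erg: "ergodic_map M \<tau>" and A: "A \<in> sets M" and pos: "measure M A > 0"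
  shows "AE x in M. \<forall>k. \<exists>n\<ge>k. (\<tau> ^^ n) x \<in> A"
proof -
  interpret prob_space M by (rule ergodic_mapD[OF erg])
  define a where "a = measure M A / 2"
  have a: "a > 0" using pos by (simp add: a_def)
  have "AE x in M. \<exists>C. \<forall>n. (\<Sum>i<n. a - indicator A ((\<tau> ^^ i) x)) \<le> C"
  proof (rule ergodic_sums_bounded_above[OF erg])
    have i: "integrable M (indicator A :: _ \<Rightarrow> real)"
      by (rule integrable_real_indicator) (use A emeasure_eq_measure in auto)
    then show "integrable M (\<lambda>x. a - indicator A x)" by simp
    have "(\<integral>x. a - indicator A x \<partial>M) = a - measure M A"
      using i A by (simp add: prob_space)
    then show "(\<integral>x. a - indicator A x \<partial>M) < 0" using a by (simp add: a_def)
  qed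
  then show ?thesis
  proof eventually_elim
    fix x assume "\<exists>C. \<forall>n. (\<Sum>i<n. a - indicator A ((\<tau> ^^ i) x)) \<le> C"
    then obtain C where C: "(\<Sum>i<n. a - indicator A ((\<tau> ^^ i) x)) \<le> C" for n by blast
    show "\<forall>k. \<exists>n\<ge>k. (\<tau> ^^ n) x \<in> A"
    proof (rule ccontr)
      assume "\<not> ?thesis"
      then obtain k where k: "\<And>n. n \<ge> k \<Longrightarrow> (\<tau> ^^ n) x \<notin> A" by blast
      have le: "(\<Sum>i<n. indicator A ((\<tau> ^^ i) x)) \<le> real k" for n
      proof -
        have "(\<Sum>i<n. indicator A ((\<tau> ^^ i) x) :: real) \<le> (\<Sum>i<n. indicator {..<k} i)"
          by (intro sum_mono) (use k in \<open>auto simp: indicator_def intro: leI ccontr[of "_ < _"]\<close>)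
        also have "\<dots> = card ({..<n} \<inter> {..<k})" by (simp add: indicator_def sum.If_cases Int_def)
        also have "\<dots> \<le> real k" using card_mono[of "{..<k}" "{..<n} \<inter> {..<k}"] by simp
        finally show ?thesis .
      qed
      obtain n :: nat where "real n > (C + real k) / a" using reals_Archimedean2 by blast
      then have "a * real n > C + real k" using a by (simp add: field_simps)
      then show False using C[of n] le[of n] by (simp add: sum_subtractf mult.commute)
    qed
  qed
qed

text \<open>A Borel-Cantelli argument: by invariance the events that \<open>h\<close> exceeds
  \<open>\<epsilon> * n\<close> at the \<open>n\<close>-th orbit point have the same total measure
  as the events that it does so at the starting point, and at each point \<open>y\<close> this
  happens for at most \<open>1 + \<bar>h y\<bar> / \<epsilon>\<close> indices.\<close>

lemma (in prob_space) orbit_sublinear: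
  fixes h :: "'a \<Rightarrow> real"
  assumes \<tau>: "\<tau> \<in> measurable M M" "distr M M \<tau> = M"
    and h: "integrable M h" and \<epsilon>: "\<epsilon> > 0"
  shows "AE x in M. eventually (\<lambda>n. h ((\<tau> ^^ n) x) \<le> \<epsilon> * real n) sequentially"
proof -
  have [measurable]: "h \<in> borel_measurable M" "\<And>n. (\<tau> ^^ n) \<in> measurable M M"
    using h funpow_measurable[OF \<tau>(1)] by auto
  let ?g = "\<lambda>n y. indicator {y\<in>space M. h y > \<epsilon> * real n} y :: ennreal"
  have sum_le: "(\<Sum>n. ?g n y) \<le> ennreal (1 + \<bar>h y\<bar> / \<epsilon>)" for y
  proof -
    define N where "N = nat \<lfloor>\<bar>h y\<bar> / \<epsilon>\<rfloor>"
    have z: "?g n y = 0" if "n \<notin> {..N}" for n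
    proof -
      have "\<bar>h y\<bar> / \<epsilon> < real n" using that \<epsilon> unfolding N_def by (simp add: not_le floor_less_iff nat_less_iff)
      then have "\<not> h y > \<epsilon> * real n" using \<epsilon> by (simp add: field_simps)
      then show ?thesis by simp
    qed
    have "(\<Sum>n. ?g n y) = (\<Sum>n\<le>N. ?g n y)" by (rule suminf_finite) (use z in auto)
    also have "\<dots> \<le> (\<Sum>n\<le>N. 1)" by (intro sum_mono) (auto simp: indicator_def)
    also have "\<dots> = ennreal (real (Suc N))" by (simp add: ennreal_of_nat_eq_real_of_nat)
    also have "\<dots> \<le> ennreal (1 + \<bar>h y\<bar> / \<epsilon>)"
      by (intro ennreal_leI) (use \<epsilon> in \<open>auto simp: N_def\<close>)
    finally show ?thesis .
  qed
  have "(\<integral>\<^sup>+x. (\<Sum>n. ?g n ((\<tau> ^^ n) x)) \<partial>M) = (\<Sum>n. \<integral>\<^sup>+x. ?g n ((\<tau> ^^ n) x) \<partial>M)"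
    by (rule nn_integral_suminf) measurable
  also have "\<dots> = (\<Sum>n. \<integral>\<^sup>+x. ?g n x \<partial>M)"
  proof (rule suminf_cong)
    fix n
    show "(\<integral>\<^sup>+x. ?g n ((\<tau> ^^ n) x) \<partial>M) = (\<integral>\<^sup>+x. ?g n x \<partial>M)"
      using nn_integral_distr[of "\<tau> ^^ n" M M "?g n"] distr_funpow[OF \<tau>, of n] by simp
  qed
  also have "\<dots> = (\<integral>\<^sup>+x. (\<Sum>n. ?g n x) \<partial>M)"
    by (rule nn_integral_suminf[symmetric]) measurable
  also have "\<dots> \<le> (\<integral>\<^sup>+x. ennreal (1 + \<bar>h x\<bar> / \<epsilon>) \<partial>M)"
    by (intro nn_integral_mono sum_le)
  also have "\<dots> < \<infinity>"
  proof -
    have "integrable M (\<lambda>x. 1 + \<bar>h x\<bar> / \<epsilon>)" using h by simp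
    then show ?thesis using \<epsilon> by (subst nn_integral_eq_integral) auto
  qed
  finally have "(\<integral>\<^sup>+x. (\<Sum>n. ?g n ((\<tau> ^^ n) x)) \<partial>M) \<noteq> \<infinity>" by simp
  then have "AE x in M. (\<Sum>n. ?g n ((\<tau> ^^ n) x)) \<noteq> \<infinity>"
    by (intro nn_integral_noteq_infinite) measurable
  then show ?thesis
  proof (rule AE_mp, intro AE_I2 impI)
    fix x assume x: "x \<in> space M" and fin: "(\<Sum>n. ?g n ((\<tau> ^^ n) x)) \<noteq> \<infinity>"
    have "summable (\<lambda>n. indicator {y\<in>space M. h y > \<epsilon> * real n} ((\<tau> ^^ n) x) :: real)"
    proof (rule summable_suminf_not_top)
      show "(\<Sum>n. ennreal (indicator {y\<in>space M. h y > \<epsilon> * real n} ((\<tau> ^^ n) x))) \<noteq> top"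
        using fin by (simp add: ennreal_indicator)
    qed simp
    then have "(\<lambda>n. indicator {y\<in>space M. h y > \<epsilon> * real n} ((\<tau> ^^ n) x) :: real) \<longlonglongrightarrow> 0"
      by (rule summable_LIMSEQ_zero)
    then have "eventually (\<lambda>n. (indicator {y\<in>space M. h y > \<epsilon> * real n} ((\<tau> ^^ n) x) :: real) < 1) sequentially"
      by (rule order_tendstoD) simp
    then show "eventually (\<lambda>n. h ((\<tau> ^^ n) x) \<le> \<epsilon> * real n) sequentially"
    proof eventually_elim
      fix n assume "(indicator {y\<in>space M. h y > \<epsilon> * real n} ((\<tau> ^^ n) x) :: real) < 1"
      moreover have "(\<tau> ^^ n) x \<in> space M" by (rule measurable_space[OF funpow_measurable[OF \<tau>(1)] x])
      ultimately show "h ((\<tau> ^^ n) x) \<le> \<epsilon> * real n" by (auto simp: indicator_def split: if_splits)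
    qed
  qed
qed

text \<open>The products grow like \<open>exp (a * k)\<close>, so the power \<open>\<alpha>\<close>
  contributes \<open>exp (- \<alpha> * a * k)\<close>; half of this decay is given up to the
  subexponential growth of \<open>H\<close>, and a geometric series remains. With
  \<open>\<tau>\<close> the inverse of \<open>\<theta>\<close> the series dominates the distortion
  of all cylinders that end at a given fibre.\<close>

lemma orbit_series_finite:
  fixes H \<gamma> :: "'x \<Rightarrow> real"
  assumes erg: "ergodic_map M \<tau>" and \<gamma>: "\<gamma> \<in> borel_measurable M" "\<And>x. x \<in> space M \<Longrightarrow> \<gamma> x > 1"
    and H: "\<And>x. x \<in> space M \<Longrightarrow> H x \<ge> 1" "integrable M (\<lambda>x. ln (H x))"
    and \<alpha>: "\<alpha> > 0" and \<xi>: "\<xi> > 0"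
  shows "AE x in M. (\<Sum>k. ennreal (H ((\<tau> ^^ k) x) * (\<xi> / (\<Prod>i\<le>k. \<gamma> ((\<tau> ^^ i) x))) powr \<alpha>)) \<noteq> \<infinity>"
proof -
  interpret prob_space M by (rule ergodic_mapD[OF erg])
  have \<tau>: "\<tau> \<in> measurable M M" "distr M M \<tau> = M" by (rule ergodic_mapD[OF erg])+
  have pos: "0 < ln (\<gamma> x)" if "x \<in> space M" for x using \<gamma>(2)[OF that] by simp
  obtain a :: real where a: "a > 0"
    and growth: "AE x in M. \<exists>C. \<forall>n. a * real n - C \<le> (\<Sum>i<n. ln (\<gamma> ((\<tau> ^^ i) x)))"
    using ergodic_sums_linear_growth[OF erg borel_measurable_ln[OF \<gamma>(1)] pos] by blast
  define \<epsilon> where "\<epsilon> = \<alpha> * a / 2"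
  have \<epsilon>: "\<epsilon> > 0" using \<alpha> a by (simp add: \<epsilon>_def)
  show ?thesis using growth orbit_sublinear[OF \<tau> H(2) \<epsilon>]
  proof (rule AE_mp[OF AE_conjI], intro AE_I2 impI, elim conjE exE)
    fix x C assume x: "x \<in> space M" and C: "\<forall>n. a * real n - C \<le> (\<Sum>i<n. ln (\<gamma> ((\<tau> ^^ i) x)))"
      and ev: "eventually (\<lambda>n. ln (H ((\<tau> ^^ n) x)) \<le> \<epsilon> * real n) sequentially"
    have sp: "(\<tau> ^^ n) x \<in> space M" for n
      by (rule measurable_space[OF funpow_measurable[OF \<tau>(1)] x])
    let ?t = "\<lambda>k. H ((\<tau> ^^ k) x) * (\<xi> / (\<Prod>i\<le>k. \<gamma> ((\<tau> ^^ i) x))) powr \<alpha>"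
    have Hpos: "H ((\<tau> ^^ k) x) > 0" for k using H(1)[OF sp[of k]] by simp
    have gpos: "\<gamma> ((\<tau> ^^ k) x) > 0" for k using \<gamma>(2)[OF sp[of k]] by simp
    have t0: "?t k \<ge> 0" for k using Hpos[of k] by simp
    have bound: "?t k \<le> exp (\<alpha> * (ln \<xi> + C)) * exp (- \<epsilon>) ^ k"
      if k: "ln (H ((\<tau> ^^ k) x)) \<le> \<epsilon> * real k" for k
    proof -
      have P: "(\<Prod>i\<le>k. \<gamma> ((\<tau> ^^ i) x)) > 0" by (intro prod_pos) (use gpos in auto)
      have lnP: "ln (\<Prod>i\<le>k. \<gamma> ((\<tau> ^^ i) x)) = (\<Sum>i<Suc k. ln (\<gamma> ((\<tau> ^^ i) x)))"
        by (subst ln_prod) (use gpos in \<open>auto simp: lessThan_Suc_atMost less_imp_neq[symmetric]\<close>)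
      have "?t k = exp (ln (H ((\<tau> ^^ k) x)) + \<alpha> * (ln \<xi> - ln (\<Prod>i\<le>k. \<gamma> ((\<tau> ^^ i) x))))"
        using Hpos[of k] P \<xi> unfolding powr_def
        by (simp add: exp_add ln_div less_imp_neq[THEN not_sym] del: prod_zero_iff)
      also have "\<dots> \<le> exp (\<alpha> * (ln \<xi> + C) - \<epsilon> * real k)"
      proof -
        \<comment> \<open>The product over \<open>i \<le> k\<close> has \<open>k + 1\<close>
          factors; the surplus \<open>a\<close> is dropped.\<close>
        have "a * real k - C \<le> ln (\<Prod>i\<le>k. \<gamma> ((\<tau> ^^ i) x))"
          unfolding lnP using C[rule_format, of "Suc k"] a by (simp add: algebra_simps)
        then have "\<alpha> * (ln \<xi> - ln (\<Prod>i\<le>k. \<gamma> ((\<tau> ^^ i) x))) \<le> \<alpha> * (ln \<xi> - (a * real k - C))"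
          using \<alpha> by (intro mult_left_mono) auto
        then show ?thesis using k by (simp add: \<epsilon>_def algebra_simps)
      qed
      also have "\<dots> = exp (\<alpha> * (ln \<xi> + C)) * exp (- \<epsilon>) ^ k"
        by (simp add: exp_diff exp_minus exp_of_nat_mult[symmetric] field_simps flip: power_inverse)
      finally show ?thesis .
    qed
    have "summable ?t"
    proof (rule summable_comparison_test_ev)
      show "eventually (\<lambda>k. norm (?t k) \<le> exp (\<alpha> * (ln \<xi> + C)) * exp (- \<epsilon>) ^ k) sequentially"
        using ev
      proof eventually_elim
        case (elim k)
        then show ?case using bound[OF elim] t0[of k] by simp
      qed
      show "summable (\<lambda>k. exp (\<alpha> * (ln \<xi> + C)) * exp (- \<epsilon>) ^ k)"
        by (intro summable_mult summable_geometric) (use \<epsilon> in simp)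
    qed
    then show "(\<Sum>k. ennreal (?t k)) \<noteq> \<infinity>"
      using ennreal_suminf_neq_top[of ?t, OF _ t0] by simp
  qed
qed

section \<open>Ergodicity of the base map and of its inverse\<close>

lemma ergodic_map_base:
  assumes "ergodic_base M \<theta>"
  shows "ergodic_map M \<theta>"
  using assms unfolding ergodic_base_def ergodic_map_def by - (elim conjE, intro conjI)

text \<open>The inverse has the same invariant sets. It is needed because distortion is controlled
  along backward orbits.\<close>

lemma ergodic_map_inverse:
  assumes "ergodic_base M \<theta>"
  shows "ergodic_map M (inv_into (space M) \<theta>)"
proof -
  let ?\<tau> = "inv_into (space M) \<theta>"
  have bij: "bij_betw \<theta> (space M) (space M)" and \<theta>: "\<theta> \<in> measurable M M"
    and \<tau>: "?\<tau> \<in> measurable M M" and d: "distr M M \<theta> = M" and P: "prob_space M"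
    and erg: "\<forall>A\<in>sets M. \<theta> -` A \<inter> space M = A \<longrightarrow> measure M A = 0 \<or> measure M A = 1"
    using assms unfolding ergodic_base_def by blast+
  have 1: "?\<tau> (\<theta> x) = x" if "x \<in> space M" for x using bij that by (simp add: bij_betw_inv_into_left)
  have 2: "\<theta> (?\<tau> x) = x" if "x \<in> space M" for x using bij that by (simp add: bij_betw_inv_into_right)
  have "distr M M ?\<tau> = distr (distr M M \<theta>) M ?\<tau>" using d by simp
  also have "\<dots> = distr M M (?\<tau> \<circ> \<theta>)" by (rule distr_distr) (use \<theta> \<tau> d in auto)
  also have "\<dots> = distr M M (\<lambda>x. x)" by (rule distr_cong) (use 1 in auto)
  finally have dist: "distr M M ?\<tau> = M" by simp
  have "measure M A = 0 \<or> measure M A = 1" if A: "A \<in> sets M" "?\<tau> -` A \<inter> space M = A" for A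
  proof -
    have "\<theta> -` A \<inter> space M = A"
    proof (intro set_eqI iffI)
      fix x assume "x \<in> \<theta> -` A \<inter> space M"
      then have "?\<tau> (\<theta> x) \<in> A" "x \<in> space M" using A(2) by auto
      then show "x \<in> A" using 1 by simp
    next
      fix x assume x: "x \<in> A"
      then have sp: "x \<in> space M" using A(2) by auto
      have "?\<tau> (\<theta> x) \<in> A" using 1[OF sp] x by simp
      moreover have "\<theta> x \<in> space M" using sp \<theta> by (auto dest: measurable_space)
      ultimately show "x \<in> \<theta> -` A \<inter> space M" using A(2) sp by auto
    qed
    then show ?thesis using erg A by blast
  qed
  then show ?thesis using \<tau> dist P unfolding ergodic_map_def by blast
qed

section \<open>Borel measures on compact metric spaces\<close>

lemma openin_mtopology_of:
  "openin (mtopology_of m) U \<longleftrightarrow> U \<subseteq> mspace m \<and> (\<forall>z\<in>U. \<exists>r>0. mball_of m z r \<subseteq> U)"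
  unfolding mtopology_of_def mball_of_def
  by (simp add: Metric_space.openin_mtopology[OF Metric_space_mspace_mdist] Ball_def)

lemma openin_mball_of: "openin (mtopology_of m) (mball_of m z r)"
  unfolding mtopology_of_def mball_of_def
  by (simp add: Metric_space.openin_mball[OF Metric_space_mspace_mdist])

lemma mdist_self [simp]: "z \<in> mspace m \<Longrightarrow> mdist m z z = 0"
  by simp

lemma continuous_map_real_iff:
  "continuous_map (mtopology_of m) euclideanreal f \<longleftrightarrow>
     (\<forall>a\<in>mspace m. \<forall>\<epsilon>>0. \<exists>\<delta>>0. \<forall>z\<in>mspace m. mdist m a z < \<delta> \<longrightarrow> \<bar>f a - f z\<bar> < \<epsilon>)"
proof -
  have "continuous_map (mtopology_of m) euclideanreal f \<longleftrightarrow>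
      f ` mspace m \<subseteq> UNIV \<and> (\<forall>a\<in>mspace m. \<forall>\<epsilon>>0. \<exists>\<delta>>0. \<forall>z. z \<in> mspace m \<and> mdist m a z < \<delta> \<longrightarrow> dist (f a) (f z) < \<epsilon>)"
    unfolding mtopology_of_def
    by (rule Metric_space.metric_continuous_map[OF Metric_space_mspace_mdist Met_TC.Metric_space_axioms,
          unfolded mtopology_is_euclidean])
  then show ?thesis unfolding dist_real_def Ball_def by (simp only: subset_UNIV imp_conjL simp_thms)
qed

lemma compact_finite_net:
  assumes "compact_space (mtopology_of m)" "r > 0"
  obtains K where "finite K" "K \<subseteq> mspace m" "mspace m \<subseteq> (\<Union>z\<in>K. mball_of m z r)"
proof -
  have "Metric_space.mtotally_bounded (mspace m) (mdist m) (mspace m)"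
    using Metric_space.compactin_imp_mtotally_bounded[OF Metric_space_mspace_mdist] assms(1)
    by (metis compact_space_def mtopology_of_def topspace_mtopology_of)
  then show thesis
    using that assms(2) Metric_space.mtotally_bounded_def[OF Metric_space_mspace_mdist]
    unfolding mball_of_def by metis
qed

lemma compact_real_bounded:
  assumes "compact_space (mtopology_of m)" "continuous_map (mtopology_of m) euclideanreal f"
  shows "\<exists>B. \<forall>z\<in>mspace m. \<bar>f z\<bar> \<le> B"
proof -
  have "compactin euclideanreal (f ` mspace m)"
    using image_compactin[OF _ assms(2), of "mspace m"] assms(1)
    by (simp add: compact_space_def)
  then have "bounded (f ` mspace m)" by (simp add: compact_imp_bounded)
  then show ?thesis unfolding bounded_iff by simp
qed

section \<open>Borel sets of a fibre\<close>

lemma opens_subset_Pow: "{U. openin (mtopology_of m) U} \<subseteq> Pow (mspace m)"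
  using openin_subset[where U = "mtopology_of m"] by simp blast

lemma space_fibre_borel [simp]: "space (fibre_borel m) = mspace m"
  unfolding fibre_borel_def by (rule space_measure_of[OF opens_subset_Pow])

lemma sets_fibre_borel: "sets (fibre_borel m) = sigma_sets (mspace m) {U. openin (mtopology_of m) U}"
  unfolding fibre_borel_def by (rule sets_measure_of[OF opens_subset_Pow])

lemma openin_fibre_borel: "openin (mtopology_of m) U \<Longrightarrow> U \<in> sets (fibre_borel m)"
  by (simp add: sets_fibre_borel)

lemma closedin_fibre_borel:
  assumes "closedin (mtopology_of m) F"
  shows "F \<in> sets (fibre_borel m)"
proof -
  have "mspace m - F \<in> sets (fibre_borel m)"
    using assms by (intro openin_fibre_borel) (simp add: closedin_def)
  then have "mspace m - (mspace m - F) \<in> sets (fibre_borel m)"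
    using sets.compl_sets[of "mspace m - F" "fibre_borel m"] by simp
  moreover have "mspace m - (mspace m - F) = F" using closedin_subset[OF assms] by auto
  ultimately show ?thesis by simp
qed

lemma continuous_map_fibre_borel:
  assumes "continuous_map (mtopology_of m) euclideanreal f"
  shows "f \<in> borel_measurable (fibre_borel m)"
proof (rule borel_measurableI)
  fix S :: "real set" assume "open S"
  then have "openin (mtopology_of m) {z \<in> mspace m. f z \<in> S}"
    using openin_continuous_map_preimage[OF assms, of S] by simp
  then show "f -` S \<inter> space (fibre_borel m) \<in> sets (fibre_borel m)"
    by (intro openin_fibre_borel) (simp add: vimage_def Int_def conj_commute)
qed

text \<open>The case distinction avoids an infimum over the empty set.\<close>

definition dist_to :: "'z metric \<Rightarrow> 'z set \<Rightarrow> 'z \<Rightarrow> real" where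
  "dist_to m F z = (if F = {} then 1 else (INF y\<in>F. mdist m z y))"

lemma dist_to_nonneg: "dist_to m F z \<ge> 0"
  unfolding dist_to_def by (auto intro: cINF_greatest)

lemma dist_to_le: "y \<in> F \<Longrightarrow> dist_to m F z \<le> mdist m z y"
  unfolding dist_to_def by (auto intro!: cINF_lower bdd_belowI2[of _ 0])

lemma dist_to_triangle:
  assumes "F \<subseteq> mspace m" "z \<in> mspace m" "z' \<in> mspace m"
  shows "dist_to m F z \<le> dist_to m F z' + mdist m z z'"
proof (cases "F = {}")
  case False
  have "dist_to m F z - mdist m z z' \<le> mdist m z' y" if "y \<in> F" for y
    using dist_to_le[OF that, of m z] mdist_triangle[of z m z' y] assms that by auto
  then have "dist_to m F z - mdist m z z' \<le> (INF y\<in>F. mdist m z' y)"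
    by (intro cINF_greatest False) auto
  then show ?thesis using False by (simp add: dist_to_def)
qed (simp add: dist_to_def)

lemma continuous_dist_to:
  assumes "F \<subseteq> mspace m"
  shows "continuous_map (mtopology_of m) euclideanreal (dist_to m F)"
  unfolding continuous_map_real_iff
proof (intro ballI allI impI)
  fix a and \<epsilon> :: real assume a: "a \<in> mspace m" and \<epsilon>: "\<epsilon> > 0"
  have "\<bar>dist_to m F a - dist_to m F z\<bar> \<le> mdist m a z" if "z \<in> mspace m" for z
    using dist_to_triangle[OF assms a that] dist_to_triangle[OF assms that a]
    by (simp add: mdist_commute)
  then show "\<exists>\<delta>>0. \<forall>z\<in>mspace m. mdist m a z < \<delta> \<longrightarrow> \<bar>dist_to m F a - dist_to m F z\<bar> < \<epsilon>"
    using \<epsilon> by (intro exI[of _ \<epsilon>] conjI ballI impI) (auto intro: le_less_trans)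
qed

lemma dist_to_pos_iff:
  assumes F: "closedin (mtopology_of m) F" and z: "z \<in> mspace m"
  shows "dist_to m F z > 0 \<longleftrightarrow> z \<notin> F"
proof
  assume "z \<notin> F"
  moreover have "openin (mtopology_of m) (mspace m - F)" using F by (simp add: closedin_def)
  ultimately obtain r where r: "r > 0" "mball_of m z r \<subseteq> mspace m - F"
    using z by (auto simp: openin_mtopology_of)
  have "r \<le> mdist m z y" if "y \<in> F" for y
  proof (rule ccontr)
    assume "\<not> r \<le> mdist m z y"
    then have "y \<in> mball_of m z r" using that z closedin_subset[OF F] by auto
    then show False using r(2) that by blast
  qed
  then have "r \<le> (INF y\<in>F. mdist m z y)" if "F \<noteq> {}"
    using that by (intro cINF_greatest)
  then show "dist_to m F z > 0" using r(1) by (cases "F = {}") (simp_all add: dist_to_def)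
next
  assume pos: "dist_to m F z > 0"
  show "z \<notin> F"
  proof
    assume "z \<in> F"
    then show False using dist_to_le[of z F m z] mdist_self[OF z] pos by linarith
  qed
qed

section \<open>Shrinking neighbourhoods of closed sets and regularity\<close>

definition nbhd :: "'z metric \<Rightarrow> 'z set \<Rightarrow> nat \<Rightarrow> 'z set" where
  "nbhd m F k = {z \<in> mspace m. dist_to m F z < inverse (real (Suc k))}"

lemma openin_nbhd: "F \<subseteq> mspace m \<Longrightarrow> openin (mtopology_of m) (nbhd m F k)"
  using openin_continuous_map_preimage[OF continuous_dist_to, of F m "{..< inverse (real (Suc k))}"]
  by (simp add: nbhd_def)

lemma closedin_dist_to_ge:
  "F \<subseteq> mspace m \<Longrightarrow> closedin (mtopology_of m) {z \<in> mspace m. dist_to m F z \<ge> c}"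
  using closedin_continuous_map_preimage[OF continuous_dist_to, of F m "{c..}"] by simp

lemma nbhd_superset:
  assumes "F \<subseteq> mspace m"
  shows "F \<subseteq> nbhd m F k"
proof
  fix z assume z: "z \<in> F"
  then have "dist_to m F z \<le> 0" using dist_to_le[OF z, of m z] mdist_self[of z m] assms by auto
  also have "0 < inverse (real (Suc k))" by simp
  finally show "z \<in> nbhd m F k" using z assms by (auto simp: nbhd_def)
qed

lemma decseq_nbhd: "decseq (nbhd m F)"
proof (rule decseq_SucI)
  fix k
  have *: "inverse (real (Suc (Suc k))) \<le> inverse (real (Suc k))" by (rule le_imp_inverse_le) simp_all
  show "nbhd m F (Suc k) \<subseteq> nbhd m F k"
  proof
    fix z assume "z \<in> nbhd m F (Suc k)"
    then have z: "z \<in> mspace m" "dist_to m F z < inverse (real (Suc (Suc k)))"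
      unfolding nbhd_def by blast+
    show "z \<in> nbhd m F k"
      unfolding nbhd_def using z(1) order.strict_trans2[OF z(2) *] by blast
  qed
qed

lemma Inter_nbhd:
  assumes "closedin (mtopology_of m) F"
  shows "(\<Inter>k. nbhd m F k) = F"
proof
  show "F \<subseteq> (\<Inter>k. nbhd m F k)"
    by (rule INT_greatest, rule nbhd_superset) (use closedin_subset[OF assms] in simp)
  show "(\<Inter>k. nbhd m F k) \<subseteq> F"
  proof (rule subsetI, rule ccontr)
    fix z assume z: "z \<in> (\<Inter>k. nbhd m F k)" "z \<notin> F"
    have "z \<in> nbhd m F 0" using z(1) by (rule INT_D) simp
    then have "z \<in> mspace m" by (simp add: nbhd_def)
    then have "dist_to m F z > 0" using dist_to_pos_iff[OF assms] z(2) by simp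
    then obtain k where "inverse (real (Suc k)) < dist_to m F z" using reals_Archimedean by blast
    moreover have "z \<in> nbhd m F k" using z(1) by (rule INT_D) simp
    ultimately show False by (simp add: nbhd_def)
  qed
qed

lemma measure_nbhd_tendsto:
  assumes "finite_measure \<rho>" "sets \<rho> = sets (fibre_borel m)" "closedin (mtopology_of m) F"
  shows "(\<lambda>k. measure \<rho> (nbhd m F k)) \<longlonglongrightarrow> measure \<rho> F"
proof -
  interpret finite_measure \<rho> by fact
  have "F \<subseteq> mspace m" using closedin_subset[OF assms(3)] by simp
  then have "range (nbhd m F) \<subseteq> sets \<rho>"
    using openin_fibre_borel[OF openin_nbhd] assms(2) by blast
  from finite_Lim_measure_decseq[OF this decseq_nbhd] show ?thesis
    unfolding Inter_nbhd[OF assms(3)] .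
qed

text \<open>Approximation by closed sets from inside and by open sets from outside is proved
  simultaneously, because complementation exchanges the two.\<close>

lemma borel_regular:
  assumes "finite_measure \<rho>" and sets: "sets \<rho> = sets (fibre_borel m)" and A: "A \<in> sets \<rho>"
    and e: "e > 0"
  shows "\<exists>F U. closedin (mtopology_of m) F \<and> openin (mtopology_of m) U \<and> F \<subseteq> A \<and> A \<subseteq> U \<and>
    measure \<rho> (U - F) < e"
proof -
  interpret finite_measure \<rho> by fact
  have sp: "space \<rho> = mspace m" using sets_eq_imp_space_eq[OF sets] by simp
  have o: "U \<in> sets \<rho>" if "openin (mtopology_of m) U" for U
    using openin_fibre_borel[OF that] sets by simp
  have c: "F \<in> sets \<rho>" if "closedin (mtopology_of m) F" for F
    using closedin_fibre_borel[OF that] sets by simp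
  have "A \<in> sigma_sets (mspace m) {U. openin (mtopology_of m) U}"
    using A sets by (simp add: sets_fibre_borel)
  then show ?thesis using e
  proof (induction arbitrary: e rule: sigma_sets.induct)
    case (Basic U)
    then have U: "openin (mtopology_of m) U" by simp
    \<comment> \<open>\<open>U\<close> is exhausted from inside by the complements of shrinking
      neighbourhoods of its closed complement \<open>?C\<close>; the error is then the part of a
      neighbourhood outside \<open>?C\<close>.\<close>
    let ?C = "mspace m - U"
    have C: "closedin (mtopology_of m) ?C" using closedin_diff[OF closedin_topspace U] by simp
    have Usub: "U \<subseteq> mspace m" using openin_subset[OF U] by simp
    have "(\<lambda>k. measure \<rho> (nbhd m ?C k)) \<longlonglongrightarrow> measure \<rho> ?C"
      by (rule measure_nbhd_tendsto) (use sets C in \<open>auto intro: finite_measure_axioms\<close>)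
    then have "eventually (\<lambda>k. measure \<rho> (nbhd m ?C k) < measure \<rho> ?C + e) sequentially"
      by (rule order_tendstoD) (use Basic in simp)
    then obtain k where k: "measure \<rho> (nbhd m ?C k) < measure \<rho> ?C + e"
      by (auto simp: eventually_sequentially)
    let ?F = "{z \<in> mspace m. dist_to m ?C z \<ge> inverse (real (Suc k))}"
    have N: "openin (mtopology_of m) (nbhd m ?C k)" by (rule openin_nbhd) auto
    have sub: "?C \<subseteq> nbhd m ?C k" by (rule nbhd_superset) auto
    have F_eq: "?F = mspace m - nbhd m ?C k" by (auto simp: nbhd_def not_less)
    have "nbhd m ?C k \<subseteq> mspace m" by (auto simp: nbhd_def)
    then have FU: "?F \<subseteq> U" "U - ?F = nbhd m ?C k - ?C"
      unfolding F_eq using sub Usub by blast+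
    have "measure \<rho> (nbhd m ?C k - ?C) = measure \<rho> (nbhd m ?C k) - measure \<rho> ?C"
      by (rule finite_measure_Diff) (use o[OF N] c[OF C] sub in auto)
    then have "measure \<rho> (U - ?F) < e" using k FU by simp
    moreover have "closedin (mtopology_of m) ?F" by (rule closedin_dist_to_ge) auto
    ultimately show ?case using U FU(1) by (intro exI[of _ ?F] exI[of _ U] conjI order_refl)
  next
    case Empty
    then show ?case by (intro exI[of _ "{}"] conjI) simp_all
  next
    case (Compl A)
    from Compl.IH[OF Compl.prems]
    obtain F U where FU: "closedin (mtopology_of m) F" "openin (mtopology_of m) U" "F \<subseteq> A" "A \<subseteq> U"
      "measure \<rho> (U - F) < e" by (elim exE conjE)
    have "U \<subseteq> mspace m" using openin_subset[OF FU(2)] by simp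
    then have eq: "(mspace m - F) - (mspace m - U) = U - F" by blast
    moreover have "closedin (mtopology_of m) (mspace m - U)" "openin (mtopology_of m) (mspace m - F)"
      using closedin_diff[OF closedin_topspace FU(2)] FU(1) by (simp_all add: closedin_def)
    moreover have "measure \<rho> ((mspace m - F) - (mspace m - U)) < e" unfolding eq by (rule FU(5))
    moreover have "mspace m - U \<subseteq> mspace m - A" "mspace m - A \<subseteq> mspace m - F" using FU(3,4) by blast+
    ultimately show ?case
      by (intro exI[of _ "mspace m - U"] exI[of _ "mspace m - F"] conjI)
  next
    case (Union A)
    \<comment> \<open>The errors of the single sets add up to \<open>e / 2\<close>. The other half
      of \<open>e\<close> pays for replacing the union of all \<open>F i\<close>, which need not be
      closed, by a finite one.\<close>
    have "\<exists>F U. closedin (mtopology_of m) F \<and> openin (mtopology_of m) U \<and> F \<subseteq> A i \<and> A i \<subseteq> U \<and>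
      measure \<rho> (U - F) < e / 2 * (1/2) ^ Suc i" for i
      using Union.IH[of "e / 2 * (1/2) ^ Suc i" i] Union.prems by simp
    then obtain F U where F: "\<And>i. closedin (mtopology_of m) (F i)" and U: "\<And>i. openin (mtopology_of m) (U i)"
      and sub: "\<And>i. F i \<subseteq> A i" "\<And>i. A i \<subseteq> U i"
      and lt: "\<And>i. measure \<rho> (U i - F i) < e / 2 * (1/2) ^ Suc i"
      by metis
    let ?U = "\<Union>i. U i" and ?F = "\<lambda>n. \<Union>i<n. F i"
    have Us: "openin (mtopology_of m) ?U" using U by (intro openin_Union) auto
    have Fs: "closedin (mtopology_of m) (?F n)" for n using F by (intro closedin_Union) auto
    have sm2: "summable (\<lambda>i. e / 2 * (1/2::real) ^ Suc i)"
      by (rule summable_mult, rule sums_summable[OF power_half_series])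
    have sm: "summable (\<lambda>i. measure \<rho> (U i - F i))"
    proof (rule summable_comparison_test'[OF sm2])
      show "norm (measure \<rho> (U i - F i)) \<le> e / 2 * (1/2) ^ Suc i" for i
        using lt[of i] by (simp only: real_norm_def abs_of_nonneg[OF measure_nonneg])
    qed
    have "measure \<rho> (\<Union>i. U i - F i) \<le> (\<Sum>i. measure \<rho> (U i - F i))"
      by (rule finite_measure_subadditive_countably[OF _ sm]) (use o[OF U] c[OF F] in blast)
    also have "\<dots> \<le> (\<Sum>i. e / 2 * (1/2) ^ Suc i)"
      by (rule suminf_le[OF less_imp_le[OF lt] sm sm2])
    also have "\<dots> = e / 2 * (\<Sum>i. (1/2) ^ Suc i)"
      by (rule suminf_mult) (rule sums_summable[OF power_half_series])
    also have "\<dots> = e / 2" using sums_unique[OF power_half_series] by simp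
    finally have "measure \<rho> (\<Union>i. U i - F i) \<le> e / 2" .
    moreover have "measure \<rho> (?U - (\<Union>i. F i)) \<le> measure \<rho> (\<Union>i. U i - F i)"
      by (rule finite_measure_mono) (use o[OF U] c[OF F] in blast)+
    ultimately have le: "measure \<rho> (?U - (\<Union>i. F i)) \<le> e / 2" by simp
    have "(\<lambda>n. measure \<rho> (?U - ?F n)) \<longlonglongrightarrow> measure \<rho> (\<Inter>n. ?U - ?F n)"
    proof (rule finite_Lim_measure_decseq)
      show "range (\<lambda>n. ?U - ?F n) \<subseteq> sets \<rho>" using o[OF Us] c[OF Fs] by blast
      show "decseq (\<lambda>n. ?U - ?F n)" by (rule decseq_SucI) auto
    qed
    moreover have "(\<Inter>n. ?U - ?F n) = ?U - (\<Union>i. F i)" by auto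
    ultimately have "eventually (\<lambda>n. measure \<rho> (?U - ?F n) < e) sequentially"
      using le Union.prems by (intro order_tendstoD(2)[where y="measure \<rho> (?U - (\<Union>i. F i))"]) auto
    then obtain n where "measure \<rho> (?U - ?F n) < e" by (auto simp: eventually_sequentially)
    moreover have "?F n \<subseteq> (\<Union>i. A i)" "(\<Union>i. A i) \<subseteq> ?U" using sub by blast+
    ultimately show ?case using Us Fs[of n]
      by (intro exI[of _ "?F n"] exI[of _ ?U] conjI)
  qed
qed

text \<open>A \<open>\<sigma>\<close>-null set contains only closed sets of
  \<open>\<sigma>\<close>-measure 0, hence of \<open>\<rho>\<close>-measure 0, and these approximate
  its \<open>\<rho>\<close>-measure. Closed sets are the natural input: covers by small cylinders
  compare a set with its neighbourhoods, and the neighbourhoods of a closed set shrink back to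
  it.\<close>

lemma absolutely_continuous_if_closed_le:
  assumes \<rho>: "finite_measure \<rho>" "sets \<rho> = sets (fibre_borel m)"
    and \<sigma>: "finite_measure \<sigma>" "sets \<sigma> = sets (fibre_borel m)"
    and le: "\<And>F. closedin (mtopology_of m) F \<Longrightarrow> measure \<rho> F \<le> C * measure \<sigma> F"
  shows "absolutely_continuous \<sigma> \<rho>"
  unfolding absolutely_continuous_def
proof
  interpret R: finite_measure \<rho> by fact
  interpret S: finite_measure \<sigma> by fact
  fix A assume A: "A \<in> null_sets \<sigma>"
  then have AR: "A \<in> sets \<rho>" using \<rho> \<sigma> by (auto simp: null_sets_def)
  have "measure \<rho> A \<le> 0 + e" if e: "e > 0" for e
  proof -
    obtain F U where FU: "closedin (mtopology_of m) F" "openin (mtopology_of m) U" "F \<subseteq> A" "A \<subseteq> U"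
      "measure \<rho> (U - F) < e"
      using borel_regular[OF \<rho> AR e] by blast
    have s: "F \<in> sets \<rho>" "U \<in> sets \<rho>"
      using closedin_fibre_borel[OF FU(1)] openin_fibre_borel[OF FU(2)] \<rho> by auto
    have "measure \<sigma> F \<le> measure \<sigma> A" by (rule S.finite_measure_mono) (use FU A in auto)
    then have "measure \<sigma> F = 0" using A measure_nonneg[of \<sigma> F] by (simp add: measure_eq_0_null_sets)
    then have "measure \<rho> F \<le> 0" using le[OF FU(1)] by simp
    moreover have "measure \<rho> A \<le> measure \<rho> (F \<union> (U - F))"
      by (rule R.finite_measure_mono) (use FU s in auto)
    moreover have "measure \<rho> (F \<union> (U - F)) \<le> measure \<rho> F + measure \<rho> (U - F)"
      by (rule measure_Un_le) (use s in auto)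
    ultimately show ?thesis using FU(5) by simp
  qed
  then have "measure \<rho> A \<le> 0" by (rule field_le_epsilon)
  then have "measure \<rho> A = 0" using measure_nonneg[of \<rho> A] by linarith
  then show "A \<in> null_sets \<rho>" using AR by (simp add: null_sets_def R.emeasure_eq_measure)
qed

section \<open>Expanding maps between the fibres of an orbit\<close>

text \<open>The recursion appends the last map of the orbit, whereas cylinders and the inductions on
  their depth peel off the first one.\<close>

lemma fibre_iter_Suc_left: "fibre_iter \<theta> T (Suc n) x z = fibre_iter \<theta> T n (\<theta> x) (T x z)"
  by (induction n) (simp_all add: funpow_swap1)

lemma fibre_iter_add:
  "fibre_iter \<theta> T (m + n) x z = fibre_iter \<theta> T n ((\<theta> ^^ m) x) (fibre_iter \<theta> T m x z)"
proof (induction n)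
  case (Suc n)
  have "(\<theta> ^^ (m + n)) x = (\<theta> ^^ n) ((\<theta> ^^ m) x)" by (subst add.commute) (simp add: funpow_add)
  then show ?case using Suc by simp
qed simp

text \<open>\<open>P z d\<close> is asked for all \<open>d\<close> below the threshold rather than
  at the threshold, so that the minimum of finitely many thresholds works.\<close>

lemma common_delta:
  fixes P :: "'b \<Rightarrow> real \<Rightarrow> bool"
  assumes "finite S" "\<And>z. z \<in> S \<Longrightarrow> \<exists>\<delta>>0. \<forall>d<\<delta>. P z d"
  shows "\<exists>\<delta>>0. \<forall>z\<in>S. \<forall>d<\<delta>. P z d"
  using assms
proof (induction S rule: finite_induct)
  case empty
  then show ?case by (intro exI[of _ 1]) simp
next
  case (insert a S)
  obtain d1 where d1: "d1 > 0" "\<forall>d<d1. P a d" using insert.prems[of a] by auto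
  obtain d2 where d2: "d2 > 0" "\<forall>z\<in>S. \<forall>d<d2. P z d" using insert.IH insert.prems by auto
  show ?case using d1 d2 by (intro exI[of _ "min d1 d2"]) auto
qed

text \<open>The set \<open>T_y^{-n}(B(T^n(y), \<xi>))\<close> whose mass the Gibbs condition
  prescribes.\<close>

definition cylinder ::
    "('x \<Rightarrow> 'x) \<Rightarrow> ('x \<Rightarrow> 'z metric) \<Rightarrow> ('x \<Rightarrow> 'z \<Rightarrow> 'z) \<Rightarrow> ('x \<Rightarrow> real) \<Rightarrow> real \<Rightarrow> 'x \<Rightarrow> nat \<Rightarrow> 'z \<Rightarrow> 'z set"
  where
  "cylinder \<theta> J T \<eta> \<xi> x n z =
     inverse_branch_iter \<theta> J T \<eta> n x z ` mball_of (J ((\<theta> ^^ n) x)) (fibre_iter \<theta> T n x z) \<xi>"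

text \<open>What holds almost everywhere is required here at every point of a forward invariant set
  \<open>G\<close>, so that arguments along a single orbit involve no null sets.\<close>

locale expanding_fibres =
  fixes \<theta> :: "'x \<Rightarrow> 'x" and J :: "'x \<Rightarrow> 'z metric" and T :: "'x \<Rightarrow> 'z \<Rightarrow> 'z"
    and \<eta> :: "'x \<Rightarrow> real" and \<xi> :: real and \<gamma> :: "'x \<Rightarrow> real" and G :: "'x set"
  assumes orbit: "x \<in> G \<Longrightarrow> \<theta> x \<in> G"
    and nonempty: "x \<in> G \<Longrightarrow> mspace (J x) \<noteq> {}"
    and compact: "x \<in> G \<Longrightarrow> compact_space (mtopology_of (J x))"
    and continuous: "x \<in> G \<Longrightarrow> continuous_map (mtopology_of (J x)) (mtopology_of (J (\<theta> x))) (T x)"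
    and open_T: "x \<in> G \<Longrightarrow> open_map (mtopology_of (J x)) (mtopology_of (J (\<theta> x))) (T x)"
    and surj: "x \<in> G \<Longrightarrow> T x ` mspace (J x) = mspace (J (\<theta> x))"
    and eta_pos: "x \<in> G \<Longrightarrow> \<eta> x > 0"
    and xi_pos: "\<xi> > 0"
    and branch: "\<lbrakk>x \<in> G; z \<in> mspace (J x); w \<in> mball_of (J (\<theta> x)) (T x z) \<xi>\<rbrakk> \<Longrightarrow>
      \<exists>!u. u \<in> mball_of (J x) z (\<eta> x) \<and> T x u = w"
    and gamma: "x \<in> G \<Longrightarrow> \<gamma> x > 1"
    and expand: "\<lbrakk>x \<in> G; z \<in> mspace (J x); u \<in> mspace (J x); mdist (J x) z u < \<eta> x\<rbrakk> \<Longrightarrow>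
      \<gamma> x * mdist (J x) z u \<le> mdist (J (\<theta> x)) (T x z) (T x u)"
begin

section \<open>Inverse branches and cylinders\<close>

abbreviation "inv_branch \<equiv> inverse_branch J T \<eta>"
abbreviation "cyl \<equiv> cylinder \<theta> J T \<eta> \<xi>"
abbreviation "iter \<equiv> fibre_iter \<theta> T"

lemma orbit_funpow: "x \<in> G \<Longrightarrow> (\<theta> ^^ n) x \<in> G"
  by (induction n) (simp_all add: orbit)

lemma T_in: "x \<in> G \<Longrightarrow> z \<in> mspace (J x) \<Longrightarrow> T x z \<in> mspace (J (\<theta> x))"
  using surj by blast

lemma iter_in: "x \<in> G \<Longrightarrow> z \<in> mspace (J x) \<Longrightarrow> iter n x z \<in> mspace (J ((\<theta> ^^ n) x))"
  by (induction n) (simp_all add: T_in orbit_funpow)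

lemma inv_branch:
  assumes "x \<in> G" "z \<in> mspace (J x)" "w \<in> mball_of (J (\<theta> x)) (T x z) \<xi>"
  shows "inv_branch x z w \<in> mball_of (J x) z (\<eta> x)" "T x (inv_branch x z w) = w"
  using theI'[OF branch[OF assms]] unfolding inverse_branch_def by (rule conjunct1, rule conjunct2)

text \<open>\<open>T x\<close> may fail to be injective on the whole \<open>\<eta> x\<close>-ball;
  uniqueness of branches separates only points whose image lies in the \<open>\<xi>\<close>-ball
  around \<open>T x z\<close>.\<close>

lemma branch_inj:
  assumes "x \<in> G" "z \<in> mspace (J x)" "T x u \<in> mball_of (J (\<theta> x)) (T x z) \<xi>"
    and "u \<in> mball_of (J x) z (\<eta> x)" "u' \<in> mball_of (J x) z (\<eta> x)" "T x u' = T x u"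
  shows "u' = u"
proof (rule ex1E[OF branch[OF assms(1-3)]])
  fix v assume *: "\<forall>y. y \<in> mball_of (J x) z (\<eta> x) \<and> T x y = T x u \<longrightarrow> y = v"
  have "u' = v" by (rule *[rule_format, OF conjI[OF assms(5,6)]])
  also have "v = u" by (rule *[rule_format, OF conjI[OF assms(4) refl], symmetric])
  finally show ?thesis .
qed

lemma inv_branch_T:
  assumes "x \<in> G" "z \<in> mspace (J x)" "u \<in> mball_of (J x) z (\<eta> x)"
    "T x u \<in> mball_of (J (\<theta> x)) (T x z) \<xi>"
  shows "inv_branch x z (T x u) = u"
  by (rule branch_inj[OF assms(1,2,4,3) inv_branch[OF assms(1,2,4)]])

lemma contraction:
  assumes x: "x \<in> G" and z: "z \<in> mspace (J x)" and u: "u \<in> mball_of (J x) z (\<eta> x)"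
  shows "mdist (J x) z u \<le> mdist (J (\<theta> x)) (T x z) (T x u)"
proof -
  have "1 * mdist (J x) z u \<le> \<gamma> x * mdist (J x) z u"
    by (rule mult_right_mono) (use gamma[OF x] in simp_all)
  then show ?thesis using expand[OF x z, of u] u by simp
qed

lemma cyl_0 [simp]: "cyl x 0 z = mball_of (J x) z \<xi>"
  by (simp add: cylinder_def)

lemma cyl_Suc_image: "cyl x (Suc n) z = inv_branch x z ` cyl (\<theta> x) n (T x z)"
  unfolding cylinder_def image_image
  by (simp only: fibre_iter_Suc_left funpow_Suc_right comp_def) (rule image_cong, simp_all)

text \<open>Inverse branches do not increase the distance to the centre. Staying inside the
  \<open>\<xi>\<close>-ball is what makes the next inverse branch applicable.\<close>

lemma cyl_subset_ball: "x \<in> G \<Longrightarrow> z \<in> mspace (J x) \<Longrightarrow> cyl x n z \<subseteq> mball_of (J x) z \<xi>"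
proof (induction n arbitrary: x z)
  case (Suc n)
  note IH = Suc.IH[OF orbit T_in, OF Suc.prems(1) Suc.prems]
  show ?case
  proof
    fix u assume "u \<in> cyl x (Suc n) z"
    then obtain w where w: "w \<in> cyl (\<theta> x) n (T x z)" "u = inv_branch x z w"
      unfolding cyl_Suc_image by (rule imageE)
    have wb: "w \<in> mball_of (J (\<theta> x)) (T x z) \<xi>" by (rule subsetD[OF IH w(1)])
    have u: "u \<in> mball_of (J x) z (\<eta> x)" "T x u = w"
      using inv_branch[OF Suc.prems wb] w(2) by simp_all
    show "u \<in> mball_of (J x) z \<xi>"
      using contraction[OF Suc.prems u(1)] u wb by simp
  qed
qed simp

text \<open>Replaces the image under a definite description by a preimage condition, from which
  openness, injectivity and the distance estimate are read off.\<close>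

lemma cyl_Suc:
  assumes x: "x \<in> G" and z: "z \<in> mspace (J x)"
  shows "cyl x (Suc n) z = {u \<in> mball_of (J x) z (\<eta> x). T x u \<in> cyl (\<theta> x) n (T x z)}"
proof -
  have sub: "cyl (\<theta> x) n (T x z) \<subseteq> mball_of (J (\<theta> x)) (T x z) \<xi>"
    by (rule cyl_subset_ball[OF orbit[OF x] T_in[OF x z]])
  show ?thesis
  proof (intro set_eqI iffI)
    fix u assume "u \<in> cyl x (Suc n) z"
    then obtain w where w: "w \<in> cyl (\<theta> x) n (T x z)" "u = inv_branch x z w"
      unfolding cyl_Suc_image by (rule imageE)
    then show "u \<in> {u \<in> mball_of (J x) z (\<eta> x). T x u \<in> cyl (\<theta> x) n (T x z)}"
      using inv_branch[OF x z subsetD[OF sub w(1)]] by simp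
  next
    fix u assume "u \<in> {u \<in> mball_of (J x) z (\<eta> x). T x u \<in> cyl (\<theta> x) n (T x z)}"
    then have u: "u \<in> mball_of (J x) z (\<eta> x)" "T x u \<in> cyl (\<theta> x) n (T x z)" by simp_all
    show "u \<in> cyl x (Suc n) z"
      unfolding cyl_Suc_image
      by (rule image_eqI[where f = "inv_branch x z" and x = "T x u",
            OF inv_branch_T[OF x z u(1) subsetD[OF sub u(2)], symmetric] u(2)])
  qed
qed

lemma cyl_subset: "x \<in> G \<Longrightarrow> z \<in> mspace (J x) \<Longrightarrow> cyl x n z \<subseteq> mspace (J x)"
  using cyl_subset_ball[of x z n] by auto

lemma openin_cyl: "x \<in> G \<Longrightarrow> z \<in> mspace (J x) \<Longrightarrow> openin (mtopology_of (J x)) (cyl x n z)"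
proof (induction n arbitrary: x z)
  case 0
  then show ?case by (simp add: openin_mball_of)
next
  case (Suc n)
  have "openin (mtopology_of (J (\<theta> x))) (cyl (\<theta> x) n (T x z))"
    by (rule Suc.IH[OF orbit T_in, OF Suc.prems(1) Suc.prems])
  from openin_continuous_map_preimage[OF continuous[OF Suc.prems(1)] this]
  have "openin (mtopology_of (J x)) {u \<in> mspace (J x). T x u \<in> cyl (\<theta> x) n (T x z)}" by simp
  from openin_Int[OF openin_mball_of this, of z "\<eta> x"] show ?case
    unfolding cyl_Suc[OF Suc.prems] by (rule back_subst) auto
qed

lemma T_cyl:
  assumes x: "x \<in> G" and z: "z \<in> mspace (J x)"
  shows "T x ` cyl x (Suc n) z = cyl (\<theta> x) n (T x z)"
proof -
  have "T x (inv_branch x z w) = w" if "w \<in> cyl (\<theta> x) n (T x z)" for w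
    by (rule inv_branch(2)[OF x z subsetD[OF cyl_subset_ball[OF orbit[OF x] T_in[OF x z]] that]])
  then show ?thesis unfolding cyl_Suc_image image_image by simp
qed

lemma inj_on_cyl:
  assumes x: "x \<in> G" and z: "z \<in> mspace (J x)"
  shows "inj_on (T x) (cyl x (Suc n) z)"
proof (rule inj_onI)
  fix u u' assume u: "u \<in> cyl x (Suc n) z" "u' \<in> cyl x (Suc n) z" and eq: "T x u = T x u'"
  then show "u = u'"
    using branch_inj[OF x z, of u' u] subsetD[OF cyl_subset_ball[OF orbit[OF x] T_in[OF x z]], of "T x u'" n]
    by (simp only: cyl_Suc[OF x z] mem_Collect_eq)
qed

text \<open>Each step multiplies the distance to the centre by at least the local rate, and after
  \<open>n\<close> steps it is still below \<open>\<xi>\<close>.\<close>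

lemma cyl_dist:
  "x \<in> G \<Longrightarrow> z \<in> mspace (J x) \<Longrightarrow> u \<in> cyl x n z \<Longrightarrow>
    (\<Prod>i<n. \<gamma> ((\<theta> ^^ i) x)) * mdist (J x) z u < \<xi>"
proof (induction n arbitrary: x z u)
  case 0
  then show ?case by simp
next
  case (Suc n)
  let ?p = "\<Prod>i<n. \<gamma> ((\<theta> ^^ i) (\<theta> x))"
  have u: "u \<in> mball_of (J x) z (\<eta> x)" "T x u \<in> cyl (\<theta> x) n (T x z)"
    using Suc.prems by (simp_all add: cyl_Suc)
  have p: "?p \<ge> 0"
    by (rule prod_nonneg) (use gamma[OF orbit_funpow[OF orbit[OF Suc.prems(1)]]] in \<open>simp add: less_imp_le less_trans[OF zero_less_one]\<close>)
  have "(\<Prod>i<Suc n. \<gamma> ((\<theta> ^^ i) x)) = \<gamma> x * ?p"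
    by (simp add: prod.lessThan_Suc_shift funpow_swap1 del: prod.lessThan_Suc)
  then have "(\<Prod>i<Suc n. \<gamma> ((\<theta> ^^ i) x)) * mdist (J x) z u = ?p * (\<gamma> x * mdist (J x) z u)"
    by simp
  also have "\<dots> \<le> ?p * mdist (J (\<theta> x)) (T x z) (T x u)"
    by (rule mult_left_mono[OF _ p]) (use expand[OF Suc.prems(1,2)] u(1) in simp)
  also have "\<dots> < \<xi>" by (rule Suc.IH[OF orbit T_in u(2), OF Suc.prems(1) Suc.prems(1,2)])
  finally show ?case .
qed

text \<open>By induction the two centres have the same image, which lies within \<open>\<xi>\<close>
  of \<open>T x u\<close> for the common point \<open>u\<close>, and both lie within
  \<open>\<eta> x\<close> of \<open>u\<close>. So uniqueness of the branch at \<open>u\<close>, not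
  at a centre, identifies them. Disjointness is what allows masses of cylinders to be added.\<close>

lemma cyl_disjoint:
  "x \<in> G \<Longrightarrow> z \<in> mspace (J x) \<Longrightarrow> z' \<in> mspace (J x) \<Longrightarrow> iter n x z = iter n x z' \<Longrightarrow>
    u \<in> cyl x n z \<Longrightarrow> u \<in> cyl x n z' \<Longrightarrow> z = z'"
proof (induction n arbitrary: x z z' u)
  case (Suc n)
  note x = Suc.prems(1) and z = Suc.prems(2) and z' = Suc.prems(3)
  have u: "u \<in> mball_of (J x) z (\<eta> x)" "T x u \<in> cyl (\<theta> x) n (T x z)"
    "u \<in> mball_of (J x) z' (\<eta> x)" "T x u \<in> cyl (\<theta> x) n (T x z')"
    using Suc.prems(5,6) by (simp_all add: cyl_Suc x z z')
  have eq: "T x z = T x z'"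
    by (rule Suc.IH[OF orbit[OF x] T_in[OF x z] T_in[OF x z'] _ u(2,4)])
       (use Suc.prems(4) in \<open>simp only: fibre_iter_Suc_left\<close>)
  have us: "u \<in> mspace (J x)" using u by simp
  have "T x u \<in> mball_of (J (\<theta> x)) (T x z) \<xi>"
    by (rule subsetD[OF cyl_subset_ball[OF orbit[OF x] T_in[OF x z]] u(2)])
  then have "T x z \<in> mball_of (J (\<theta> x)) (T x u) \<xi>" by (simp add: mdist_commute)
  then show ?case
    using branch_inj[OF x us, of z' z] u(1,3) eq z z' by (simp add: mdist_commute)
qed simp

text \<open>The centre is found by pulling \<open>w\<close> back along the branches at
  \<open>u\<close>; by symmetry of the distance \<open>u\<close> then lies in the cylinder of that
  centre.\<close>

lemma cyl_cover:
  "x \<in> G \<Longrightarrow> u \<in> mspace (J x) \<Longrightarrow> iter n x u \<in> mball_of (J ((\<theta> ^^ n) x)) w \<xi> \<Longrightarrow>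
    \<exists>z\<in>mspace (J x). iter n x z = w \<and> u \<in> cyl x n z"
proof (induction n arbitrary: x u)
  case 0
  then show ?case by (intro bexI[of _ w]) simp_all
next
  case (Suc n)
  note x = Suc.prems(1) and u = Suc.prems(2)
  have "iter n (\<theta> x) (T x u) \<in> mball_of (J ((\<theta> ^^ n) (\<theta> x))) w \<xi>"
    using Suc.prems(3) by (simp only: fibre_iter_Suc_left funpow_Suc_right comp_def)
  from Suc.IH[OF orbit[OF x] T_in[OF x u] this]
  obtain z1 where z1: "z1 \<in> mspace (J (\<theta> x))" "iter n (\<theta> x) z1 = w" "T x u \<in> cyl (\<theta> x) n z1"
    by (elim bexE conjE)
  have "T x u \<in> mball_of (J (\<theta> x)) z1 \<xi>"
    by (rule subsetD[OF cyl_subset_ball[OF orbit[OF x] z1(1)] z1(3)])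
  then have z1b: "z1 \<in> mball_of (J (\<theta> x)) (T x u) \<xi>" by (simp add: mdist_commute)
  define z where "z = inv_branch x u z1"
  have z: "z \<in> mball_of (J x) u (\<eta> x)" "T x z = z1"
    using inv_branch[OF x u z1b] by (simp_all add: z_def)
  have zs: "z \<in> mspace (J x)" using z by simp
  have "u \<in> cyl x (Suc n) z"
    using z z1 u by (simp add: cyl_Suc[OF x zs] mdist_commute)
  moreover have "iter (Suc n) x z = w" by (simp only: fibre_iter_Suc_left z(2) z1(2))
  ultimately show ?case using zs by (intro bexI[of _ z] conjI)
qed

section \<open>Preimage sets, their cardinality and sums over them\<close>

abbreviation preimages :: "'x \<Rightarrow> 'z \<Rightarrow> 'z set" where
  "preimages x w \<equiv> {z. z \<in> mspace (J x) \<and> T x z = w}"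

text \<open>Surjectivity holds because \<open>w0\<close> can be pulled back in turn along the branch
  at any preimage of \<open>w\<close>.\<close>

lemma bij_betw_preimages:
  assumes x: "x \<in> G" and w0: "w0 \<in> mspace (J (\<theta> x))" and w: "w \<in> mball_of (J (\<theta> x)) w0 \<xi>"
  shows "bij_betw (\<lambda>z. inv_branch x z w) (preimages x w0) (preimages x w)"
proof (rule bij_betwI')
  fix z z' assume z: "z \<in> preimages x w0" and z': "z' \<in> preimages x w0"
  have w': "w \<in> mball_of (J (\<theta> x)) (T x z) \<xi>" "w \<in> mball_of (J (\<theta> x)) (T x z') \<xi>"
    using z z' w by simp_all
  have zs: "z \<in> mspace (J x)" "z' \<in> mspace (J x)" using z z' by simp_all
  note b = inv_branch[OF x zs(1) w'(1)] and b' = inv_branch[OF x zs(2) w'(2)]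
  show "inv_branch x z w = inv_branch x z' w \<longleftrightarrow> z = z'"
  proof
    assume eq: "inv_branch x z w = inv_branch x z' w"
    show "z = z'"
      by (rule branch_inj[OF x, of "inv_branch x z w"])
         (use b b' eq z z' w in \<open>simp_all add: mdist_commute\<close>)
  qed simp
next
  fix z assume z: "z \<in> preimages x w0"
  then show "inv_branch x z w \<in> preimages x w"
    using inv_branch[OF x, of z w] w by simp
next
  fix u assume u: "u \<in> preimages x w"
  then have us: "u \<in> mspace (J x)" and Tu: "T x u = w" by simp_all
  have w0b: "w0 \<in> mball_of (J (\<theta> x)) (T x u) \<xi>" using w Tu by (simp add: mdist_commute)
  define v where "v = inv_branch x u w0"
  have v: "v \<in> mball_of (J x) u (\<eta> x)" "T x v = w0"
    using inv_branch[OF x us w0b] by (simp_all add: v_def)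
  have vs: "v \<in> mspace (J x)" using v by simp
  have "inv_branch x v (T x u) = u"
    by (rule inv_branch_T[OF x vs]) (use v us Tu w in \<open>simp_all add: mdist_commute\<close>)
  then show "\<exists>z\<in>preimages x w0. u = inv_branch x z w"
    using vs v(2) Tu by (intro bexI[of _ v]) simp_all
qed

text \<open>Two different preimages of one point have distance at least \<open>\<eta> x\<close>, so
  each ball of radius \<open>\<eta> x / 2\<close> around a point of a finite net contains at most
  one of them.\<close>

lemma preimages_bounded:
  assumes x: "x \<in> G"
  shows "\<exists>k. \<forall>w\<in>mspace (J (\<theta> x)). finite (preimages x w) \<and> card (preimages x w) \<le> k"
proof -
  obtain K where K: "finite K" "K \<subseteq> mspace (J x)" "mspace (J x) \<subseteq> (\<Union>c\<in>K. mball_of (J x) c (\<eta> x / 2))"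
    by (rule compact_finite_net[OF compact[OF x], of "\<eta> x / 2"]) (use eta_pos[OF x] in simp_all)
  have "finite (preimages x w) \<and> card (preimages x w) \<le> card K" if w: "w \<in> mspace (J (\<theta> x))" for w
  proof -
    define c where "c z = (SOME c. c \<in> K \<and> z \<in> mball_of (J x) c (\<eta> x / 2))" for z
    have c: "c z \<in> K \<and> z \<in> mball_of (J x) (c z) (\<eta> x / 2)" if "z \<in> mspace (J x)" for z
    proof -
      have "\<exists>c. c \<in> K \<and> z \<in> mball_of (J x) c (\<eta> x / 2)"
        using subsetD[OF K(3) that] unfolding UN_iff Bex_def .
      then show ?thesis unfolding c_def by (rule someI_ex)
    qed
    have "inj_on c (preimages x w)"
    proof (rule inj_onI)
      fix z z' assume z: "z \<in> preimages x w" and z': "z' \<in> preimages x w" and eq: "c z = c z'"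
      have zs: "z \<in> mspace (J x)" "z' \<in> mspace (J x)" using z z' by simp_all
      have "mdist (J x) z z' < \<eta> x"
        using mdist_triangle[of z "J x" "c z" z'] c[OF zs(1)] c[OF zs(2)] zs eq K(2) mdist_commute[of "J x" z "c z"]
        by simp
      then show "z = z'"
        using branch_inj[OF x zs(1), of z z'] z z' w eta_pos[OF x] xi_pos by simp
    qed
    moreover have "c ` preimages x w \<subseteq> K" using c by (intro image_subsetI) simp
    ultimately show ?thesis
      by (intro conjI inj_on_finite[OF _ _ K(1)] card_inj_on_le[OF _ _ K(1)])
  qed
  then show ?thesis by (intro exI[of _ "card K"] ballI)
qed

lemma finite_preimages:
  assumes "x \<in> G" "w \<in> mspace (J (\<theta> x))"
  shows "finite (preimages x w)"
proof -
  obtain k where "\<forall>w\<in>mspace (J (\<theta> x)). finite (preimages x w) \<and> card (preimages x w) \<le> k"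
    using preimages_bounded[OF assms(1)] by (rule exE)
  from bspec[OF this assms(2)] show ?thesis by (rule conjunct1)
qed

lemma preimages_nonempty:
  assumes "x \<in> G" "w \<in> mspace (J (\<theta> x))"
  shows "preimages x w \<noteq> {}"
proof -
  have "w \<in> T x ` mspace (J x)" using assms(2) surj[OF assms(1)] by simp
  then obtain z where "z \<in> mspace (J x)" "w = T x z" by (rule imageE)
  then show ?thesis by auto
qed

text \<open>Finiteness matters because \<open>enn2real\<close>, which turns the degree into a real
  bound, would send an infinite degree to 0.\<close>

lemma fibre_degree_finite:
  assumes x: "x \<in> G"
  shows "fibre_degree \<theta> J T x < \<infinity>"
proof -
  obtain k where k: "\<forall>w\<in>mspace (J (\<theta> x)). finite (preimages x w) \<and> card (preimages x w) \<le> k"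
    using preimages_bounded[OF x] by (rule exE)
  have "fibre_degree \<theta> J T x \<le> of_nat k"
    unfolding fibre_degree_def
  proof (rule SUP_least)
    fix w assume "w \<in> mspace (J (\<theta> x))"
    from bspec[OF k this] show "emeasure (count_space UNIV) (preimages x w) \<le> of_nat k"
      by (simp add: emeasure_count_space_finite)
  qed
  also have "\<dots> < \<infinity>" by (simp add: of_nat_less_top)
  finally show ?thesis .
qed

lemma card_preimages_le:
  assumes x: "x \<in> G" and w: "w \<in> mspace (J (\<theta> x))"
  shows "real (card (preimages x w)) \<le> enn2real (fibre_degree \<theta> J T x)"
proof -
  have "of_nat (card (preimages x w)) = emeasure (count_space UNIV) (preimages x w)"
    using finite_preimages[OF x w] by simp
  also have "\<dots> \<le> fibre_degree \<theta> J T x"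
    unfolding fibre_degree_def using w by (rule SUP_upper)
  finally have "enn2real (of_nat (card (preimages x w))) \<le> enn2real (fibre_degree \<theta> J T x)"
    using fibre_degree_finite[OF x] by (intro enn2real_mono) simp_all
  then show ?thesis by simp
qed

lemma finite_iter_preimages:
  "x \<in> G \<Longrightarrow> w \<in> mspace (J ((\<theta> ^^ n) x)) \<Longrightarrow> finite {z \<in> mspace (J x). iter n x z = w}"
proof (induction n arbitrary: x)
  case 0
  have "{z \<in> mspace (J x). iter 0 x z = w} \<subseteq> {w}" by auto
  then show ?case by (rule finite_subset) simp
next
  case (Suc n)
  let ?S = "{z \<in> mspace (J (\<theta> x)). iter n (\<theta> x) z = w}"
  have "w \<in> mspace (J ((\<theta> ^^ n) (\<theta> x)))" using Suc.prems(2) by (simp only: funpow_Suc_right comp_def)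
  then have "finite ?S" by (rule Suc.IH[OF orbit[OF Suc.prems(1)]])
  then have "finite (\<Union>v\<in>?S. preimages x v)"
    by (rule finite_UN_I) (use finite_preimages[OF Suc.prems(1)] in simp)
  moreover have "{z \<in> mspace (J x). iter (Suc n) x z = w} \<subseteq> (\<Union>v\<in>?S. preimages x v)"
    unfolding fibre_iter_Suc_left using T_in[OF Suc.prems(1)] by auto
  ultimately show ?case by (rule finite_subset[rotated])
qed

text \<open>Along its inverse branch a preimage moves no further than \<open>w\<close> moves away
  from \<open>w0\<close>, and the correspondence of preimages is bijective, so none appears or
  disappears. Hence one \<open>\<delta>\<close> for the finitely many preimages of \<open>w0\<close>
  suffices. This yields continuity of transformed functions.\<close>

lemma continuous_preimage_sum:
  assumes x: "x \<in> G" and h: "continuous_map (mtopology_of (J x)) euclideanreal h"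
  shows "continuous_map (mtopology_of (J (\<theta> x))) euclideanreal (\<lambda>w. \<Sum>z\<in>preimages x w. h z)"
  unfolding continuous_map_real_iff
proof (intro ballI allI impI)
  fix w0 and \<epsilon> :: real assume w0: "w0 \<in> mspace (J (\<theta> x))" and \<epsilon>: "\<epsilon> > 0"
  let ?P = "preimages x w0"
  have fin: "finite ?P" by (rule finite_preimages[OF x w0])
  have ne: "?P \<noteq> {}" by (rule preimages_nonempty[OF x w0])
  have card: "real (card ?P) > 0" using fin ne by (simp add: card_gt_0_iff)
  define e where "e = \<epsilon> / real (card ?P)"
  have e: "e > 0" using \<epsilon> card by (simp add: e_def)
  have "\<exists>\<delta>>0. \<forall>d<\<delta>. \<forall>u\<in>mspace (J x). mdist (J x) z u \<le> d \<longrightarrow> \<bar>h z - h u\<bar> < e" if z: "z \<in> ?P" for z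
  proof -
    have "z \<in> mspace (J x)" using z by simp
    then obtain \<delta> where "\<delta> > 0" "\<forall>u\<in>mspace (J x). mdist (J x) z u < \<delta> \<longrightarrow> \<bar>h z - h u\<bar> < e"
      using h e unfolding continuous_map_real_iff by meson
    then show ?thesis by (intro exI[of _ \<delta>]) (auto intro: le_less_trans)
  qed
  then have "\<exists>\<delta>>0. \<forall>z\<in>?P. \<forall>d<\<delta>. \<forall>u\<in>mspace (J x). mdist (J x) z u \<le> d \<longrightarrow> \<bar>h z - h u\<bar> < e"
    by (rule common_delta[OF fin])
  then obtain \<delta> where \<delta>: "\<delta> > 0"
    "\<forall>z\<in>?P. \<forall>d<\<delta>. \<forall>u\<in>mspace (J x). mdist (J x) z u \<le> d \<longrightarrow> \<bar>h z - h u\<bar> < e"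
    by (elim exE conjE)
  show "\<exists>\<delta>>0. \<forall>w\<in>mspace (J (\<theta> x)). mdist (J (\<theta> x)) w0 w < \<delta> \<longrightarrow>
    \<bar>(\<Sum>z\<in>preimages x w0. h z) - (\<Sum>z\<in>preimages x w. h z)\<bar> < \<epsilon>"
  proof (intro exI[of _ "min \<delta> \<xi>"] conjI ballI impI)
    show "min \<delta> \<xi> > 0" using \<delta>(1) xi_pos by simp
    fix w assume w: "w \<in> mspace (J (\<theta> x))" "mdist (J (\<theta> x)) w0 w < min \<delta> \<xi>"
    then have wb: "w \<in> mball_of (J (\<theta> x)) w0 \<xi>" using w0 by simp
    have "(\<Sum>z\<in>preimages x w. h z) = (\<Sum>z\<in>?P. h (inv_branch x z w))"
      by (rule sum.reindex_bij_betw[OF bij_betw_preimages[OF x w0 wb], symmetric])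
    then have "\<bar>(\<Sum>z\<in>?P. h z) - (\<Sum>z\<in>preimages x w. h z)\<bar> = \<bar>\<Sum>z\<in>?P. h z - h (inv_branch x z w)\<bar>"
      by (simp add: sum_subtractf)
    also have "\<dots> \<le> (\<Sum>z\<in>?P. \<bar>h z - h (inv_branch x z w)\<bar>)" by (rule sum_abs)
    also have "\<dots> < (\<Sum>z\<in>?P. e)"
    proof (rule sum_strict_mono[OF fin ne])
      fix z assume z: "z \<in> ?P"
      then have zs: "z \<in> mspace (J x)" and Tz: "T x z = w0" by simp_all
      have wz: "w \<in> mball_of (J (\<theta> x)) (T x z) \<xi>" using wb Tz by simp
      note b = inv_branch[OF x zs wz]
      have "mdist (J x) z (inv_branch x z w) \<le> mdist (J (\<theta> x)) w0 w"
        using contraction[OF x zs b(1)] b(2) Tz by simp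
      moreover have "inv_branch x z w \<in> mspace (J x)" using b(1) by simp
      moreover have "mdist (J (\<theta> x)) w0 w < \<delta>" using w(2) by simp
      ultimately show "\<bar>h z - h (inv_branch x z w)\<bar> < e" using \<delta>(2) z by blast
    qed
    also have "\<dots> = \<epsilon>" using card by (simp add: e_def)
    finally show "\<bar>(\<Sum>z\<in>preimages x w0. h z) - (\<Sum>z\<in>preimages x w. h z)\<bar> < \<epsilon>" .
  qed
qed

end

section \<open>Conformal measures along an orbit\<close>

text \<open>Only the dual identity ties \<open>\<Lambda>\<close> to the measures; its positivity and
  its size are derived from it.\<close>

locale conformal_fibres = expanding_fibres +
  fixes \<phi> :: "'a \<Rightarrow> 'b \<Rightarrow> real" and \<nu> :: "'a \<Rightarrow> 'b measure" and \<Lambda> B H :: "'a \<Rightarrow> real" and \<alpha> :: real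
  assumes phi_cont: "x \<in> G \<Longrightarrow> continuous_map (mtopology_of (J x)) euclideanreal (\<phi> x)"
    and phi_bound: "\<lbrakk>x \<in> G; z \<in> mspace (J x)\<rbrakk> \<Longrightarrow> \<bar>\<phi> x z\<bar> \<le> B x"
    and holder: "\<lbrakk>x \<in> G; z \<in> mspace (J x); u \<in> mspace (J x); mdist (J x) z u \<le> \<eta> x\<rbrakk> \<Longrightarrow>
      \<bar>\<phi> x z - \<phi> x u\<bar> \<le> H x * mdist (J x) z u powr \<alpha>"
    and H_nonneg: "x \<in> G \<Longrightarrow> H x \<ge> 0"
    and alpha_pos: "\<alpha> > 0"
    and nu: "x \<in> G \<Longrightarrow> borel_probability_on (J x) (\<nu> x)"
    and dual: "\<lbrakk>x \<in> G; continuous_map (mtopology_of (J x)) euclideanreal g\<rbrakk> \<Longrightarrow>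
      (\<integral>w. transfer_operator J T \<phi> x g w \<partial>\<nu> (\<theta> x)) = \<Lambda> x * (\<integral>z. g z \<partial>\<nu> x)"
begin

section \<open>Conformal measures and duality on open sets\<close>

abbreviation "transfer \<equiv> transfer_operator J T \<phi>"

lemma prob_nu: "x \<in> G \<Longrightarrow> prob_space (\<nu> x)"
  using nu unfolding borel_probability_on_def by (rule conjunct1)

lemma finite_nu: "x \<in> G \<Longrightarrow> finite_measure (\<nu> x)"
  by (rule prob_space.finite_measure[OF prob_nu])

lemma sets_nu: "x \<in> G \<Longrightarrow> sets (\<nu> x) = sets (fibre_borel (J x))"
  using nu unfolding borel_probability_on_def by (rule conjunct2)

lemma space_nu: "x \<in> G \<Longrightarrow> space (\<nu> x) = mspace (J x)"
  using sets_eq_imp_space_eq[OF sets_nu] by simp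

lemma open_sets_nu: "x \<in> G \<Longrightarrow> openin (mtopology_of (J x)) V \<Longrightarrow> V \<in> sets (\<nu> x)"
  by (simp only: sets_nu openin_fibre_borel)

lemma continuous_measurable_nu:
  assumes "x \<in> G" "continuous_map (mtopology_of (J x)) euclideanreal g"
  shows "g \<in> borel_measurable (\<nu> x)"
  using continuous_map_fibre_borel[OF assms(2)] measurable_cong_sets[OF sets_nu[OF assms(1)] refl] by blast

lemma continuous_integrable_nu:
  assumes x: "x \<in> G" and g: "continuous_map (mtopology_of (J x)) euclideanreal g"
  shows "integrable (\<nu> x) g"
proof -
  obtain C where C: "\<forall>z\<in>mspace (J x). \<bar>g z\<bar> \<le> C"
    using compact_real_bounded[OF compact[OF x] g] by (rule exE)
  show ?thesis
  proof (rule finite_measure.integrable_const_bound[OF finite_nu[OF x]])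
    show "AE z in \<nu> x. norm (g z) \<le> C" by (rule AE_I2) (use C space_nu[OF x] in simp)
    show "g \<in> borel_measurable (\<nu> x)" by (rule continuous_measurable_nu[OF x g])
  qed
qed

lemma transfer_cont:
  assumes x: "x \<in> G" and g: "continuous_map (mtopology_of (J x)) euclideanreal g"
  shows "continuous_map (mtopology_of (J (\<theta> x))) euclideanreal (transfer x g)"
proof -
  have "continuous_map euclideanreal euclideanreal exp" by (simp add: continuous_on_exp)
  from continuous_map_compose[OF phi_cont[OF x] this]
  have "continuous_map (mtopology_of (J x)) euclideanreal (\<lambda>z. exp (\<phi> x z))" by (simp add: comp_def)
  from continuous_preimage_sum[OF x continuous_map_real_mult[OF g this]]
  show ?thesis unfolding transfer_operator_def .
qed

lemma transfer_abs_le: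
  assumes "\<And>z. z \<in> mspace (J x) \<Longrightarrow> \<bar>g z\<bar> \<le> 1"
  shows "\<bar>transfer x g w\<bar> \<le> transfer x (\<lambda>_. 1) w"
  unfolding transfer_operator_def
proof (rule order_trans[OF sum_abs], rule sum_mono)
  fix z assume "z \<in> preimages x w"
  then show "\<bar>g z * exp (\<phi> x z)\<bar> \<le> 1 * exp (\<phi> x z)"
    using assms[of z] by (simp add: abs_mult)
qed

text \<open>The indicator of an open set is the pointwise limit of truncated multiples of the
  distance to its complement. The transfer operator is a finite sum and preserves pointwise limits,
  and all transforms are dominated by that of the constant 1, which is integrable.\<close>

lemma dual_open:
  assumes x: "x \<in> G" and V: "openin (mtopology_of (J x)) V"
  shows "integrable (\<nu> (\<theta> x)) (transfer x (indicator V))"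
    "(\<integral>w. transfer x (indicator V) w \<partial>\<nu> (\<theta> x)) = \<Lambda> x * measure (\<nu> x) V"
proof -
  let ?F = "mspace (J x) - V"
  have F: "closedin (mtopology_of (J x)) ?F" using closedin_diff[OF closedin_topspace V] by simp
  define g where "g k z = min 1 (real k * dist_to (J x) ?F z)" for k z
  have gc: "continuous_map (mtopology_of (J x)) euclideanreal (g k)" for k
    unfolding g_def
    by (intro continuous_map_real_min continuous_map_canonical_const continuous_map_real_mult_left
        continuous_dist_to) auto
  have g1: "\<bar>g k z\<bar> \<le> 1" for k z
    using dist_to_nonneg[of "J x" ?F z] by (simp add: g_def)
  have lim: "(\<lambda>k. g k z) \<longlonglongrightarrow> indicator V z" if z: "z \<in> mspace (J x)" for z
  proof (cases "z \<in> V")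
    case True
    then have pos: "dist_to (J x) ?F z > 0" using dist_to_pos_iff[OF F z] by simp
    obtain K :: nat where K: "1 / dist_to (J x) ?F z \<le> real K" using real_arch_simple by blast
    have "g k z = 1" if "k \<ge> K" for k
    proof -
      have "1 / dist_to (J x) ?F z \<le> real k" using K that by linarith
      then have "1 \<le> real k * dist_to (J x) ?F z" using pos by (simp add: divide_le_eq)
      then show ?thesis by (simp add: g_def)
    qed
    then have "eventually (\<lambda>k. g k z = indicator V z) sequentially"
      unfolding eventually_sequentially using True by (intro exI[of _ K]) simp
    then show ?thesis by (rule tendsto_eventually)
  next
    case False
    then have "\<not> dist_to (J x) ?F z > 0" using dist_to_pos_iff[OF F z] z by simp
    then have "dist_to (J x) ?F z = 0" using dist_to_nonneg[of "J x" ?F z] by simp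
    then have "g k z = 0" for k by (simp add: g_def)
    then show ?thesis using False by simp
  qed
  have Vs: "V \<in> sets (\<nu> x)" by (rule open_sets_nu[OF x V])
  have int1: "integrable (\<nu> x) (\<lambda>_. 1 :: real)"
    by (rule continuous_integrable_nu[OF x]) simp
  have A: "(\<lambda>k. \<integral>z. g k z \<partial>\<nu> x) \<longlonglongrightarrow> (\<integral>z. indicator V z \<partial>\<nu> x)"
  proof (rule integral_dominated_convergence[OF _ _ int1])
    show "(indicator V :: 'b \<Rightarrow> real) \<in> borel_measurable (\<nu> x)" using Vs by simp
    show "g k \<in> borel_measurable (\<nu> x)" for k by (rule continuous_measurable_nu[OF x gc])
    show "AE z in \<nu> x. (\<lambda>k. g k z) \<longlonglongrightarrow> indicator V z"
      by (rule AE_I2) (simp add: lim space_nu[OF x])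
    show "AE z in \<nu> x. norm (g k z) \<le> 1" for k using g1 by simp
  qed
  have meas: "transfer x (g k) \<in> borel_measurable (\<nu> (\<theta> x))" for k
    by (rule continuous_measurable_nu[OF orbit[OF x] transfer_cont[OF x gc]])
  have limT: "(\<lambda>k. transfer x (g k) w) \<longlonglongrightarrow> transfer x (indicator V) w" for w
    unfolding transfer_operator_def by (intro tendsto_sum tendsto_mult_right) (simp add: lim)
  have measV: "transfer x (indicator V) \<in> borel_measurable (\<nu> (\<theta> x))"
    by (rule borel_measurable_LIMSEQ_real[OF limT meas])
  have intT: "integrable (\<nu> (\<theta> x)) (transfer x (\<lambda>_. 1))"
    by (rule continuous_integrable_nu[OF orbit[OF x] transfer_cont[OF x]]) simp
  have B: "(\<lambda>k. \<integral>w. transfer x (g k) w \<partial>\<nu> (\<theta> x)) \<longlonglongrightarrow> (\<integral>w. transfer x (indicator V) w \<partial>\<nu> (\<theta> x))"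
    by (rule integral_dominated_convergence[OF measV meas intT])
       (use limT transfer_abs_le[OF g1] in simp_all)
  show "integrable (\<nu> (\<theta> x)) (transfer x (indicator V))"
  proof (rule Bochner_Integration.integrable_bound[OF intT measV])
    have "\<bar>transfer x (indicator V) w\<bar> \<le> transfer x (\<lambda>_. 1) w" for w
      by (rule transfer_abs_le) (simp add: indicator_def)
    then show "AE w in \<nu> (\<theta> x). norm (transfer x (indicator V) w) \<le> norm (transfer x (\<lambda>_. 1) w)"
      by (intro AE_I2) (simp add: order_trans[OF _ abs_ge_self])
  qed
  have "(\<lambda>k. \<Lambda> x * (\<integral>z. g k z \<partial>\<nu> x)) \<longlonglongrightarrow> \<Lambda> x * (\<integral>z. indicator V z \<partial>\<nu> x)"
    by (rule tendsto_mult_left[OF A])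
  then have "(\<lambda>k. \<integral>w. transfer x (g k) w \<partial>\<nu> (\<theta> x)) \<longlonglongrightarrow> \<Lambda> x * (\<integral>z. indicator V z \<partial>\<nu> x)"
    unfolding dual[OF x gc] .
  from LIMSEQ_unique[OF B this]
  show "(\<integral>w. transfer x (indicator V) w \<partial>\<nu> (\<theta> x)) = \<Lambda> x * measure (\<nu> x) V"
    using Vs sets.sets_into_space[OF Vs] by (simp add: Int_absorb1 Int_absorb2)
qed

section \<open>Masses of images under one step\<close>

lemma image_open:
  "x \<in> G \<Longrightarrow> openin (mtopology_of (J x)) V \<Longrightarrow> openin (mtopology_of (J (\<theta> x))) (T x ` V)"
  using open_T unfolding open_map_def by blast

lemma integral_indicator_nu:
  assumes "x \<in> G" "openin (mtopology_of (J x)) V"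
  shows "integrable (\<nu> x) (\<lambda>z. c * indicator V z)" "(\<integral>z. c * indicator V z \<partial>\<nu> x) = c * measure (\<nu> x) V"
proof -
  have V: "V \<in> sets (\<nu> x)" by (rule open_sets_nu[OF assms])
  have "integrable (\<nu> x) (indicator V :: 'b \<Rightarrow> real)"
    by (rule integrable_real_indicator[OF V])
       (simp add: finite_measure.emeasure_eq_measure[OF finite_nu[OF assms(1)]])
  then show "integrable (\<nu> x) (\<lambda>z. c * indicator V z)" by simp
  show "(\<integral>z. c * indicator V z \<partial>\<nu> x) = c * measure (\<nu> x) V"
    using V sets.sets_into_space[OF V] by (simp add: Int_absorb1 Int_absorb2)
qed

text \<open>Over a point of the image one preimage in \<open>V\<close> already contributes at least
  \<open>exp c\<close> to the transform of the indicator of \<open>V\<close>, and the other terms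
  are nonnegative.\<close>

lemma nu_image_lower:
  assumes x: "x \<in> G" and V: "openin (mtopology_of (J x)) V" and c: "\<And>z. z \<in> V \<Longrightarrow> c \<le> \<phi> x z"
  shows "exp c * measure (\<nu> (\<theta> x)) (T x ` V) \<le> \<Lambda> x * measure (\<nu> x) V"
proof -
  note TV = image_open[OF x V]
  have Vsub: "V \<subseteq> mspace (J x)" using openin_subset[OF V] by simp
  have "(\<integral>w. exp c * indicator (T x ` V) w \<partial>\<nu> (\<theta> x)) \<le> (\<integral>w. transfer x (indicator V) w \<partial>\<nu> (\<theta> x))"
  proof (rule integral_mono[OF integral_indicator_nu(1)[OF orbit[OF x] TV] dual_open(1)[OF x V]])
    fix w assume "w \<in> space (\<nu> (\<theta> x))"
    then have w: "w \<in> mspace (J (\<theta> x))" by (simp add: space_nu[OF orbit[OF x]])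
    have nn: "0 \<le> indicator V z * exp (\<phi> x z)" for z by (simp add: indicator_def)
    show "exp c * indicator (T x ` V) w \<le> transfer x (indicator V) w"
    proof (cases "w \<in> T x ` V")
      case True
      then obtain u where u: "u \<in> V" "w = T x u" by (rule imageE)
      have "exp c * indicator (T x ` V) w \<le> indicator V u * exp (\<phi> x u)" using True u(1) c by simp
      also have "\<dots> \<le> transfer x (indicator V) w"
        unfolding transfer_operator_def
        by (rule member_le_sum[OF _ nn finite_preimages[OF x w]]) (use u Vsub in auto)
      finally show ?thesis .
    next
      case False
      then show ?thesis unfolding transfer_operator_def by (simp add: sum_nonneg nn)
    qed
  qed
  then show ?thesis unfolding dual_open(2)[OF x V] integral_indicator_nu(2)[OF orbit[OF x] TV] .
qed

text \<open>Injectivity leaves a single nonzero term in the sum over preimages.\<close>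

lemma nu_image_upper:
  assumes x: "x \<in> G" and V: "openin (mtopology_of (J x)) V" and c: "\<And>z. z \<in> V \<Longrightarrow> \<phi> x z \<le> c"
    and inj: "inj_on (T x) V"
  shows "\<Lambda> x * measure (\<nu> x) V \<le> exp c * measure (\<nu> (\<theta> x)) (T x ` V)"
proof -
  note TV = image_open[OF x V]
  have Vsub: "V \<subseteq> mspace (J x)" using openin_subset[OF V] by simp
  have "(\<integral>w. transfer x (indicator V) w \<partial>\<nu> (\<theta> x)) \<le> (\<integral>w. exp c * indicator (T x ` V) w \<partial>\<nu> (\<theta> x))"
  proof (rule integral_mono[OF dual_open(1)[OF x V] integral_indicator_nu(1)[OF orbit[OF x] TV]])
    fix w assume "w \<in> space (\<nu> (\<theta> x))"
    then have w: "w \<in> mspace (J (\<theta> x))" by (simp add: space_nu[OF orbit[OF x]])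
    show "transfer x (indicator V) w \<le> exp c * indicator (T x ` V) w"
    proof (cases "w \<in> T x ` V")
      case True
      then obtain u where u: "u \<in> V" "w = T x u" by (rule imageE)
      have eq: "z = u" if "z \<in> V" "T x z = w" for z
        by (rule inj_onD[OF inj _ that(1) u(1)]) (simp add: that(2) u(2))
      have up: "u \<in> preimages x w" using u Vsub by auto
      have "transfer x (indicator V) w = (\<Sum>z\<in>{u}. indicator V z * exp (\<phi> x z))"
        unfolding transfer_operator_def
        by (rule sum.mono_neutral_right[OF finite_preimages[OF x w]])
           (use up eq in \<open>auto simp: indicator_def\<close>)
      also have "\<dots> \<le> exp c * indicator (T x ` V) w" using True u(1) c by simp
      finally show ?thesis .
    next
      case False
      then have "z \<notin> V" if "T x z = w" for z using that by blast
      then have "transfer x (indicator V) w = 0"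
        unfolding transfer_operator_def by (intro sum.neutral) (simp add: indicator_def)
      then show ?thesis by simp
    qed
  qed
  then show ?thesis unfolding dual_open(2)[OF x V] integral_indicator_nu(2)[OF orbit[OF x] TV] .
qed

section \<open>Size of the eigenvalue and mass of balls\<close>

lemma nu_whole: "x \<in> G \<Longrightarrow> measure (\<nu> x) (mspace (J x)) = 1"
  using prob_space.prob_space[OF prob_nu] space_nu by simp

text \<open>The lower bound for images is applied to the whole fibre, which has mass 1 and is mapped
  onto the next one.\<close>

lemma Lambda_pos:
  assumes x: "x \<in> G"
  shows "\<Lambda> x > 0"
proof -
  have V: "openin (mtopology_of (J x)) (mspace (J x))" using openin_topspace[of "mtopology_of (J x)"] by simp
  have "exp (- B x) * measure (\<nu> (\<theta> x)) (T x ` mspace (J x)) \<le> \<Lambda> x * measure (\<nu> x) (mspace (J x))"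
    by (rule nu_image_lower[OF x V]) (use phi_bound[OF x] in \<open>simp add: abs_le_iff minus_le_iff\<close>)
  then have "exp (- B x) \<le> \<Lambda> x" by (simp add: surj[OF x] nu_whole x orbit)
  then show ?thesis using exp_gt_zero[of "- B x"] by linarith
qed

text \<open>\<open>\<Lambda> x\<close> is the integral of the transform of 1, a sum whose number of
  terms is at most the degree. The \<open>max 1\<close> keeps the logarithm nonnegative.\<close>

lemma Lambda_le:
  assumes x: "x \<in> G"
  shows "\<Lambda> x \<le> exp (B x + ln (max 1 (enn2real (fibre_degree \<theta> J T x))))"
proof -
  let ?d = "enn2real (fibre_degree \<theta> J T x)"
  interpret P: prob_space "\<nu> (\<theta> x)" by (rule prob_nu[OF orbit[OF x]])
  have cont1: "continuous_map (mtopology_of (J x)) euclideanreal (\<lambda>_. 1)" by simp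
  have "\<Lambda> x = (\<integral>w. transfer x (\<lambda>_. 1) w \<partial>\<nu> (\<theta> x))"
    using dual[OF x cont1] prob_space.prob_space[OF prob_nu[OF x]] by simp
  also have "\<dots> \<le> (\<integral>w. max 1 ?d * exp (B x) \<partial>\<nu> (\<theta> x))"
  proof (rule integral_mono[OF continuous_integrable_nu[OF orbit[OF x] transfer_cont[OF x cont1]]])
    show "integrable (\<nu> (\<theta> x)) (\<lambda>w. max 1 ?d * exp (B x))" by simp
    fix w assume "w \<in> space (\<nu> (\<theta> x))"
    then have w: "w \<in> mspace (J (\<theta> x))" by (simp add: space_nu[OF orbit[OF x]])
    have "transfer x (\<lambda>_. 1) w \<le> (\<Sum>z\<in>preimages x w. exp (B x))"
      unfolding transfer_operator_def
      by (rule sum_mono) (use phi_bound[OF x] in \<open>simp add: abs_le_iff\<close>)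
    also have "\<dots> = real (card (preimages x w)) * exp (B x)" by simp
    also have "\<dots> \<le> max 1 ?d * exp (B x)"
      by (rule mult_right_mono) (use card_preimages_le[OF x w] in auto)
    finally show "transfer x (\<lambda>_. 1) w \<le> max 1 ?d * exp (B x)" .
  qed
  also have "\<dots> = exp (B x + ln (max 1 ?d))" by (simp add: exp_add P.prob_space mult.commute)
  finally show ?thesis .
qed

text \<open>Bounds the logarithm of the factor by which the mass can drop from the image of an open
  set to the set itself. One \<open>B x\<close> comes from the smallest weight
  \<open>exp (\<phi> x z)\<close>, the rest from the upper bound for
  \<open>\<Lambda> x\<close>.\<close>

definition ball_cost :: "'a \<Rightarrow> real" where
  "ball_cost x = 2 * B x + ln (max 1 (enn2real (fibre_degree \<theta> J T x)))"

text \<open>Stated for all open sets and not only for balls, since the induction passes from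
  \<open>V\<close> to its image.\<close>

lemma iter_image_lower:
  "x \<in> G \<Longrightarrow> openin (mtopology_of (J x)) V \<Longrightarrow>
    exp (- (\<Sum>j<n. ball_cost ((\<theta> ^^ j) x))) * measure (\<nu> ((\<theta> ^^ n) x)) (iter n x ` V) \<le> measure (\<nu> x) V"
proof (induction n arbitrary: x V)
  case 0
  then show ?case by simp
next
  case (Suc n)
  note x = Suc.prems(1) and V = Suc.prems(2)
  let ?S = "\<Sum>j<n. ball_cost ((\<theta> ^^ j) (\<theta> x))"
  have S: "(\<Sum>j<Suc n. ball_cost ((\<theta> ^^ j) x)) = ball_cost x + ?S"
    by (simp add: sum.lessThan_Suc_shift funpow_swap1 del: sum.lessThan_Suc)
  have im: "iter (Suc n) x ` V = iter n (\<theta> x) ` (T x ` V)"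
    unfolding image_image by (rule image_cong[OF refl fibre_iter_Suc_left])
  have th: "(\<theta> ^^ Suc n) x = (\<theta> ^^ n) (\<theta> x)" by (simp add: funpow_swap1)
  have "exp (- (ball_cost x + ?S)) * measure (\<nu> ((\<theta> ^^ n) (\<theta> x))) (iter n (\<theta> x) ` (T x ` V))
      = exp (- ball_cost x) * (exp (- ?S) * measure (\<nu> ((\<theta> ^^ n) (\<theta> x))) (iter n (\<theta> x) ` (T x ` V)))"
    unfolding mult.assoc[symmetric] mult_exp_exp by simp
  also have "\<dots> \<le> exp (- ball_cost x) * measure (\<nu> (\<theta> x)) (T x ` V)"
    by (rule mult_left_mono[OF Suc.IH[OF orbit[OF x] image_open[OF x V]]]) simp
  also have "\<dots> \<le> measure (\<nu> x) V"
  proof -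
    let ?l = "B x + ln (max 1 (enn2real (fibre_degree \<theta> J T x)))"
    have Vsub: "V \<subseteq> mspace (J x)" using openin_subset[OF V] by simp
    have "exp (- B x) * measure (\<nu> (\<theta> x)) (T x ` V) \<le> \<Lambda> x * measure (\<nu> x) V"
      by (rule nu_image_lower[OF x V]) (use phi_bound[OF x] Vsub in \<open>force simp: abs_le_iff\<close>)
    also have "\<dots> \<le> exp ?l * measure (\<nu> x) V"
      by (rule mult_right_mono[OF Lambda_le[OF x] measure_nonneg])
    finally have "exp (- ?l) * (exp (- B x) * measure (\<nu> (\<theta> x)) (T x ` V)) \<le> exp (- ?l) * (exp ?l * measure (\<nu> x) V)"
      by (rule mult_left_mono) simp
    moreover have "exp (- ball_cost x) = exp (- ?l) * exp (- B x)"
      unfolding mult_exp_exp by (simp add: ball_cost_def)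
    moreover have "exp (- ?l) * exp ?l = 1" unfolding mult_exp_exp by simp
    ultimately show ?thesis by (simp only: mult.assoc[symmetric] mult_1_left)
  qed
  finally show ?case unfolding S im th .
qed

text \<open>After \<open>N\<close> steps the ball has spread over a whole fibre, which has mass
  1.\<close>

lemma ball_lower:
  assumes x: "x \<in> G" and z: "z \<in> mspace (J x)"
    and N: "iter N x ` mball_of (J x) z \<xi> = mspace (J ((\<theta> ^^ N) x))"
  shows "exp (- (\<Sum>j<N. ball_cost ((\<theta> ^^ j) x))) \<le> measure (\<nu> x) (mball_of (J x) z \<xi>)"
  using iter_image_lower[OF x openin_mball_of, of N z \<xi>] unfolding N nu_whole[OF orbit_funpow[OF x]] by simp

text \<open>At time \<open>j\<close> the remaining cylinder has depth \<open>n - j\<close>, hence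
  radius at most \<open>\<xi>\<close> divided by the remaining rates; the \<open>j\<close>-th term
  is the resulting Hoelder bound for the oscillation of \<open>\<phi>\<close> around the centre.
  Read from its last index, the sum runs through the backward orbit of
  \<open>(\<theta> ^^ n) x\<close>.\<close>

definition distortion :: "nat \<Rightarrow> 'a \<Rightarrow> real" where
  "distortion n x = (\<Sum>j<n. H ((\<theta> ^^ j) x) * (\<xi> / (\<Prod>i\<in>{j..<n}. \<gamma> ((\<theta> ^^ i) x))) powr \<alpha>)"

lemma distortion_Suc:
  "distortion (Suc n) x = H x * (\<xi> / (\<Prod>i<Suc n. \<gamma> ((\<theta> ^^ i) x))) powr \<alpha> + distortion n (\<theta> x)"
proof -
  have P: "(\<Prod>i\<in>{Suc j..<Suc n}. \<gamma> ((\<theta> ^^ i) x)) = (\<Prod>i\<in>{j..<n}. \<gamma> ((\<theta> ^^ i) (\<theta> x)))" for j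
    unfolding prod.shift_bounds_Suc_ivl by (simp add: funpow_swap1)
  show ?thesis unfolding distortion_def sum.lessThan_Suc_shift P
    by (simp only: atLeast0LessThan funpow_0 funpow_Suc_right comp_def)
qed

lemma phi_cyl:
  assumes x: "x \<in> G" and z: "z \<in> mspace (J x)" and u: "u \<in> cyl x (Suc n) z"
  shows "\<bar>\<phi> x z - \<phi> x u\<bar> \<le> H x * (\<xi> / (\<Prod>i<Suc n. \<gamma> ((\<theta> ^^ i) x))) powr \<alpha>"
proof -
  let ?p = "\<Prod>i<Suc n. \<gamma> ((\<theta> ^^ i) x)"
  have g1: "\<gamma> ((\<theta> ^^ i) x) > 0" for i using gamma[OF orbit_funpow[OF x]] by (rule less_trans[OF zero_less_one])
  have p: "?p > 0" by (rule prod_pos) (use g1 in simp)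
  have ub: "u \<in> mball_of (J x) z (\<eta> x)" using u by (simp add: cyl_Suc[OF x z])
  then have "\<bar>\<phi> x z - \<phi> x u\<bar> \<le> H x * mdist (J x) z u powr \<alpha>"
    by (intro holder[OF x z]) simp_all
  also have "\<dots> \<le> H x * (\<xi> / ?p) powr \<alpha>"
  proof (rule mult_left_mono[OF powr_mono2 H_nonneg[OF x]])
    have "?p * mdist (J x) z u < \<xi>" by (rule cyl_dist[OF x z u])
    then show "mdist (J x) z u \<le> \<xi> / ?p" using p by (simp only: pos_le_divide_eq mult.commute[of "mdist (J x) z u"] less_imp_le)
  qed (use alpha_pos in simp_all)
  finally show ?thesis .
qed

text \<open>One-step comparison of \<open>\<nu> x\<close> and \<open>\<nu> (\<theta> x)\<close> on a cylinder costs the oscillation of \<open>\<phi> x\<close> there;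
  the costs along the orbit add up to \<^term>\<open>distortion\<close>.\<close>

lemma gibbs_bounds:
  "x \<in> G \<Longrightarrow> z \<in> mspace (J x) \<Longrightarrow>
    exp ((\<Sum>j<n. \<phi> ((\<theta> ^^ j) x) (iter j x z)) - distortion n x) * measure (\<nu> ((\<theta> ^^ n) x)) (mball_of (J ((\<theta> ^^ n) x)) (iter n x z) \<xi>)
      \<le> (\<Prod>j<n. \<Lambda> ((\<theta> ^^ j) x)) * measure (\<nu> x) (cyl x n z) \<and>
    (\<Prod>j<n. \<Lambda> ((\<theta> ^^ j) x)) * measure (\<nu> x) (cyl x n z) \<le>
    exp ((\<Sum>j<n. \<phi> ((\<theta> ^^ j) x) (iter j x z)) + distortion n x) * measure (\<nu> ((\<theta> ^^ n) x)) (mball_of (J ((\<theta> ^^ n) x)) (iter n x z) \<xi>)"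
proof (induction n arbitrary: x z)
  case 0
  then show ?case by (simp add: distortion_def)
next
  case (Suc n)
  note x = Suc.prems(1) and z = Suc.prems(2)
  let ?\<delta> = "H x * (\<xi> / (\<Prod>i<Suc n. \<gamma> ((\<theta> ^^ i) x))) powr \<alpha>"
  let ?S = "\<Sum>j<n. \<phi> ((\<theta> ^^ j) (\<theta> x)) (iter j (\<theta> x) (T x z))"
  let ?D = "distortion n (\<theta> x)"
  let ?L = "\<Prod>j<n. \<Lambda> ((\<theta> ^^ j) (\<theta> x))"
  let ?b = "measure (\<nu> ((\<theta> ^^ n) (\<theta> x))) (mball_of (J ((\<theta> ^^ n) (\<theta> x))) (iter n (\<theta> x) (T x z)) \<xi>)"
  let ?m = "measure (\<nu> (\<theta> x)) (cyl (\<theta> x) n (T x z))"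
  let ?M = "measure (\<nu> x) (cyl x (Suc n) z)"
  have S: "(\<Sum>j<Suc n. \<phi> ((\<theta> ^^ j) x) (iter j x z)) = \<phi> x z + ?S"
    unfolding sum.lessThan_Suc_shift
    by (simp only: fibre_iter_Suc_left fibre_iter.simps(1) funpow_Suc_right comp_def funpow_0)
  have L: "(\<Prod>j<Suc n. \<Lambda> ((\<theta> ^^ j) x)) = \<Lambda> x * ?L"
    unfolding prod.lessThan_Suc_shift by (simp only: funpow_Suc_right comp_def funpow_0)
  have b: "measure (\<nu> ((\<theta> ^^ Suc n) x)) (mball_of (J ((\<theta> ^^ Suc n) x)) (iter (Suc n) x z) \<xi>) = ?b"
    by (simp only: fibre_iter_Suc_left funpow_Suc_right comp_def)
  have L0: "?L \<ge> 0" by (rule prod_nonneg) (use Lambda_pos[OF orbit_funpow[OF orbit[OF x]]] in \<open>simp add: less_imp_le\<close>)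
  have IH: "exp (?S - ?D) * ?b \<le> ?L * ?m" "?L * ?m \<le> exp (?S + ?D) * ?b"
    using Suc.IH[OF orbit[OF x] T_in[OF x z]] by (rule conjunct1, rule conjunct2)
  have lo: "exp (\<phi> x z - ?\<delta>) * ?m \<le> \<Lambda> x * ?M"
    using nu_image_lower[OF x openin_cyl[OF x z], of "Suc n" "\<phi> x z - ?\<delta>"] phi_cyl[OF x z]
    unfolding T_cyl[OF x z] abs_le_iff by (simp add: algebra_simps)
  have up: "\<Lambda> x * ?M \<le> exp (\<phi> x z + ?\<delta>) * ?m"
    using nu_image_upper[OF x openin_cyl[OF x z] _ inj_on_cyl[OF x z], of n "\<phi> x z + ?\<delta>"] phi_cyl[OF x z]
    unfolding T_cyl[OF x z] abs_le_iff by (simp add: algebra_simps)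
  have "exp (\<phi> x z + ?S - (?\<delta> + ?D)) * ?b = exp (\<phi> x z - ?\<delta>) * (exp (?S - ?D) * ?b)"
    unfolding mult.assoc[symmetric] mult_exp_exp by (simp only: add_diff_eq diff_add_eq diff_diff_add ac_simps)
  also have "\<dots> \<le> exp (\<phi> x z - ?\<delta>) * (?L * ?m)" by (rule mult_left_mono[OF IH(1)]) simp
  also have "\<dots> = ?L * (exp (\<phi> x z - ?\<delta>) * ?m)" by (simp only: ac_simps)
  also have "\<dots> \<le> ?L * (\<Lambda> x * ?M)" by (rule mult_left_mono[OF lo L0])
  finally have 1: "exp (\<phi> x z + ?S - (?\<delta> + ?D)) * ?b \<le> \<Lambda> x * ?L * ?M" by (simp only: ac_simps)
  have "?L * (\<Lambda> x * ?M) \<le> ?L * (exp (\<phi> x z + ?\<delta>) * ?m)" by (rule mult_left_mono[OF up L0])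
  also have "\<dots> = exp (\<phi> x z + ?\<delta>) * (?L * ?m)" by (simp only: ac_simps)
  also have "\<dots> \<le> exp (\<phi> x z + ?\<delta>) * (exp (?S + ?D) * ?b)" by (rule mult_left_mono[OF IH(2)]) simp
  also have "\<dots> = exp (\<phi> x z + ?S + (?\<delta> + ?D)) * ?b"
    unfolding mult.assoc[symmetric] mult_exp_exp by (simp only: ac_simps)
  finally have 2: "\<Lambda> x * ?L * ?M \<le> exp (\<phi> x z + ?S + (?\<delta> + ?D)) * ?b" by (simp only: ac_simps)
  show ?case unfolding S L b distortion_Suc using 1 2 by (rule conjI)
qed

end

section \<open>Full support, positive densities and comparison of Gibbs measures\<close>

text \<open>\<open>Q\<close> is evaluated at the end of the orbit segment, which makes one bound
  serve all depths \<open>n\<close> although the rates vary.\<close>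

locale gibbs_fibres = conformal_fibres +
  fixes N :: "'a \<Rightarrow> nat" and Q :: "'a \<Rightarrow> real"
  assumes exact: "\<lbrakk>x \<in> G; z \<in> mspace (J x)\<rbrakk> \<Longrightarrow>
      fibre_iter \<theta> T (N x) x ` mball_of (J x) z \<xi> = mspace (J ((\<theta> ^^ N x) x))"
    and growth: "x \<in> G \<Longrightarrow> filterlim (\<lambda>n. \<Prod>i<n. \<gamma> ((\<theta> ^^ i) x)) at_top sequentially"
    and distortion_le: "x \<in> G \<Longrightarrow> distortion n x \<le> Q ((\<theta> ^^ n) x)"
begin

text \<open>Both ingredients belong to the end point of an orbit segment: \<open>Q\<close> bounds
  the distortion accumulated before it, and the sum of costs bounds the mass of a
  \<open>\<xi>\<close>-ball there from below.\<close>

definition gibbs_const :: "'a \<Rightarrow> real" where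
  "gibbs_const x = exp (Q x + (\<Sum>j<N x. ball_cost ((\<theta> ^^ j) x)))"

lemma ball_cost_nonneg:
  assumes "x \<in> G"
  shows "ball_cost x \<ge> 0"
proof -
  obtain z where z: "z \<in> mspace (J x)" using nonempty[OF assms] by blast
  have "B x \<ge> 0" by (rule order_trans[OF abs_ge_zero phi_bound[OF assms z]])
  then show ?thesis by (simp add: ball_cost_def)
qed

text \<open>With \<open>ln (\<Lambda> x)\<close> as pseudo-pressure the product of eigenvalues in
  \<open>gibbs_bounds\<close> cancels. What remains, up to distortion, is the mass of a
  \<open>\<xi>\<close>-ball, which is at most 1 and is bounded below by
  \<open>ball_lower\<close>.\<close>

lemma gibbs_nu:
  fixes n :: nat
  assumes x: "x \<in> G" and z: "z \<in> mspace (J x)"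
  defines "r \<equiv> measure (\<nu> x) (cyl x n z) /
    exp ((\<Sum>j<n. \<phi> ((\<theta> ^^ j) x) (iter j x z)) - (\<Sum>j<n. ln (\<Lambda> ((\<theta> ^^ j) x))))"
  shows "inverse (gibbs_const ((\<theta> ^^ n) x)) \<le> r" "r \<le> gibbs_const ((\<theta> ^^ n) x)"
proof -
  let ?S = "\<Sum>j<n. \<phi> ((\<theta> ^^ j) x) (iter j x z)" and ?P = "\<Sum>j<n. ln (\<Lambda> ((\<theta> ^^ j) x))"
  let ?y = "(\<theta> ^^ n) x" and ?D = "distortion n x" and ?L = "\<Prod>j<n. \<Lambda> ((\<theta> ^^ j) x)"
  let ?b = "measure (\<nu> ((\<theta> ^^ n) x)) (mball_of (J ((\<theta> ^^ n) x)) (iter n x z) \<xi>)"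
  let ?R = "\<Sum>j<N ?y. ball_cost ((\<theta> ^^ j) ?y)"
  have y: "?y \<in> G" by (rule orbit_funpow[OF x])
  have expP: "exp ?P = ?L"
    unfolding exp_sum[OF finite_lessThan] by (rule prod.cong[OF refl]) (simp add: Lambda_pos orbit_funpow x)
  have r: "r = exp (- ?S) * (?L * measure (\<nu> x) (cyl x n z))"
    unfolding r_def expP[symmetric] by (simp add: exp_diff exp_minus field_simps)
  have g: "exp (?S - ?D) * ?b \<le> ?L * measure (\<nu> x) (cyl x n z)"
    "?L * measure (\<nu> x) (cyl x n z) \<le> exp (?S + ?D) * ?b"
    using gibbs_bounds[OF x z, of n] by (rule conjunct1, rule conjunct2)
  have DQ: "?D \<le> Q ?y" by (rule distortion_le[OF x])
  have b: "exp (- ?R) \<le> ?b"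
    by (rule ball_lower[OF y iter_in[OF x z] exact[OF y iter_in[OF x z]]])
  have R: "?R \<ge> 0" by (rule sum_nonneg) (simp add: ball_cost_nonneg orbit_funpow[OF y])
  have b1: "?b \<le> 1" by (rule prob_space.prob_le_1[OF prob_nu[OF y]])
  have "inverse (gibbs_const ?y) = exp (- Q ?y) * exp (- ?R)"
    unfolding gibbs_const_def mult_exp_exp by (simp flip: exp_minus)
  also have "\<dots> \<le> exp (- ?D) * ?b" by (rule mult_mono[OF _ b]) (use DQ in simp_all)
  also have "\<dots> = exp (- ?S) * (exp (?S - ?D) * ?b)"
    unfolding mult.assoc[symmetric] mult_exp_exp by simp
  also have "\<dots> \<le> r" unfolding r by (rule mult_left_mono[OF g(1)]) simp
  finally show "inverse (gibbs_const ?y) \<le> r" .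
  have "r \<le> exp (- ?S) * (exp (?S + ?D) * ?b)" unfolding r by (rule mult_left_mono[OF g(2)]) simp
  also have "\<dots> = exp ?D * ?b" unfolding mult.assoc[symmetric] mult_exp_exp by simp
  also have "\<dots> \<le> exp ?D * 1" by (rule mult_left_mono[OF b1]) simp
  also have "\<dots> \<le> gibbs_const ?y" using DQ R by (simp add: gibbs_const_def)
  finally show "r \<le> gibbs_const ?y" .
qed

lemma nu_cyl_pos:
  assumes x: "x \<in> G" and z: "z \<in> mspace (J x)"
  shows "measure (\<nu> x) (cyl x n z) > 0"
proof -
  have "0 < inverse (gibbs_const ((\<theta> ^^ n) x))" by (simp add: gibbs_const_def)
  from less_le_trans[OF this gibbs_nu(1)[OF x z]] show ?thesis by (simp add: zero_less_divide_iff)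
qed

text \<open>The estimate in \<open>cyl_dist\<close> does not depend on the centre, so cylinders
  shrink uniformly over the fibre.\<close>

lemma cyl_small:
  assumes x: "x \<in> G" and r: "r > 0"
  shows "eventually (\<lambda>n. \<forall>z\<in>mspace (J x). \<forall>u\<in>cyl x n z. mdist (J x) z u < r) sequentially"
  using filterlim_at_top_dense[THEN iffD1, OF growth[OF x], rule_format, of "\<xi> / r"]
proof eventually_elim
  fix n assume n: "\<xi> / r < (\<Prod>i<n. \<gamma> ((\<theta> ^^ i) x))"
  let ?p = "\<Prod>i<n. \<gamma> ((\<theta> ^^ i) x)"
  show "\<forall>z\<in>mspace (J x). \<forall>u\<in>cyl x n z. mdist (J x) z u < r"
  proof (intro ballI)
    fix z u assume "z \<in> mspace (J x)" "u \<in> cyl x n z"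
    then have "?p * mdist (J x) z u < \<xi>" by (rule cyl_dist[OF x])
    also have "\<xi> < ?p * r" using n r by (simp add: divide_less_eq)
    finally show "mdist (J x) z u < r"
      using divide_pos_pos[OF xi_pos r] n by (simp add: mult_less_cancel_left)
  qed
qed

lemma cyl_in_open:
  assumes x: "x \<in> G" and U: "openin (mtopology_of (J x)) U" and z: "z \<in> U"
  shows "\<exists>n. cyl x n z \<subseteq> U"
proof -
  have zs: "z \<in> mspace (J x)" using openin_subset[OF U] z by auto
  obtain r where r: "r > 0" "mball_of (J x) z r \<subseteq> U"
    using bspec[OF conjunct2[OF U[unfolded openin_mtopology_of]] z] by (elim exE conjE)
  obtain n where n: "\<forall>z\<in>mspace (J x). \<forall>u\<in>cyl x n z. mdist (J x) z u < r"
    using cyl_small[OF x r(1)] unfolding eventually_sequentially by blast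
  have "cyl x n z \<subseteq> mball_of (J x) z r"
    using n zs cyl_subset[OF x zs, of n] by auto
  then show ?thesis using r(2) by blast
qed

lemma nu_open_pos:
  assumes x: "x \<in> G" and U: "openin (mtopology_of (J x)) U" and z: "z \<in> U"
  shows "measure (\<nu> x) U > 0"
proof -
  have zs: "z \<in> mspace (J x)" using openin_subset[OF U] z by auto
  obtain n where n: "cyl x n z \<subseteq> U" using cyl_in_open[OF x U z] by (rule exE)
  have "measure (\<nu> x) (cyl x n z) \<le> measure (\<nu> x) U"
    by (rule finite_measure.finite_measure_mono[OF finite_nu[OF x] n open_sets_nu[OF x U]])
  then show ?thesis using nu_cyl_pos[OF x zs, of n] by linarith
qed

text \<open>If \<open>q z < 0\<close>, continuity gives an open set containing \<open>z\<close> on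
  which \<open>q\<close> stays below \<open>q z / 2\<close>; its mass is positive by full support,
  so the integral of \<open>q\<close> over it is negative.\<close>

lemma density_nonneg:
  assumes x: "x \<in> G" and q: "continuous_map (mtopology_of (J x)) euclideanreal q"
    and nn: "\<And>A. A \<in> sets (\<nu> x) \<Longrightarrow> 0 \<le> (LINT z:A|\<nu> x. q z)" and z: "z \<in> mspace (J x)"
  shows "q z \<ge> 0"
proof (rule ccontr)
  assume "\<not> q z \<ge> 0"
  then have neg: "q z < 0" by simp
  let ?U = "{u \<in> mspace (J x). q u < q z / 2}"
  have U: "openin (mtopology_of (J x)) ?U"
    using openin_continuous_map_preimage[OF q, of "{..<q z / 2}"] by simp
  have pos: "measure (\<nu> x) ?U > 0" by (rule nu_open_pos[OF x U, of z]) (use z neg in simp)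
  have Us: "?U \<in> sets (\<nu> x)" by (rule open_sets_nu[OF x U])
  have "(\<integral>u. indicator ?U u * q u \<partial>\<nu> x) \<le> (\<integral>u. (q z / 2) * indicator ?U u \<partial>\<nu> x)"
  proof (rule integral_mono[OF integrable_mult_indicator[OF Us continuous_integrable_nu[OF x q], unfolded real_scaleR_def]
        integral_indicator_nu(1)[OF x U]])
    show "indicator ?U u * q u \<le> (q z / 2) * indicator ?U u" for u by (simp add: indicator_def)
  qed
  also have "\<dots> = (q z / 2) * measure (\<nu> x) ?U" by (rule integral_indicator_nu(2)[OF x U])
  also have "\<dots> < 0" using neg pos by (simp add: mult_neg_pos)
  finally show False using nn[OF Us] by (simp add: set_lebesgue_integral_def)
qed

section \<open>Positivity of eigenfunctions\<close>

lemma iter_cyl: "x \<in> G \<Longrightarrow> z \<in> mspace (J x) \<Longrightarrow>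
    iter n x ` cyl x n z = mball_of (J ((\<theta> ^^ n) x)) (iter n x z) \<xi>"
proof (induction n arbitrary: x z)
  case (Suc n)
  note x = Suc.prems(1) and z = Suc.prems(2)
  have "iter (Suc n) x ` cyl x (Suc n) z = iter n (\<theta> x) ` (T x ` cyl x (Suc n) z)"
    unfolding image_image by (rule image_cong[OF refl fibre_iter_Suc_left])
  also have "\<dots> = mball_of (J ((\<theta> ^^ n) (\<theta> x))) (iter n (\<theta> x) (T x z)) \<xi>"
    unfolding T_cyl[OF x z] by (rule Suc.IH[OF orbit[OF x] T_in[OF x z]])
  also have "\<dots> = mball_of (J ((\<theta> ^^ Suc n) x)) (iter (Suc n) x z) \<xi>"
    by (simp only: fibre_iter_Suc_left funpow_Suc_right comp_def)
  finally show ?case .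
qed simp

text \<open>Positivity at a point passes to its image, because the transfer sum has nonnegative
  terms. A cylinder inside the open set where \<open>q x\<close> is positive is spread over a whole
  fibre, and from then on surjectivity keeps \<open>q\<close> positive. The conclusion concerns late
  fibres only; \<open>AE_eventually_in\<close> is what carries it back to almost every
  fibre.\<close>

lemma eigenfunction_eventually_pos:
  assumes x: "x \<in> G"
    and q0: "\<And>k z. z \<in> mspace (J ((\<theta> ^^ k) x)) \<Longrightarrow> q ((\<theta> ^^ k) x) z \<ge> 0"
    and qc: "continuous_map (mtopology_of (J x)) euclideanreal (q x)"
    and eig: "\<And>k w. w \<in> mspace (J (\<theta> ((\<theta> ^^ k) x))) \<Longrightarrow>
      transfer ((\<theta> ^^ k) x) (q ((\<theta> ^^ k) x)) w = \<Lambda> ((\<theta> ^^ k) x) * q (\<theta> ((\<theta> ^^ k) x)) w"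
    and int: "(\<integral>z. q x z \<partial>\<nu> x) = 1"
  shows "\<exists>m. \<forall>k\<ge>m. \<forall>w\<in>mspace (J ((\<theta> ^^ k) x)). q ((\<theta> ^^ k) x) w > 0"
proof -
  have step: "q (\<theta> ((\<theta> ^^ k) x)) (T ((\<theta> ^^ k) x) u) > 0"
    if u: "u \<in> mspace (J ((\<theta> ^^ k) x))" and pos: "q ((\<theta> ^^ k) x) u > 0" for k u
  proof -
    let ?y = "(\<theta> ^^ k) x"
    have y: "?y \<in> G" by (rule orbit_funpow[OF x])
    have w: "T ?y u \<in> mspace (J (\<theta> ?y))" by (rule T_in[OF y u])
    have "0 < q ?y u * exp (\<phi> ?y u)" using pos by simp
    also have "\<dots> \<le> transfer ?y (q ?y) (T ?y u)"
      unfolding transfer_operator_def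
      by (rule member_le_sum[OF _ _ finite_preimages[OF y w]]) (use u q0[of _ k] in simp_all)
    also have "\<dots> = \<Lambda> ?y * q (\<theta> ?y) (T ?y u)" by (rule eig[OF w])
    finally show ?thesis using Lambda_pos[OF y] by (simp add: zero_less_mult_iff)
  qed
  have steps: "q ((\<theta> ^^ k) x) (iter k x u) > 0" if u: "u \<in> mspace (J x)" and pos: "q x u > 0" for k u
  proof (induction k)
    case (Suc k)
    from step[OF iter_in[OF x u] Suc.IH] show ?case by simp
  qed (use pos in simp)
  have "\<exists>z\<in>mspace (J x). q x z > 0"
  proof (rule ccontr)
    assume "\<not> ?thesis"
    then have np: "\<not> q x z > 0" if "z \<in> mspace (J x)" for z using that by blast
    have "q x z = 0" if "z \<in> mspace (J x)" for z using q0[of z 0] np[OF that] that by simp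
    then have "(\<integral>z. q x z \<partial>\<nu> x) = (\<integral>z. 0 \<partial>\<nu> x)"
      by (intro Bochner_Integration.integral_cong refl) (simp add: space_nu[OF x])
    then show False using int by simp
  qed
  then obtain z where z: "z \<in> mspace (J x)" "q x z > 0" by (elim bexE)
  let ?U = "{u \<in> mspace (J x). q x u > 0}"
  have U: "openin (mtopology_of (J x)) ?U"
    using openin_continuous_map_preimage[OF qc, of "{0<..}"] by simp
  obtain n where n: "cyl x n z \<subseteq> ?U" using cyl_in_open[OF x U, of z] z by auto
  let ?y = "(\<theta> ^^ n) x"
  have y: "?y \<in> G" by (rule orbit_funpow[OF x])
  \<comment> \<open>\<open>n\<close> steps stretch the cylinder to a \<open>\<xi>\<close>-ball, and
    \<open>N ?y\<close> further steps stretch that ball to a whole fibre.\<close>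
  let ?m = "n + N ?y"
  have im: "iter ?m x ` cyl x n z = mspace (J ((\<theta> ^^ ?m) x))"
  proof -
    have "iter ?m x ` cyl x n z = iter (N ?y) ?y ` (iter n x ` cyl x n z)"
      unfolding image_image by (rule image_cong[OF refl fibre_iter_add])
    also have "\<dots> = mspace (J ((\<theta> ^^ N ?y) ?y))"
      unfolding iter_cyl[OF x z(1)] by (rule exact[OF y iter_in[OF x z(1)]])
    finally show ?thesis by (simp add: funpow_add add.commute[of n])
  qed
  have posm: "\<forall>w\<in>mspace (J ((\<theta> ^^ ?m) x)). q ((\<theta> ^^ ?m) x) w > 0"
    unfolding im[symmetric] by (intro ballI, erule imageE) (use n steps in auto)
  note one_step = step
  have "\<forall>w\<in>mspace (J ((\<theta> ^^ k) x)). q ((\<theta> ^^ k) x) w > 0" if "k \<ge> ?m" for k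
    using that
  proof (induction rule: dec_induct)
    case base
    show ?case by (rule posm)
  next
    case (step k)
    have k: "(\<theta> ^^ k) x \<in> G" by (rule orbit_funpow[OF x])
    show ?case
    proof
      fix w assume "w \<in> mspace (J ((\<theta> ^^ Suc k) x))"
      then have "w \<in> T ((\<theta> ^^ k) x) ` mspace (J ((\<theta> ^^ k) x))" by (simp add: surj[OF k])
      then obtain u where u: "u \<in> mspace (J ((\<theta> ^^ k) x))" "w = T ((\<theta> ^^ k) x) u" by (elim imageE)
      have "q (\<theta> ((\<theta> ^^ k) x)) (T ((\<theta> ^^ k) x) u) > 0"
        by (rule one_step[OF u(1) bspec[OF step.IH u(1)]])
      then show "q ((\<theta> ^^ Suc k) x) w > 0" by (simp add: u(2))
    qed
  qed
  then show ?thesis by (intro exI[of _ ?m]) simp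
qed

lemma density_cyl_bounds:
  assumes x: "x \<in> G" and z: "z \<in> mspace (J x)"
    and qc: "continuous_map (mtopology_of (J x)) euclideanreal q"
    and ab: "a > 0" "\<And>u. u \<in> mspace (J x) \<Longrightarrow> a \<le> q u" "\<And>u. u \<in> mspace (J x) \<Longrightarrow> q u \<le> b"
    and \<mu>: "\<And>A. A \<in> sets (fibre_borel (J x)) \<Longrightarrow> measure \<mu> A = (LINT u:A|\<nu> x. q u)"
  shows "a * measure (\<nu> x) (cyl x n z) \<le> measure \<mu> (cyl x n z)"
    "measure \<mu> (cyl x n z) \<le> b * measure (\<nu> x) (cyl x n z)"
proof -
  let ?A = "cyl x n z"
  have A: "openin (mtopology_of (J x)) ?A" by (rule openin_cyl[OF x z])
  have \<mu>A: "measure \<mu> ?A = (\<integral>u. indicator ?A u * q u \<partial>\<nu> x)"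
    using \<mu>[OF openin_fibre_borel[OF A]] by (simp add: set_lebesgue_integral_def)
  note int = integrable_mult_indicator[OF open_sets_nu[OF x A] continuous_integrable_nu[OF x qc],
      unfolded real_scaleR_def]
  have "(\<integral>u. a * indicator ?A u \<partial>\<nu> x) \<le> (\<integral>u. indicator ?A u * q u \<partial>\<nu> x)"
  proof (rule integral_mono[OF integral_indicator_nu(1)[OF x A] int])
    fix u assume "u \<in> space (\<nu> x)"
    then show "a * indicator ?A u \<le> indicator ?A u * q u"
      using ab(2)[of u] by (simp add: indicator_def space_nu[OF x])
  qed
  then show "a * measure (\<nu> x) ?A \<le> measure \<mu> ?A" unfolding \<mu>A integral_indicator_nu(2)[OF x A] .
  have "(\<integral>u. indicator ?A u * q u \<partial>\<nu> x) \<le> (\<integral>u. b * indicator ?A u \<partial>\<nu> x)"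
  proof (rule integral_mono[OF int integral_indicator_nu(1)[OF x A]])
    fix u assume "u \<in> space (\<nu> x)"
    then show "indicator ?A u * q u \<le> b * indicator ?A u"
      using ab(3)[of u] by (simp add: indicator_def space_nu[OF x])
  qed
  then show "measure \<mu> ?A \<le> b * measure (\<nu> x) ?A" unfolding \<mu>A integral_indicator_nu(2)[OF x A] .
qed

text \<open>The cylinders over the preimages of one centre \<open>w j\<close> are disjoint, so their
  \<open>\<sigma>\<close>-masses add up to at most that of \<open>U\<close>. Only the
  \<open>a\<close> centres cost a factor, however many preimages they have. With \<open>F\<close>
  and \<open>U\<close> the whole fibre this compares total masses; with \<open>U\<close> a
  neighbourhood of a closed \<open>F\<close> it yields absolute continuity.\<close>

lemma cover_estimate:
  assumes x: "x \<in> G"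
    and \<rho>: "finite_measure \<rho>" "sets \<rho> = sets (fibre_borel (J x))"
    and \<sigma>: "finite_measure \<sigma>" "sets \<sigma> = sets (fibre_borel (J x))"
    and le: "\<And>z. z \<in> mspace (J x) \<Longrightarrow> measure \<rho> (cyl x n z) \<le> c * measure \<sigma> (cyl x n z)" and c: "c \<ge> 0"
    and w: "\<And>j. j \<in> {1..a} \<Longrightarrow> w j \<in> mspace (J ((\<theta> ^^ n) x))"
    and cov: "mspace (J ((\<theta> ^^ n) x)) \<subseteq> (\<Union>j\<in>{1..a}. mball_of (J ((\<theta> ^^ n) x)) (w j) \<xi>)"
    and F: "F \<subseteq> mspace (J x)" and U: "openin (mtopology_of (J x)) U"
    and sub: "\<And>z. z \<in> mspace (J x) \<Longrightarrow> cyl x n z \<inter> F \<noteq> {} \<Longrightarrow> cyl x n z \<subseteq> U"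
  shows "measure \<rho> F \<le> c * (real a * measure \<sigma> U)"
proof -
  let ?Z = "\<lambda>j. {z \<in> mspace (J x). iter n x z = w j \<and> cyl x n z \<inter> F \<noteq> {}}"
  have finZ: "finite (?Z j)" if "j \<in> {1..a}" for j
    by (rule finite_subset[OF _ finite_iter_preimages[OF x w[OF that], of ]]) blast
  have cs: "cyl x n z \<in> sets \<rho>" "cyl x n z \<in> sets \<sigma>" if "z \<in> mspace (J x)" for z
    using openin_fibre_borel[OF openin_cyl[OF x that]] \<rho>(2) \<sigma>(2) by simp_all
  have Us: "U \<in> sets \<sigma>" using openin_fibre_borel[OF U] \<sigma>(2) by simp
  let ?C = "\<lambda>j. \<Union>z\<in>?Z j. cyl x n z"
  have Cs: "?C j \<in> sets \<rho>" "?C j \<in> sets \<sigma>" if "j \<in> {1..a}" for j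
    by (rule sets.finite_UN[OF finZ[OF that]], use cs in simp)+
  have "F \<subseteq> (\<Union>j\<in>{1..a}. ?C j)"
  proof
    fix u assume u: "u \<in> F"
    then have us: "u \<in> mspace (J x)" using F by blast
    from subsetD[OF cov iter_in[OF x us]]
    obtain j where j: "j \<in> {1..a}" "iter n x u \<in> mball_of (J ((\<theta> ^^ n) x)) (w j) \<xi>" by (rule UN_E)
    from cyl_cover[OF x us j(2)]
    obtain z where "z \<in> mspace (J x)" "iter n x z = w j" "u \<in> cyl x n z" by (elim bexE conjE)
    then have "z \<in> ?Z j" "u \<in> cyl x n z" using u by auto
    then show "u \<in> (\<Union>j\<in>{1..a}. ?C j)" using j(1) by (intro UN_I)
  qed
  then have "measure \<rho> F \<le> measure \<rho> (\<Union>j\<in>{1..a}. ?C j)"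
    by (rule finite_measure.finite_measure_mono[OF \<rho>(1)]) (rule sets.finite_UN, use Cs in simp_all)
  also have "\<dots> \<le> (\<Sum>j\<in>{1..a}. measure \<rho> (?C j))"
    by (rule measure_UNION_le) (use Cs in simp_all)
  also have "\<dots> \<le> (\<Sum>j\<in>{1..a}. c * measure \<sigma> U)"
  proof (rule sum_mono)
    fix j assume j: "j \<in> {1..a}"
    have "measure \<rho> (?C j) \<le> (\<Sum>z\<in>?Z j. measure \<rho> (cyl x n z))"
      by (rule measure_UNION_le[OF finZ[OF j]]) (use cs in simp)
    also have "\<dots> \<le> (\<Sum>z\<in>?Z j. c * measure \<sigma> (cyl x n z))" by (rule sum_mono) (use le in simp)
    also have "\<dots> = c * (\<Sum>z\<in>?Z j. measure \<sigma> (cyl x n z))" by (rule sum_distrib_left[symmetric])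
    also have "(\<Sum>z\<in>?Z j. measure \<sigma> (cyl x n z)) = measure \<sigma> (?C j)"
    proof (rule finite_measure.finite_measure_finite_Union[OF \<sigma>(1) finZ[OF j], symmetric])
      show "(\<lambda>z. cyl x n z) ` ?Z j \<subseteq> sets \<sigma>" by (rule image_subsetI) (use cs in simp)
      show "disjoint_family_on (\<lambda>z. cyl x n z) (?Z j)"
        unfolding disjoint_family_on_def
      proof (intro ballI impI)
        fix z z' assume zz: "z \<in> ?Z j" "z' \<in> ?Z j" "z \<noteq> z'"
        show "cyl x n z \<inter> cyl x n z' = {}"
        proof (rule ccontr)
          assume "cyl x n z \<inter> cyl x n z' \<noteq> {}"
          then obtain u where "u \<in> cyl x n z" "u \<in> cyl x n z'" by blast
          then have "z = z'" by (intro cyl_disjoint[OF x, of z z' n u]) (use zz in simp_all)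
          then show False using zz(3) by simp
        qed
      qed
    qed
    also have "c * measure \<sigma> (?C j) \<le> c * measure \<sigma> U"
      by (rule mult_left_mono[OF finite_measure.finite_measure_mono[OF \<sigma>(1) _ Us] c]) (use sub in blast)
    finally show "measure \<rho> (?C j) \<le> c * measure \<sigma> U" .
  qed
  also have "\<dots> = c * (real a * measure \<sigma> U)" by simp
  finally show ?thesis .
qed

text \<open>The normalisations \<open>p\<close> and \<open>p'\<close> are unrelated a priori. Their
  discrepancy is recovered from the total masses: the reverse comparison \<open>le2\<close>, summed
  over the cover, gives \<open>exp (p' - p) \<le> k\<^sup>2 * real a\<close>, and the two Gibbs
  bounds contribute another \<open>k\<^sup>2\<close>.\<close>

lemma gibbs_cyl_le:
  assumes x: "x \<in> G" and \<rho>: "borel_probability_on (J x) \<rho>" and \<sigma>: "borel_probability_on (J x) \<sigma>"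
    and k: "k \<ge> 1"
    and g\<rho>: "\<And>z. z \<in> mspace (J x) \<Longrightarrow> inverse k \<le> measure \<rho> (cyl x n z) / exp (S z - p) \<and> measure \<rho> (cyl x n z) / exp (S z - p) \<le> k"
    and g\<sigma>: "\<And>z. z \<in> mspace (J x) \<Longrightarrow> inverse k \<le> measure \<sigma> (cyl x n z) / exp (S z - p') \<and> measure \<sigma> (cyl x n z) / exp (S z - p') \<le> k"
    and w: "\<And>j. j \<in> {1..a} \<Longrightarrow> w j \<in> mspace (J ((\<theta> ^^ n) x))"
    and cov: "mspace (J ((\<theta> ^^ n) x)) \<subseteq> (\<Union>j\<in>{1..a}. mball_of (J ((\<theta> ^^ n) x)) (w j) \<xi>)"
    and z: "z \<in> mspace (J x)"
  shows "measure \<rho> (cyl x n z) \<le> k ^ 4 * real a * measure \<sigma> (cyl x n z)"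
proof -
  have fin: "finite_measure \<rho>" "finite_measure \<sigma>" and sets: "sets \<rho> = sets (fibre_borel (J x))" "sets \<sigma> = sets (fibre_borel (J x))"
    and prob: "prob_space \<rho>" "prob_space \<sigma>"
    using \<rho> \<sigma> by (auto simp: borel_probability_on_def prob_space.finite_measure)
  have whole: "measure \<rho> (mspace (J x)) = 1" "measure \<sigma> (mspace (J x)) = 1"
    using prob_space.prob_space[OF prob(1)] prob_space.prob_space[OF prob(2)]
      sets_eq_imp_space_eq[OF sets(1)] sets_eq_imp_space_eq[OF sets(2)] by simp_all
  have le1: "measure \<rho> (cyl x n z) \<le> k\<^sup>2 * exp (p' - p) * measure \<sigma> (cyl x n z)" if z: "z \<in> mspace (J x)" for z
  proof -
    have "measure \<rho> (cyl x n z) \<le> k * exp (S z - p)" using g\<rho>[OF z] by (simp add: divide_le_eq)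
    also have "exp (S z - p) = exp (p' - p) * exp (S z - p')" unfolding mult_exp_exp by simp
    also have "exp (S z - p') \<le> k * measure \<sigma> (cyl x n z)"
      using g\<sigma>[OF z] k by (simp add: field_simps)
    finally show ?thesis using k by (simp add: power2_eq_square mult_left_mono mult.assoc mult.left_commute)
  qed
  have le2: "measure \<sigma> (cyl x n z) \<le> k\<^sup>2 * exp (p - p') * measure \<rho> (cyl x n z)" if z: "z \<in> mspace (J x)" for z
  proof -
    have "measure \<sigma> (cyl x n z) \<le> k * exp (S z - p')" using g\<sigma>[OF z] by (simp add: divide_le_eq)
    also have "exp (S z - p') = exp (p - p') * exp (S z - p)" unfolding mult_exp_exp by simp
    also have "exp (S z - p) \<le> k * measure \<rho> (cyl x n z)"
      using g\<rho>[OF z] k by (simp add: field_simps)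
    finally show ?thesis using k by (simp add: power2_eq_square mult_left_mono mult.assoc mult.left_commute)
  qed
  have o: "openin (mtopology_of (J x)) (mspace (J x))" using openin_topspace[of "mtopology_of (J x)"] by simp
  have "measure \<sigma> (mspace (J x)) \<le> k\<^sup>2 * exp (p - p') * (real a * measure \<rho> (mspace (J x)))"
    by (rule cover_estimate[OF x fin(2) sets(2) fin(1) sets(1) le2 _ w cov order_refl o cyl_subset[OF x]]) simp_all
  then have "1 \<le> k\<^sup>2 * exp (p - p') * real a" by (simp add: whole)
  then have "exp (p' - p) * 1 \<le> exp (p' - p) * (k\<^sup>2 * exp (p - p') * real a)"
    by (rule mult_left_mono) simp
  also have "\<dots> = k\<^sup>2 * real a * (exp (p' - p) * exp (p - p'))" by (simp only: ac_simps)
  also have "\<dots> = k\<^sup>2 * real a" unfolding mult_exp_exp by simp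
  finally have t: "exp (p' - p) \<le> k\<^sup>2 * real a" by simp
  have "measure \<rho> (cyl x n z) \<le> k\<^sup>2 * exp (p' - p) * measure \<sigma> (cyl x n z)" by (rule le1[OF z])
  also have "\<dots> \<le> k\<^sup>2 * (k\<^sup>2 * real a) * measure \<sigma> (cyl x n z)"
    by (intro mult_right_mono mult_left_mono t) simp_all
  also have "\<dots> = k ^ 4 * real a * measure \<sigma> (cyl x n z)"
    by (simp add: power4_eq_xxxx power2_eq_square mult.assoc)
  finally show ?thesis .
qed

text \<open>Infinitely many depths suffice, because cylinders are small at every large depth. The
  constants \<open>c\<close> and \<open>a\<close> must not depend on the depth, since the depth has
  to grow while the neighbourhood of \<open>F\<close> shrinks.\<close>

lemma absolutely_continuous_cyl:
  fixes a :: nat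
  assumes x: "x \<in> G" and \<rho>: "borel_probability_on (J x) \<rho>" and \<sigma>: "borel_probability_on (J x) \<sigma>"
    and c: "c \<ge> 0"
    and inf: "\<And>m. \<exists>n\<ge>m. (\<forall>z\<in>mspace (J x). measure \<rho> (cyl x n z) \<le> c * measure \<sigma> (cyl x n z)) \<and>
      (\<exists>b w. b \<le> a \<and> (\<forall>j\<in>{1..b}. w j \<in> mspace (J ((\<theta> ^^ n) x))) \<and>
        mspace (J ((\<theta> ^^ n) x)) \<subseteq> (\<Union>j\<in>{1..b}. mball_of (J ((\<theta> ^^ n) x)) (w j) \<xi>))"
  shows "absolutely_continuous \<sigma> \<rho>"
proof -
  have fin: "finite_measure \<rho>" "finite_measure \<sigma>" and sets: "sets \<rho> = sets (fibre_borel (J x))" "sets \<sigma> = sets (fibre_borel (J x))"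
    using \<rho> \<sigma> by (auto simp: borel_probability_on_def prob_space.finite_measure)
  show ?thesis
  proof (rule absolutely_continuous_if_closed_le[OF fin(1) sets(1) fin(2) sets(2)])
    fix F assume F: "closedin (mtopology_of (J x)) F"
    have Fsub: "F \<subseteq> mspace (J x)" using closedin_subset[OF F] by simp
    have le: "measure \<rho> F \<le> c * real a * measure \<sigma> (nbhd (J x) F i)" for i
    proof -
      \<comment> \<open>Two points of a cylinder are compared through its centre, hence the factor
        2.\<close>
      define r where "r = inverse (real (Suc i)) / 2"
      have r: "r > 0" by (simp add: r_def)
      obtain m where m: "\<And>n. n \<ge> m \<Longrightarrow> \<forall>z\<in>mspace (J x). \<forall>u\<in>cyl x n z. mdist (J x) z u < r"
        using cyl_small[OF x r] unfolding eventually_sequentially by blast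
      from inf[of m] obtain n b w where n: "n \<ge> m"
        and len: "\<forall>z\<in>mspace (J x). measure \<rho> (cyl x n z) \<le> c * measure \<sigma> (cyl x n z)"
        and b: "b \<le> a" and w: "\<forall>j\<in>{1..b}. w j \<in> mspace (J ((\<theta> ^^ n) x))"
        and cov: "mspace (J ((\<theta> ^^ n) x)) \<subseteq> (\<Union>j\<in>{1..b}. mball_of (J ((\<theta> ^^ n) x)) (w j) \<xi>)"
        by (elim exE conjE)
      have "measure \<rho> F \<le> c * (real b * measure \<sigma> (nbhd (J x) F i))"
      proof (rule cover_estimate[OF x fin(1) sets(1) fin(2) sets(2) bspec[OF len] c bspec[OF w] cov Fsub openin_nbhd[OF Fsub]])
        fix z assume z: "z \<in> mspace (J x)" and ne: "cyl x n z \<inter> F \<noteq> {}"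
        obtain u where u: "u \<in> cyl x n z" "u \<in> F" using ne by blast
        note mn = m[OF n, rule_format, OF z]
        show "cyl x n z \<subseteq> nbhd (J x) F i"
        proof
          fix v assume v: "v \<in> cyl x n z"
          have vs: "v \<in> mspace (J x)" "u \<in> mspace (J x)" using cyl_subset[OF x z] u(1) v by blast+
          have "dist_to (J x) F v \<le> mdist (J x) v u" by (rule dist_to_le[OF u(2)])
          also have "\<dots> \<le> mdist (J x) v z + mdist (J x) z u" by (rule mdist_triangle[OF vs(1) z vs(2)])
          also have "\<dots> < r + r" using mn[OF v] mn[OF u(1)] by (simp add: mdist_commute)
          finally have "dist_to (J x) F v < inverse (real (Suc i))" by (simp add: r_def)
          then show "v \<in> nbhd (J x) F i" using vs(1) unfolding nbhd_def by blast
        qed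
      qed
      also have "\<dots> \<le> c * (real a * measure \<sigma> (nbhd (J x) F i))"
        by (intro mult_left_mono mult_right_mono c) (use b in simp_all)
      finally show ?thesis by (simp only: mult.assoc)
    qed
    have "(\<lambda>i. c * real a * measure \<sigma> (nbhd (J x) F i)) \<longlonglongrightarrow> c * real a * measure \<sigma> F"
      by (rule tendsto_mult_left[OF measure_nbhd_tendsto[OF fin(2) sets(2) F]])
    then show "measure \<rho> F \<le> c * real a * measure \<sigma> F"
      by (rule LIMSEQ_le_const) (use le in simp)
  qed
qed

end

section \<open>From almost every fibre to random maps\<close>

text \<open>Compactness makes the norm finite; for an infinite norm \<open>enn2real\<close> would
  give the bound 0.\<close>

lemma fibre_norm_bound:
  assumes "compact_space (mtopology_of (J x))" "continuous_map (mtopology_of (J x)) euclideanreal (g x)"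
    and z: "z \<in> mspace (J x)"
  shows "\<bar>g x z\<bar> \<le> enn2real (fibre_norm J g x)"
proof -
  obtain C where C: "\<forall>z\<in>mspace (J x). \<bar>g x z\<bar> \<le> C"
    using compact_real_bounded[OF assms(1,2)] by (rule exE)
  have "fibre_norm J g x \<le> ennreal C"
    unfolding fibre_norm_def by (rule SUP_least) (use C in \<open>simp add: ennreal_leI\<close>)
  then have fin: "fibre_norm J g x < top" by (rule le_less_trans) simp
  have "ennreal \<bar>g x z\<bar> \<le> fibre_norm J g x" unfolding fibre_norm_def using z by (rule SUP_upper)
  from enn2real_mono[OF this fin] show ?thesis by simp
qed

text \<open>The infimum supplies constants arbitrarily close to \<open>h\<close>, so the estimate is
  proved up to an arbitrary \<epsilon>.\<close>

lemma holder_seminorm_bound: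
  assumes le: "holder_seminorm J \<eta> \<alpha> g x \<le> ennreal h" and h: "h \<ge> 0"
    and z: "z \<in> mspace (J x)" "u \<in> mspace (J x)" "mdist (J x) z u \<le> \<eta> x"
  shows "\<bar>g x z - g x u\<bar> \<le> h * mdist (J x) z u powr \<alpha>"
proof (rule field_le_epsilon)
  fix \<epsilon> :: real assume \<epsilon>: "\<epsilon> > 0"
  let ?r = "mdist (J x) z u powr \<alpha>"
  \<comment> \<open>The summand 1 covers coinciding points, where \<open>?r\<close>
    vanishes.\<close>
  define e where "e = \<epsilon> / (?r + 1)"
  have r: "?r \<ge> 0" by simp
  have e: "e > 0" using \<epsilon> r by (simp add: e_def add_nonneg_pos)
  have "ennreal h < ennreal (h + e)" using e h by (simp add: ennreal_less_iff)
  then have "holder_seminorm J \<eta> \<alpha> g x < ennreal (h + e)" by (rule le_less_trans[OF le])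
  then obtain C where C: "0 \<le> C" "ennreal C < ennreal (h + e)"
    "\<forall>z1\<in>mspace (J x). \<forall>z2\<in>mspace (J x). mdist (J x) z1 z2 \<le> \<eta> x \<longrightarrow>
      \<bar>g x z1 - g x z2\<bar> \<le> C * mdist (J x) z1 z2 powr \<alpha>"
    unfolding holder_seminorm_def Inf_less_iff by auto
  have "\<bar>g x z - g x u\<bar> \<le> C * ?r" by (rule C(3)[rule_format, OF z])
  also have "\<dots> \<le> (h + e) * ?r"
    by (rule mult_right_mono[OF _ r]) (use C(1,2) in \<open>simp add: ennreal_less_iff\<close>)
  also have "\<dots> \<le> h * ?r + \<epsilon>"
  proof -
    have "e * ?r \<le> e * (?r + 1)" by (rule mult_left_mono) (use e in simp_all)
    also have "\<dots> = \<epsilon>" using r by (simp add: e_def add_nonneg_eq_0_iff)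
    finally show ?thesis by (simp add: distrib_right)
  qed
  finally show "\<bar>g x z - g x u\<bar> \<le> h * ?r + \<epsilon>" .
qed

lemma compact_attains_min:
  assumes "compact_space (mtopology_of m)" "mspace m \<noteq> {}" "continuous_map (mtopology_of m) euclideanreal f"
  shows "\<exists>z0\<in>mspace m. \<forall>z\<in>mspace m. f z0 \<le> f z"
proof -
  have "compactin euclideanreal (f ` mspace m)"
    using image_compactin[OF _ assms(3), of "mspace m"] assms(1) by (simp add: compact_space_def)
  then have "compact (f ` mspace m)" by simp
  from compact_attains_inf[OF this] obtain y where y: "y \<in> f ` mspace m" "\<forall>t\<in>f ` mspace m. y \<le> t"
    using assms(2) by blast
  from y(1) obtain z0 where "z0 \<in> mspace m" "y = f z0" by (rule imageE)
  then show ?thesis using y(2) by (intro bexI[of _ z0]) simp_all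
qed

text \<open>Reversing the order of summation turns the sum along a forward segment into a partial
  sum of the backward series. The series starts at \<open>\<tau> ((\<theta> ^^ n) x)\<close>, which
  for \<open>n > 0\<close> is the last point whose rate and Hoelder constant enter.\<close>

lemma backward_series_bound:
  fixes h g :: "'x \<Rightarrow> real"
  assumes pred: "\<And>j. \<tau> ((\<theta> ^^ Suc j) x) = (\<theta> ^^ j) x"
    and h: "\<And>j. h ((\<theta> ^^ j) x) \<ge> 0"
    and fin: "(\<Sum>k. ennreal (h ((\<tau> ^^ k) (\<tau> ((\<theta> ^^ n) x))) *
      (\<xi> / (\<Prod>i\<le>k. g ((\<tau> ^^ i) (\<tau> ((\<theta> ^^ n) x))))) powr \<alpha>)) \<noteq> \<infinity>"
  shows "(\<Sum>j<n. h ((\<theta> ^^ j) x) * (\<xi> / (\<Prod>i\<in>{j..<n}. g ((\<theta> ^^ i) x))) powr \<alpha>) \<le>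
    enn2real (\<Sum>k. ennreal (h ((\<tau> ^^ k) (\<tau> ((\<theta> ^^ n) x))) *
      (\<xi> / (\<Prod>i\<le>k. g ((\<tau> ^^ i) (\<tau> ((\<theta> ^^ n) x))))) powr \<alpha>))"
proof -
  let ?t = "\<lambda>k. h ((\<tau> ^^ k) (\<tau> ((\<theta> ^^ n) x))) * (\<xi> / (\<Prod>i\<le>k. g ((\<tau> ^^ i) (\<tau> ((\<theta> ^^ n) x))))) powr \<alpha>"
  let ?s = "\<lambda>j. h ((\<theta> ^^ j) x) * (\<xi> / (\<Prod>i\<in>{j..<n}. g ((\<theta> ^^ i) x))) powr \<alpha>"
  have b: "(\<tau> ^^ k) (\<tau> ((\<theta> ^^ n) x)) = (\<theta> ^^ (n - Suc k)) x" if "k < n" for k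
    using that
  proof (induction k)
    case 0
    then show ?case using pred[of "n - 1"] by simp
  next
    case (Suc k)
    then have "n - Suc k = Suc (n - Suc (Suc k))" by simp
    then have "\<tau> ((\<theta> ^^ (n - Suc k)) x) = (\<theta> ^^ (n - Suc (Suc k))) x" using pred[of "n - Suc (Suc k)"] by metis
    then show ?case using Suc by simp
  qed
  have ts: "?t k = ?s (n - Suc k)" if k: "k < n" for k
  proof -
    have "(\<Prod>i\<le>k. g ((\<tau> ^^ i) (\<tau> ((\<theta> ^^ n) x)))) = (\<Prod>i\<le>k. g ((\<theta> ^^ (n - Suc i)) x))"
      by (rule prod.cong[OF refl]) (use b k in simp)
    also have "\<dots> = (\<Prod>i\<in>{n - Suc k..<n}. g ((\<theta> ^^ i) x))"
      by (rule prod.reindex_bij_witness[of _ "\<lambda>i. n - Suc i" "\<lambda>i. n - Suc i"]) (use k in auto)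
    finally show ?thesis using b[OF k] by simp
  qed
  have nn: "?t k \<ge> 0" if "k < n" for k unfolding ts[OF that] using h by simp
  have "(\<Sum>j<n. ?s j) = (\<Sum>k<n. ?s (n - Suc k))" by (rule sum.nat_diff_reindex[symmetric])
  also have "\<dots> = (\<Sum>k<n. ?t k)" by (rule sum.cong[OF refl]) (simp only: ts lessThan_iff)
  finally have eq: "(\<Sum>j<n. ?s j) = (\<Sum>k<n. ?t k)" .
  have "ennreal (\<Sum>k<n. ?t k) = (\<Sum>k<n. ennreal (?t k))"
    by (rule sum_ennreal[symmetric]) (use nn in simp)
  also have "\<dots> \<le> (\<Sum>k. ennreal (?t k))" by (rule sum_le_suminf) simp_all
  finally have "enn2real (ennreal (\<Sum>k<n. ?t k)) \<le> enn2real (\<Sum>k. ennreal (?t k))"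
    by (rule enn2real_mono) (use fin in \<open>simp add: less_top\<close>)
  moreover have "(\<Sum>k<n. ?t k) \<ge> 0" by (rule sum_nonneg) (use nn in simp)
  ultimately show ?thesis unfolding eq by simp
qed

text \<open>A positive number dominates its logarithm, so linear growth of the sums of logarithms
  already makes the products diverge.\<close>

lemma prod_growth:
  fixes g :: "nat \<Rightarrow> real"
  assumes a: "a > 0" and C: "\<And>n. a * real n - C \<le> (\<Sum>i<n. ln (g i))" and g: "\<And>i. g i > 1"
  shows "filterlim (\<lambda>n. \<Prod>i<n. g i) at_top sequentially"
  unfolding filterlim_at_top
proof
  fix Z :: real
  obtain m :: nat where m: "(Z + C) / a \<le> real m" using real_arch_simple by blast
  have "Z \<le> (\<Prod>i<n. g i)" if n: "n \<ge> m" for n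
  proof -
    have g0: "g i > 0" for i using g[of i] by simp
    have P: "(\<Prod>i<n. g i) > 0" by (rule prod_pos) (simp add: g0)
    have "(Z + C) / a \<le> real n" using m n by simp
    then have "Z \<le> a * real n - C" using a by (simp add: field_simps)
    also have "\<dots> \<le> (\<Sum>i<n. ln (g i))" by (rule C)
    also have "\<dots> = ln (\<Prod>i<n. g i)"
      by (rule ln_prod[symmetric]) (use g0 in \<open>simp_all add: less_imp_neq[THEN not_sym]\<close>)
    also have "\<dots> \<le> (\<Prod>i<n. g i)" using ln_le_minus_one[OF P] by simp
    finally show ?thesis .
  qed
  then show "eventually (\<lambda>n. Z \<le> (\<Prod>i<n. g i)) sequentially"
    unfolding eventually_sequentially by (intro exI[of _ m]) simp
qed

text \<open>By invariance the measure of \<open>E\<close> equals the integral of its indicator along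
  the \<open>k\<close>-th iterate for every \<open>k\<close>, and by dominated convergence these
  integrals tend to 1.\<close>

lemma (in prob_space) AE_eventually_in:
  assumes \<tau>: "\<tau> \<in> measurable M M" "distr M M \<tau> = M" and E: "E \<in> sets M"
    and ev: "AE x in M. \<exists>m. \<forall>k\<ge>m. (\<tau> ^^ k) x \<in> E"
  shows "AE x in M. x \<in> E"
proof -
  have iE: "integrable M (indicator E :: _ \<Rightarrow> real)"
    by (rule integrable_real_indicator[OF E]) (simp add: emeasure_eq_measure)
  have bE: "(indicator E :: _ \<Rightarrow> real) \<in> borel_measurable M" using E by simp
  note int = integral_preserving[OF funpow_measurable[OF \<tau>(1)] distr_funpow[OF \<tau>] bE]
  have m: "(\<lambda>x. indicator E ((\<tau> ^^ k) x) :: real) \<in> borel_measurable M" for k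
    by (rule measurable_compose[OF funpow_measurable[OF \<tau>(1)] bE])
  have "(\<lambda>k. \<integral>x. indicator E ((\<tau> ^^ k) x) \<partial>M) \<longlonglongrightarrow> (\<integral>x. (1::real) \<partial>M)"
  proof (rule integral_dominated_convergence[where w = "\<lambda>_. 1"])
    show "AE x in M. (\<lambda>k. indicator E ((\<tau> ^^ k) x)) \<longlonglongrightarrow> (1::real)"
      using ev
    proof eventually_elim
      fix x assume "\<exists>m. \<forall>k\<ge>m. (\<tau> ^^ k) x \<in> E"
      then have "eventually (\<lambda>k. indicator E ((\<tau> ^^ k) x) = (1::real)) sequentially"
        unfolding eventually_sequentially indicator_def by simp
      then show "(\<lambda>k. indicator E ((\<tau> ^^ k) x)) \<longlonglongrightarrow> (1::real)" by (rule tendsto_eventually)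
    qed
  qed (use m in simp_all)
  then have "(\<lambda>k. measure M E) \<longlonglongrightarrow> 1"
    unfolding int using E by (simp add: prob_space)
  then have "measure M E = 1" by (simp add: LIMSEQ_const_iff)
  then show ?thesis using E by (simp add: prob_eq_1)
qed

text \<open>Each almost sure property is imposed along the whole forward orbit; this costs countably
  many null sets and makes \<open>G\<close> forward invariant, as the locales require.\<close>

lemma gibbs_setup:
  fixes M :: "'x measure" and \<theta> :: "'x \<Rightarrow> 'x"
    and J :: "'x \<Rightarrow> 'z metric" and T :: "'x \<Rightarrow> 'z \<Rightarrow> 'z"
    and \<eta> :: "'x \<Rightarrow> real" and \<xi> \<alpha> :: real
    and \<phi> :: "'x \<Rightarrow> 'z \<Rightarrow> real" and \<nu> :: "'x \<Rightarrow> 'z measure"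
  assumes base: "ergodic_base M \<theta>"
    and erm: "expanding_random_map M \<theta> J T \<eta> \<xi>"
    and uib: "unique_inverse_branches M \<theta> J T \<eta> \<xi>"
    and alpha: "0 < \<alpha>"
    and phi: "\<phi> \<in> holder_space M J \<eta> \<alpha>"
    and eig: "eigenmeasures M \<theta> J T \<phi> \<nu>"
  obtains \<gamma> B H N Q G where "AE x in M. x \<in> G" "G \<subseteq> space M"
    "gibbs_fibres \<theta> J T \<eta> \<xi> \<gamma> G \<phi> \<nu> (eigenvalue \<theta> J T \<phi> \<nu>) B H \<alpha> N Q"
    "gibbs_fibres.gibbs_const \<theta> J T B N Q \<in> borel_measurable M"
    "\<forall>x. gibbs_fibres.gibbs_const \<theta> J T B N Q x \<ge> 1"
proof -
  have bij: "bij_betw \<theta> (space M) (space M)"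
    using base unfolding ergodic_base_def by - (elim conjE, assumption)
  have erg: "ergodic_map M \<theta>" by (rule ergodic_map_base[OF base])
  note \<theta> = ergodic_mapD(2)[OF erg] and \<theta>d = ergodic_mapD(3)[OF erg]
  interpret prob_space M by (rule ergodic_mapD(1)[OF erg])
  define \<tau> where "\<tau> = inv_into (space M) \<theta>"
  have erg\<tau>: "ergodic_map M \<tau>" unfolding \<tau>_def by (rule ergodic_map_inverse[OF base])
  have \<tau>m: "\<tau> \<in> measurable M M" by (rule ergodic_mapD(2)[OF erg\<tau>])
  have \<tau>\<theta>: "\<tau> (\<theta> x) = x" if "x \<in> space M" for x
    unfolding \<tau>_def by (rule bij_betw_inv_into_left[OF bij that])
  have fib: "\<forall>x\<in>space M.
        mspace (J x) \<noteq> {} \<and> compact_space (mtopology_of (J x)) \<and>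
        (\<forall>z1\<in>mspace (J x). \<forall>z2\<in>mspace (J x). mdist (J x) z1 z2 \<le> 1) \<and>
        continuous_map (mtopology_of (J x)) (mtopology_of (J (\<theta> x))) (T x) \<and>
        open_map (mtopology_of (J x)) (mtopology_of (J (\<theta> x))) (T x) \<and>
        T x ` mspace (J x) = mspace (J (\<theta> x))"
    and eta: "\<forall>x\<in>space M. \<eta> x > 0" and xi: "\<xi> > 0"
    and ex\<gamma>: "\<exists>\<gamma>\<in>borel_measurable M. (\<forall>x\<in>space M. \<gamma> x > 1) \<and>
        (AE x in M. \<forall>z1\<in>mspace (J x). \<forall>z2\<in>mspace (J x). mdist (J x) z1 z2 < \<eta> x \<longrightarrow>
           mdist (J (\<theta> x)) (T x z1) (T x z2) \<ge> \<gamma> x * mdist (J x) z1 z2)"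
    and deg: "fibre_degree \<theta> J T \<in> borel_measurable M"
    and exN: "\<exists>N\<in>measurable M (count_space (UNIV :: nat set)).
        AE x in M. \<forall>z\<in>mspace (J x).
          fibre_iter \<theta> T (N x) x ` mball_of (J x) z \<xi> = mspace (J ((\<theta> ^^ N x) x))"
    using erm unfolding expanding_random_map_def by - (elim conjE, assumption)+
  from ex\<gamma> obtain \<gamma> where \<gamma>: "\<gamma> \<in> borel_measurable M" "\<forall>x\<in>space M. \<gamma> x > 1"
    and exp: "AE x in M. \<forall>z1\<in>mspace (J x). \<forall>z2\<in>mspace (J x). mdist (J x) z1 z2 < \<eta> x \<longrightarrow>
           mdist (J (\<theta> x)) (T x z1) (T x z2) \<ge> \<gamma> x * mdist (J x) z1 z2"
    by (elim bexE conjE)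
  from exN obtain N where N: "N \<in> measurable M (count_space (UNIV :: nat set))"
    and exact: "AE x in M. \<forall>z\<in>mspace (J x).
          fibre_iter \<theta> T (N x) x ` mball_of (J x) z \<xi> = mspace (J ((\<theta> ^^ N x) x))"
    by (elim bexE)
  have C1: "\<phi> \<in> C1_space M J" and exH: "\<exists>H\<in>borel_measurable M.
        (\<forall>x\<in>space M. H x \<ge> 1) \<and> integrable M (\<lambda>x. ln (H x)) \<and>
        (AE x in M. holder_seminorm J \<eta> \<alpha> \<phi> x \<le> ennreal (H x))"
    using phi unfolding holder_space_def mem_Collect_eq by - (elim conjE, assumption)+
  from exH obtain H where H: "H \<in> borel_measurable M" "\<forall>x\<in>space M. H x \<ge> 1"
    "integrable M (\<lambda>x. ln (H x))" and hol: "AE x in M. holder_seminorm J \<eta> \<alpha> \<phi> x \<le> ennreal (H x)"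
    by (elim bexE conjE)
  have phic: "AE x in M. continuous_map (mtopology_of (J x)) euclideanreal (\<phi> x)"
    and norm: "fibre_norm J \<phi> \<in> borel_measurable M"
    using C1 unfolding C1_space_def C0_space_def mem_Collect_eq by - (elim conjE, assumption)+
  have nu: "AE x in M. borel_probability_on (J x) (\<nu> x)"
    and du: "AE x in M. \<forall>g. continuous_map (mtopology_of (J x)) euclideanreal g \<longrightarrow>
        (\<integral>w. transfer_operator J T \<phi> x g w \<partial>\<nu> (\<theta> x)) = eigenvalue \<theta> J T \<phi> \<nu> x * (\<integral>z. g z \<partial>\<nu> x)"
    using eig unfolding eigenmeasures_def by - (elim conjE, assumption)+
  have br: "AE x in M. \<forall>z\<in>mspace (J x). \<forall>w\<in>mball_of (J (\<theta> x)) (T x z) \<xi>.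
        \<exists>!u. u \<in> mball_of (J x) z (\<eta> x) \<and> T x u = w"
    using uib unfolding unique_inverse_branches_def .
  \<comment> \<open>\<open>Q0 y\<close> is the backward series started at \<open>y\<close>. In
    \<open>Q\<close> it is shifted by one step, because the last rate of a segment ending at
    \<open>x\<close> is the one at \<open>\<tau> x\<close>.\<close>
  define Q0 where "Q0 y = (\<Sum>k. ennreal (H ((\<tau> ^^ k) y) * (\<xi> / (\<Prod>i\<le>k. \<gamma> ((\<tau> ^^ i) y))) powr \<alpha>))" for y
  define Q where "Q x = enn2real (Q0 (\<tau> x))" for x
  define B where "B x = enn2real (fibre_norm J \<phi> x)" for x
  have Q0fin: "AE x in M. Q0 (\<tau> x) \<noteq> \<infinity>"
    unfolding Q0_def
    by (rule AE_preserving[OF \<tau>m ergodic_mapD(3)[OF erg\<tau>] orbit_series_finite[OF erg\<tau> \<gamma>(1) _ _ H(3) alpha xi]])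
       (use \<gamma>(2) H(2) in simp_all)
  have lnpos: "ln (\<gamma> x) > 0" if "x \<in> space M" for x by (rule ln_gt_zero[OF bspec[OF \<gamma>(2) that]])
  obtain a :: real where a: "a > 0"
    and grow: "AE x in M. \<exists>C. \<forall>n. a * real n - C \<le> (\<Sum>i<n. ln (\<gamma> ((\<theta> ^^ i) x)))"
    by (rule ergodic_sums_linear_growth[OF erg borel_measurable_ln[OF \<gamma>(1)] lnpos])
  \<comment> \<open>Only forward invariance is arranged, so what is needed about the backward orbit,
    the finiteness of \<open>Q0 (\<tau> x)\<close>, is made a condition at \<open>x\<close>
    itself.\<close>
  define Good where "Good x \<longleftrightarrow>
    (\<forall>z\<in>mspace (J x). \<forall>w\<in>mball_of (J (\<theta> x)) (T x z) \<xi>. \<exists>!u. u \<in> mball_of (J x) z (\<eta> x) \<and> T x u = w) \<and>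
    (\<forall>z1\<in>mspace (J x). \<forall>z2\<in>mspace (J x). mdist (J x) z1 z2 < \<eta> x \<longrightarrow>
       mdist (J (\<theta> x)) (T x z1) (T x z2) \<ge> \<gamma> x * mdist (J x) z1 z2) \<and>
    (\<forall>z\<in>mspace (J x). fibre_iter \<theta> T (N x) x ` mball_of (J x) z \<xi> = mspace (J ((\<theta> ^^ N x) x))) \<and>
    continuous_map (mtopology_of (J x)) euclideanreal (\<phi> x) \<and>
    holder_seminorm J \<eta> \<alpha> \<phi> x \<le> ennreal (H x) \<and>
    borel_probability_on (J x) (\<nu> x) \<and>
    (\<forall>g. continuous_map (mtopology_of (J x)) euclideanreal g \<longrightarrow>
        (\<integral>w. transfer_operator J T \<phi> x g w \<partial>\<nu> (\<theta> x)) = eigenvalue \<theta> J T \<phi> \<nu> x * (\<integral>z. g z \<partial>\<nu> x)) \<and>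
    Q0 (\<tau> x) \<noteq> \<infinity> \<and>
    (\<exists>C. \<forall>n. a * real n - C \<le> (\<Sum>i<n. ln (\<gamma> ((\<theta> ^^ i) x))))" for x
  have "AE x in M. Good x"
    unfolding Good_def by (intro AE_conjI br exp exact phic hol nu du Q0fin grow)
  then have AEG: "AE x in M. \<forall>n. Good ((\<theta> ^^ n) x)" by (rule AE_orbit[OF \<theta> \<theta>d])
  define G where "G = {x \<in> space M. \<forall>n. Good ((\<theta> ^^ n) x)}"
  have AE_G: "AE x in M. x \<in> G" unfolding G_def using AEG AE_space by eventually_elim simp
  have Gsub: "G \<subseteq> space M" unfolding G_def by (rule Collect_restrict)
  have sp: "x \<in> space M" if "x \<in> G" for x using that unfolding G_def by simp
  have Gorb: "\<theta> x \<in> G" if "x \<in> G" for x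
  proof -
    have "Good ((\<theta> ^^ n) (\<theta> x))" for n
    proof -
      have "Good ((\<theta> ^^ Suc n) x)" using that unfolding G_def by blast
      then show ?thesis by (simp only: funpow_Suc_right comp_def)
    qed
    then show ?thesis unfolding G_def using measurable_space[OF \<theta> sp[OF that]] by simp
  qed
  have good: "Good x" if "x \<in> G" for x
  proof -
    have "Good ((\<theta> ^^ 0) x)" using that unfolding G_def by blast
    then show ?thesis by simp
  qed
  note goodD = good[unfolded Good_def]
  have fibD: "mspace (J x) \<noteq> {}" "compact_space (mtopology_of (J x))"
    "continuous_map (mtopology_of (J x)) (mtopology_of (J (\<theta> x))) (T x)"
    "open_map (mtopology_of (J x)) (mtopology_of (J (\<theta> x))) (T x)"
    "T x ` mspace (J x) = mspace (J (\<theta> x))" if "x \<in> space M" for x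
    using bspec[OF fib that] by - (elim conjE, assumption)+
  have orbG: "(\<theta> ^^ n) x \<in> G" if "x \<in> G" for n x
    by (induction n) (simp_all add: that Gorb)
  have EF: "expanding_fibres \<theta> J T \<eta> \<xi> \<gamma> G"
  proof
    show "\<exists>!u. u \<in> mball_of (J x) z (\<eta> x) \<and> T x u = w"
      if "x \<in> G" "z \<in> mspace (J x)" "w \<in> mball_of (J (\<theta> x)) (T x z) \<xi>" for x z w
      by (rule bspec[OF bspec[OF conjunct1[OF goodD[OF that(1)]] that(2)] that(3)])
    show "\<gamma> x * mdist (J x) z u \<le> mdist (J (\<theta> x)) (T x z) (T x u)"
      if "x \<in> G" "z \<in> mspace (J x)" "u \<in> mspace (J x)" "mdist (J x) z u < \<eta> x" for x z u
      using conjunct1[OF conjunct2[OF goodD[OF that(1)]]] that(2-4) by simp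
  qed (use Gorb fibD[OF sp] eta xi \<gamma>(2) sp in simp_all)
  interpret E: expanding_fibres \<theta> J T \<eta> \<xi> \<gamma> G by (rule EF)
  have CF: "conformal_fibres \<theta> J T \<eta> \<xi> \<gamma> G \<phi> \<nu> (eigenvalue \<theta> J T \<phi> \<nu>) B H \<alpha>"
  proof
    fix x assume x: "x \<in> G"
    show pc: "continuous_map (mtopology_of (J x)) euclideanreal (\<phi> x)"
      and "borel_probability_on (J x) (\<nu> x)"
      using goodD[OF x] by - (elim conjE, assumption)+
    show "\<bar>\<phi> x z\<bar> \<le> B x" if "z \<in> mspace (J x)" for z
      unfolding B_def by (rule fibre_norm_bound[where J = J and g = \<phi> and x = x, OF fibD(2)[OF sp[OF x]] pc that])
    have hs: "holder_seminorm J \<eta> \<alpha> \<phi> x \<le> ennreal (H x)" using goodD[OF x] by - (elim conjE, assumption)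
    show H0: "H x \<ge> 0" using bspec[OF H(2) sp[OF x]] by simp
    show "\<bar>\<phi> x z - \<phi> x u\<bar> \<le> H x * mdist (J x) z u powr \<alpha>"
      if "z \<in> mspace (J x)" "u \<in> mspace (J x)" "mdist (J x) z u \<le> \<eta> x" for z u
      by (rule holder_seminorm_bound[where J = J and g = \<phi> and x = x, OF hs H0 that])
    show "(\<integral>w. transfer_operator J T \<phi> x g w \<partial>\<nu> (\<theta> x)) = eigenvalue \<theta> J T \<phi> \<nu> x * (\<integral>z. g z \<partial>\<nu> x)"
      if "continuous_map (mtopology_of (J x)) euclideanreal g" for g
    proof -
      have "\<forall>g. continuous_map (mtopology_of (J x)) euclideanreal g \<longrightarrow>
        (\<integral>w. transfer_operator J T \<phi> x g w \<partial>\<nu> (\<theta> x)) = eigenvalue \<theta> J T \<phi> \<nu> x * (\<integral>z. g z \<partial>\<nu> x)"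
        using goodD[OF x] by - (elim conjE, assumption)
      then show ?thesis using that by simp
    qed
  qed (rule alpha)
  interpret C: conformal_fibres \<theta> J T \<eta> \<xi> \<gamma> G \<phi> \<nu> "eigenvalue \<theta> J T \<phi> \<nu>" B H \<alpha> by (rule CF)
  have GF: "gibbs_fibres \<theta> J T \<eta> \<xi> \<gamma> G \<phi> \<nu> (eigenvalue \<theta> J T \<phi> \<nu>) B H \<alpha> N Q"
  proof
    fix x assume x: "x \<in> G"
    show "fibre_iter \<theta> T (N x) x ` mball_of (J x) z \<xi> = mspace (J ((\<theta> ^^ N x) x))"
      if "z \<in> mspace (J x)" for z
      using conjunct1[OF conjunct2[OF conjunct2[OF goodD[OF x]]]] that by (rule bspec)
    have "\<exists>C. \<forall>n. a * real n - C \<le> (\<Sum>i<n. ln (\<gamma> ((\<theta> ^^ i) x)))" using goodD[OF x] by - (elim conjE, assumption)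
    then obtain C where Cb: "\<forall>n. a * real n - C \<le> (\<Sum>i<n. ln (\<gamma> ((\<theta> ^^ i) x)))" by (rule exE)
    show "filterlim (\<lambda>n. \<Prod>i<n. \<gamma> ((\<theta> ^^ i) x)) at_top sequentially"
      by (rule prod_growth[OF a, of C]) (use Cb E.gamma[OF orbG[OF x]] in simp_all)
    show "C.distortion n x \<le> Q ((\<theta> ^^ n) x)" for n
      unfolding C.distortion_def Q_def Q0_def
    proof (rule backward_series_bound)
      show "\<tau> ((\<theta> ^^ Suc j) x) = (\<theta> ^^ j) x" for j by (simp add: \<tau>\<theta> sp orbG x)
      show "H ((\<theta> ^^ j) x) \<ge> 0" for j by (rule C.H_nonneg[OF orbG[OF x]])
      have "Q0 (\<tau> ((\<theta> ^^ n) x)) \<noteq> \<infinity>" using goodD[OF orbG[OF x, of n]] by - (elim conjE, assumption)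
      then show "(\<Sum>k. ennreal (H ((\<tau> ^^ k) (\<tau> ((\<theta> ^^ n) x))) *
          (\<xi> / (\<Prod>i\<le>k. \<gamma> ((\<tau> ^^ i) (\<tau> ((\<theta> ^^ n) x))))) powr \<alpha>)) \<noteq> \<infinity>" unfolding Q0_def .
    qed
  qed
  interpret F: gibbs_fibres \<theta> J T \<eta> \<xi> \<gamma> G \<phi> \<nu> "eigenvalue \<theta> J T \<phi> \<nu>" B H \<alpha> N Q by (rule GF)
  have [measurable]: "(\<tau> ^^ k) \<in> measurable M M" "(\<theta> ^^ k) \<in> measurable M M" for k
    by (rule funpow_measurable[OF \<tau>m], rule funpow_measurable[OF \<theta>])
  note [measurable] = \<gamma>(1) H(1) norm deg \<tau>m N
  have Q0m [measurable]: "Q0 \<in> borel_measurable M" unfolding Q0_def by measurable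
  have Qm: "Q \<in> borel_measurable M" unfolding Q_def by measurable
  have [measurable]: "B \<in> borel_measurable M" unfolding B_def by measurable
  have bcm: "C.ball_cost \<in> borel_measurable M" unfolding C.ball_cost_def by measurable
  have "(\<lambda>x. \<Sum>j<n. C.ball_cost ((\<theta> ^^ j) x)) \<in> borel_measurable M" for n
    by (intro borel_measurable_sum measurable_compose[OF _ bcm]) measurable
  \<comment> \<open>The number of summands is itself a measurable function with countably many
    values.\<close>
  from measurable_compose_countable[OF this N]
  have [measurable]: "(\<lambda>x. \<Sum>j<N x. C.ball_cost ((\<theta> ^^ j) x)) \<in> borel_measurable M" .
  note [measurable] = Qm
  have m: "F.gibbs_const \<in> borel_measurable M" unfolding F.gibbs_const_def by measurable
  \<comment> \<open>This holds off \<open>G\<close> as well, since the exponent is built from values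
    of \<open>enn2real\<close> and logarithms of numbers that are at least 1.\<close>
  have ge: "F.gibbs_const x \<ge> 1" for x
  proof -
    have "B y \<ge> 0" for y by (simp add: B_def)
    then have "C.ball_cost y \<ge> 0" for y by (simp add: C.ball_cost_def)
    then have "(\<Sum>j<N x. C.ball_cost ((\<theta> ^^ j) x)) \<ge> 0" by (intro sum_nonneg) simp
    then show ?thesis by (simp add: F.gibbs_const_def Q_def)
  qed
  show thesis by (rule that[OF AE_G Gsub GF m]) (intro allI ge)
qed

text \<open>In \<open>gibbs_family\<close> the exceptional null set may depend on \<open>n\<close>.
  There are only countably many \<open>n\<close>, so one null set serves for all; this rule and
  \<open>gibbs_familyE\<close> pass between the two forms.\<close>

lemma gibbs_familyI:
  assumes "AE x in M. borel_probability_on (J x) (\<mu> x)"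
    and "D \<in> borel_measurable M" "\<And>x. x \<in> space M \<Longrightarrow> D x \<ge> 1"
    and "AE x in M. \<forall>n. \<forall>z\<in>mspace (J x).
      inverse (D x * D ((\<theta> ^^ n) x)) \<le> measure (\<mu> x) (cylinder \<theta> J T \<eta> \<xi> x n z) /
        exp ((\<Sum>j<n. \<phi> ((\<theta> ^^ j) x) (fibre_iter \<theta> T j x z)) - (\<Sum>j<n. P ((\<theta> ^^ j) x))) \<and>
      measure (\<mu> x) (cylinder \<theta> J T \<eta> \<xi> x n z) /
        exp ((\<Sum>j<n. \<phi> ((\<theta> ^^ j) x) (fibre_iter \<theta> T j x z)) - (\<Sum>j<n. P ((\<theta> ^^ j) x))) \<le> D x * D ((\<theta> ^^ n) x)"
  shows "gibbs_family M \<theta> J T \<eta> \<xi> \<phi> \<mu>"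
  unfolding gibbs_family_def Let_def
proof (intro conjI bexI[of _ D] exI[of _ P] ballI allI assms(1,2))
  show "1 \<le> D x" if "x \<in> space M" for x by (rule assms(3)[OF that])
  show "AE x in M. \<forall>z\<in>mspace (J x).
      inverse (D x * D ((\<theta> ^^ n) x)) \<le> measure (\<mu> x) (inverse_branch_iter \<theta> J T \<eta> n x z `
        mball_of (J ((\<theta> ^^ n) x)) (fibre_iter \<theta> T n x z) \<xi>) /
        exp ((\<Sum>j<n. \<phi> ((\<theta> ^^ j) x) (fibre_iter \<theta> T j x z)) - (\<Sum>j<n. P ((\<theta> ^^ j) x))) \<and>
      measure (\<mu> x) (inverse_branch_iter \<theta> J T \<eta> n x z `
        mball_of (J ((\<theta> ^^ n) x)) (fibre_iter \<theta> T n x z) \<xi>) /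
        exp ((\<Sum>j<n. \<phi> ((\<theta> ^^ j) x) (fibre_iter \<theta> T j x z)) - (\<Sum>j<n. P ((\<theta> ^^ j) x))) \<le> D x * D ((\<theta> ^^ n) x)" for n
    using assms(4) by (rule AE_mp) (rule AE_I2, simp add: cylinder_def)
qed

lemma gibbs_familyE:
  assumes "gibbs_family M \<theta> J T \<eta> \<xi> \<phi> \<mu>"
  obtains D P where "D \<in> borel_measurable M"
    "AE x in M. borel_probability_on (J x) (\<mu> x)"
    "AE x in M. \<forall>n. \<forall>z\<in>mspace (J x).
      inverse (D x * D ((\<theta> ^^ n) x)) \<le> measure (\<mu> x) (cylinder \<theta> J T \<eta> \<xi> x n z) /
        exp ((\<Sum>j<n. \<phi> ((\<theta> ^^ j) x) (fibre_iter \<theta> T j x z)) - (\<Sum>j<n. P ((\<theta> ^^ j) x))) \<and>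
      measure (\<mu> x) (cylinder \<theta> J T \<eta> \<xi> x n z) /
        exp ((\<Sum>j<n. \<phi> ((\<theta> ^^ j) x) (fibre_iter \<theta> T j x z)) - (\<Sum>j<n. P ((\<theta> ^^ j) x))) \<le> D x * D ((\<theta> ^^ n) x)"
    "\<forall>x\<in>space M. D x \<ge> 1"
proof -
  from conjunct2[OF assms[unfolded gibbs_family_def Let_def]]
  obtain D P where D: "D \<in> borel_measurable M" "\<forall>x\<in>space M. 1 \<le> D x"
    and g: "\<forall>n. AE x in M. \<forall>z\<in>mspace (J x).
      inverse (D x * D ((\<theta> ^^ n) x)) \<le> measure (\<mu> x) (inverse_branch_iter \<theta> J T \<eta> n x z `
        mball_of (J ((\<theta> ^^ n) x)) (fibre_iter \<theta> T n x z) \<xi>) /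
        exp ((\<Sum>j<n. \<phi> ((\<theta> ^^ j) x) (fibre_iter \<theta> T j x z)) - (\<Sum>j<n. P ((\<theta> ^^ j) x))) \<and>
      measure (\<mu> x) (inverse_branch_iter \<theta> J T \<eta> n x z `
        mball_of (J ((\<theta> ^^ n) x)) (fibre_iter \<theta> T n x z) \<xi>) /
        exp ((\<Sum>j<n. \<phi> ((\<theta> ^^ j) x) (fibre_iter \<theta> T j x z)) - (\<Sum>j<n. P ((\<theta> ^^ j) x))) \<le> D x * D ((\<theta> ^^ n) x)"
    by (elim bexE exE conjE)
  show thesis
    by (rule that[OF D(1) conjunct1[OF assms[unfolded gibbs_family_def]]
          g[folded cylinder_def AE_all_countable] D(2)])
qed

lemma gibbs_family_eigenmeasures:
  assumes AE_G: "AE x in M. x \<in> G"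
    and GF: "gibbs_fibres \<theta> J T \<eta> \<xi> \<gamma> G \<phi> \<nu> \<Lambda> B H \<alpha> N Q"
    and m: "gibbs_fibres.gibbs_const \<theta> J T B N Q \<in> borel_measurable M"
    and ge: "\<And>x. gibbs_fibres.gibbs_const \<theta> J T B N Q x \<ge> 1"
  shows "gibbs_family M \<theta> J T \<eta> \<xi> \<phi> \<nu>"
proof -
  interpret gibbs_fibres \<theta> J T \<eta> \<xi> \<gamma> G \<phi> \<nu> \<Lambda> B H \<alpha> N Q by (rule GF)
  have pos: "gibbs_const x > 0" for x using ge[of x] by linarith
  show ?thesis
  proof (rule gibbs_familyI[OF _ m ge, where P = "\<lambda>x. ln (\<Lambda> x)"])
    show "AE x in M. borel_probability_on (J x) (\<nu> x)" using AE_G by eventually_elim (rule nu)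
    show "AE x in M. \<forall>n. \<forall>z\<in>mspace (J x).
      inverse (gibbs_const x * gibbs_const ((\<theta> ^^ n) x)) \<le> measure (\<nu> x) (cyl x n z) /
        exp ((\<Sum>j<n. \<phi> ((\<theta> ^^ j) x) (iter j x z)) - (\<Sum>j<n. ln (\<Lambda> ((\<theta> ^^ j) x)))) \<and>
      measure (\<nu> x) (cyl x n z) /
        exp ((\<Sum>j<n. \<phi> ((\<theta> ^^ j) x) (iter j x z)) - (\<Sum>j<n. ln (\<Lambda> ((\<theta> ^^ j) x)))) \<le> gibbs_const x * gibbs_const ((\<theta> ^^ n) x)"
      using AE_G
    proof (eventually_elim, intro allI ballI conjI)
      fix x n z assume x: "x \<in> G" and z: "z \<in> mspace (J x)"
      \<comment> \<open>The Gibbs condition allows a factor at the starting point, too; as the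
        constant is at least 1, this factor only weakens the bounds.\<close>
      have le: "1 * gibbs_const ((\<theta> ^^ n) x) \<le> gibbs_const x * gibbs_const ((\<theta> ^^ n) x)"
        by (rule mult_right_mono[OF ge less_imp_le[OF pos]])
      have "inverse (gibbs_const x * gibbs_const ((\<theta> ^^ n) x)) \<le> inverse (gibbs_const ((\<theta> ^^ n) x))"
        by (rule le_imp_inverse_le) (use le pos in simp_all)
      also note gibbs_nu(1)[OF x z]
      finally show "inverse (gibbs_const x * gibbs_const ((\<theta> ^^ n) x)) \<le> measure (\<nu> x) (cyl x n z) /
        exp ((\<Sum>j<n. \<phi> ((\<theta> ^^ j) x) (iter j x z)) - (\<Sum>j<n. ln (\<Lambda> ((\<theta> ^^ j) x))))" .
      note gibbs_nu(2)[OF x z, of n]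
      also have "gibbs_const ((\<theta> ^^ n) x) \<le> gibbs_const x * gibbs_const ((\<theta> ^^ n) x)" using le by simp
      finally show "measure (\<nu> x) (cyl x n z) /
        exp ((\<Sum>j<n. \<phi> ((\<theta> ^^ j) x) (iter j x z)) - (\<Sum>j<n. ln (\<Lambda> ((\<theta> ^^ j) x)))) \<le> gibbs_const x * gibbs_const ((\<theta> ^^ n) x)" .
    qed
  qed
qed

text \<open>A density with values between \<open>a x > 0\<close> and \<open>b x\<close> changes the
  mass of a cylinder by a factor that the constant at the starting point absorbs. The work lies in
  showing that the infimum of \<open>q x\<close> is positive on almost every fibre.\<close>

lemma gibbs_family_densities:
  assumes P: "prob_space M" and \<theta>: "\<theta> \<in> measurable M M" "distr M M \<theta> = M"
    and AE_G: "AE x in M. x \<in> G" and Gsub: "G \<subseteq> space M"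
    and GF: "gibbs_fibres \<theta> J T \<eta> \<xi> \<gamma> G \<phi> \<nu> (eigenvalue \<theta> J T \<phi> \<nu>) B H \<alpha> N Q"
    and m: "gibbs_fibres.gibbs_const \<theta> J T B N Q \<in> borel_measurable M"
    and ge: "\<And>x. gibbs_fibres.gibbs_const \<theta> J T B N Q x \<ge> 1"
    and eig: "eigenfunction M \<theta> J T \<phi> \<nu> q" and inf: "measurable_fibre_inf M J q"
    and dens: "has_densities M J \<nu> q \<mu>"
  shows "gibbs_family M \<theta> J T \<eta> \<xi> \<phi> \<mu>"
proof -
  interpret prob_space M by (rule P)
  let ?\<Lambda> = "eigenvalue \<theta> J T \<phi> \<nu>"
  interpret F: gibbs_fibres \<theta> J T \<eta> \<xi> \<gamma> G \<phi> \<nu> ?\<Lambda> B H \<alpha> N Q by (rule GF)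
  have qc: "AE x in M. continuous_map (mtopology_of (J x)) euclideanreal (q x)"
    and norm: "fibre_norm J q \<in> borel_measurable M"
    and eigen: "AE x in M. \<forall>w\<in>mspace (J (\<theta> x)). F.transfer x (q x) w = ?\<Lambda> x * q (\<theta> x) w"
    and one: "AE x in M. (\<integral>z. q x z \<partial>\<nu> x) = 1"
    using eig unfolding eigenfunction_def C0_space_def mem_Collect_eq by - (elim conjE, assumption)+
  have inf': "(\<lambda>x. INF z\<in>mspace (J x). ereal (q x z)) \<in> borel_measurable M"
    using inf unfolding measurable_fibre_inf_def .
  have dens': "AE x in M. sets (\<mu> x) = sets (fibre_borel (J x)) \<and>
        (\<forall>A\<in>sets (fibre_borel (J x)). measure (\<mu> x) A = (LINT z:A|\<nu> x. q x z))"
    using dens unfolding has_densities_def .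
  define good where "good x \<longleftrightarrow> x \<in> G \<and>
    continuous_map (mtopology_of (J x)) euclideanreal (q x) \<and>
    (\<forall>w\<in>mspace (J (\<theta> x)). F.transfer x (q x) w = ?\<Lambda> x * q (\<theta> x) w) \<and>
    (\<integral>z. q x z \<partial>\<nu> x) = 1 \<and>
    (sets (\<mu> x) = sets (fibre_borel (J x)) \<and>
        (\<forall>A\<in>sets (fibre_borel (J x)). measure (\<mu> x) A = (LINT z:A|\<nu> x. q x z)))" for x
  have "AE x in M. good x" unfolding good_def by (intro AE_conjI AE_G qc eigen one dens')
  then have AEgood: "AE x in M. \<forall>k. good ((\<theta> ^^ k) x)" by (rule AE_orbit[OF \<theta>])
  have goodD: "x \<in> G" "continuous_map (mtopology_of (J x)) euclideanreal (q x)"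
    "\<forall>w\<in>mspace (J (\<theta> x)). F.transfer x (q x) w = ?\<Lambda> x * q (\<theta> x) w" "(\<integral>z. q x z \<partial>\<nu> x) = 1"
    "sets (\<mu> x) = sets (fibre_borel (J x))"
    "\<forall>A\<in>sets (fibre_borel (J x)). measure (\<mu> x) A = (LINT z:A|\<nu> x. q x z)" if "good x" for x
    using that unfolding good_def by - (elim conjE, assumption)+
  \<comment> \<open>Measurability of the fibrewise infimum makes \<open>E\<close> measurable, so
    that \<open>AE_eventually_in\<close> applies to it.\<close>
  define E where "E = {x \<in> space M. 0 < (INF z\<in>mspace (J x). ereal (q x z))}"
  have E: "E \<in> sets M" unfolding E_def using inf' by measurable
  \<comment> \<open>Compactness turns pointwise positivity into a positive infimum.\<close>
  have pos_E: "x \<in> E" if g: "good x" and pos: "\<forall>w\<in>mspace (J x). q x w > 0" for x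
  proof -
    obtain z0 where z0: "z0 \<in> mspace (J x)" "\<forall>z\<in>mspace (J x). q x z0 \<le> q x z"
      using compact_attains_min[OF F.compact[OF goodD(1)[OF g]] F.nonempty[OF goodD(1)[OF g]] goodD(2)[OF g]]
      by (rule bexE)
    have "0 < ereal (q x z0)" using pos z0(1) by simp
    also have "\<dots> \<le> (INF z\<in>mspace (J x). ereal (q x z))" by (rule INF_greatest) (use z0(2) in simp)
    finally show ?thesis unfolding E_def using Gsub goodD(1)[OF g] by blast
  qed
  have "AE x in M. \<exists>m. \<forall>k\<ge>m. (\<theta> ^^ k) x \<in> E"
    using AEgood
  proof eventually_elim
    fix x assume g: "\<forall>k. good ((\<theta> ^^ k) x)"
    then have gk: "good ((\<theta> ^^ k) x)" for k by (rule spec)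
    have g0: "good x" using gk[of 0] by simp
    \<comment> \<open>The sign of \<open>q\<close> is inherited from the fact that its integrals
      over Borel sets are values of a measure.\<close>
    have nn: "q ((\<theta> ^^ k) x) z \<ge> 0" if z: "z \<in> mspace (J ((\<theta> ^^ k) x))" for k z
    proof (rule F.density_nonneg[OF goodD(1,2)[OF gk] _ z])
      fix A assume "A \<in> sets (\<nu> ((\<theta> ^^ k) x))"
      then have "A \<in> sets (fibre_borel (J ((\<theta> ^^ k) x)))" unfolding F.sets_nu[OF goodD(1)[OF gk]] .
      from bspec[OF goodD(6)[OF gk] this]
      show "0 \<le> (LINT z:A|\<nu> ((\<theta> ^^ k) x). q ((\<theta> ^^ k) x) z)" by (metis measure_nonneg)
    qed
    from F.eigenfunction_eventually_pos[OF goodD(1)[OF g0] nn goodD(2)[OF g0] bspec[OF goodD(3)[OF gk]] goodD(4)[OF g0]]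
    obtain k0 where "\<forall>k\<ge>k0. \<forall>w\<in>mspace (J ((\<theta> ^^ k) x)). q ((\<theta> ^^ k) x) w > 0" by (rule exE)
    then show "\<exists>m. \<forall>k\<ge>m. (\<theta> ^^ k) x \<in> E" using pos_E[OF gk] by blast
  qed
  from AE_eventually_in[OF \<theta> E this] have AE_E: "AE x in M. x \<in> E" .
  define a where "a x = real_of_ereal (INF z\<in>mspace (J x). ereal (q x z))" for x
  define b where "b x = enn2real (fibre_norm J q x)" for x
  \<comment> \<open>\<open>inverse (a x)\<close> serves the lower bound and \<open>b x\<close> the
    upper one; the 1 keeps the final constant at least 1.\<close>
  define K where "K x = max 1 (max (b x) (inverse (a x)))" for x
  have am: "a \<in> borel_measurable M" unfolding a_def using inf' by measurable
  have bm: "b \<in> borel_measurable M" unfolding b_def using norm by measurable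
  have Km: "K \<in> borel_measurable M" unfolding K_def using am bm by measurable
  have K1: "K x \<ge> 1" for x by (simp add: K_def)
  let ?c = "F.gibbs_const"
  have cpos: "?c x > 0" for x using ge[of x] by linarith
  have ab: "a x > 0" "u \<in> mspace (J x) \<Longrightarrow> a x \<le> q x u" "u \<in> mspace (J x) \<Longrightarrow> q x u \<le> b x"
    if g: "good x" and xE: "x \<in> E" for x u
  proof -
    let ?I = "INF z\<in>mspace (J x). ereal (q x z)"
    have I0: "0 < ?I" using xE unfolding E_def by simp
    have Iq: "?I \<le> ereal (q x u)" if "u \<in> mspace (J x)" for u using that by (rule INF_lower)
    obtain u0 where u0: "u0 \<in> mspace (J x)" using F.nonempty[OF goodD(1)[OF g]] by blast
    have "\<bar>?I\<bar> \<noteq> \<infinity>" using I0 Iq[OF u0] by (cases ?I) simp_all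
    then have aI: "ereal (a x) = ?I" unfolding a_def by (rule ereal_real')
    show "a x > 0" using I0 unfolding aI[symmetric] by simp
    show "a x \<le> q x u" if "u \<in> mspace (J x)" using Iq[OF that] unfolding aI[symmetric] by simp
    show "q x u \<le> b x" if "u \<in> mspace (J x)"
      using fibre_norm_bound[where J = J and g = q and x = x, OF F.compact[OF goodD(1)[OF g]] goodD(2)[OF g] that]
      unfolding b_def by simp
  qed
  show ?thesis
  proof (rule gibbs_familyI[where D = "\<lambda>x. ?c x * K x" and P = "\<lambda>x. ln (?\<Lambda> x)"])
    show "(\<lambda>x. ?c x * K x) \<in> borel_measurable M" by (intro borel_measurable_times m Km)
    show "1 \<le> ?c x * K x" for x using mult_mono[OF ge[of x] K1[of x]] cpos[of x] by simp
    show "AE x in M. borel_probability_on (J x) (\<mu> x)"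
      using AEgood
    proof eventually_elim
      fix x assume "\<forall>k. good ((\<theta> ^^ k) x)"
      then have "good ((\<theta> ^^ 0) x)" by (rule spec)
      then have g: "good x" by simp
      note x = goodD(1)[OF g]
      have sp: "space (\<mu> x) = mspace (J x)" using sets_eq_imp_space_eq[OF goodD(5)[OF g]] by simp
      have "mspace (J x) \<in> sets (fibre_borel (J x))" using sets.top[of "fibre_borel (J x)"] by simp
      from bspec[OF goodD(6)[OF g] this]
      have "measure (\<mu> x) (mspace (J x)) = (LINT z:mspace (J x)|\<nu> x. q x z)" .
      also have "\<dots> = (LINT z|\<nu> x. q x z)"
        using set_integral_space[OF F.continuous_integrable_nu[OF x goodD(2)[OF g]]] F.space_nu[OF x] by simp
      finally have one: "measure (\<mu> x) (space (\<mu> x)) = 1" using goodD(4)[OF g] sp by simp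
      \<comment> \<open>\<open>has_densities\<close> speaks of \<open>measure\<close>, which is 0 on
        sets of infinite mass; the value 1 of the total \<open>measure\<close> excludes
        this.\<close>
      have "emeasure (\<mu> x) (space (\<mu> x)) \<noteq> \<infinity>"
      proof
        assume "emeasure (\<mu> x) (space (\<mu> x)) = \<infinity>"
        then have "measure (\<mu> x) (space (\<mu> x)) = 0" by (simp add: measure_def)
        then show False using one by simp
      qed
      then have "emeasure (\<mu> x) (space (\<mu> x)) = 1"
        using emeasure_eq_ennreal_measure[of "\<mu> x" "space (\<mu> x)"] one by simp
      then have "prob_space (\<mu> x)" by (rule prob_spaceI)
      then show "borel_probability_on (J x) (\<mu> x)"
        unfolding borel_probability_on_def using goodD(5)[OF g] by (rule conjI)
    qed
    show "AE x in M. \<forall>n. \<forall>z\<in>mspace (J x).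
      inverse (?c x * K x * (?c ((\<theta> ^^ n) x) * K ((\<theta> ^^ n) x))) \<le> measure (\<mu> x) (F.cyl x n z) /
        exp ((\<Sum>j<n. \<phi> ((\<theta> ^^ j) x) (F.iter j x z)) - (\<Sum>j<n. ln (?\<Lambda> ((\<theta> ^^ j) x)))) \<and>
      measure (\<mu> x) (F.cyl x n z) /
        exp ((\<Sum>j<n. \<phi> ((\<theta> ^^ j) x) (F.iter j x z)) - (\<Sum>j<n. ln (?\<Lambda> ((\<theta> ^^ j) x))))
        \<le> ?c x * K x * (?c ((\<theta> ^^ n) x) * K ((\<theta> ^^ n) x))"
      using AEgood AE_E
    proof (eventually_elim, intro allI ballI)
      fix x n z assume gk: "\<forall>k. good ((\<theta> ^^ k) x)" and xE: "x \<in> E" and z: "z \<in> mspace (J x)"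
      from spec[OF gk] have "good ((\<theta> ^^ 0) x)" .
      then have g: "good x" by simp
      note x = goodD(1)[OF g]
      let ?y = "(\<theta> ^^ n) x"
      let ?e = "exp ((\<Sum>j<n. \<phi> ((\<theta> ^^ j) x) (F.iter j x z)) - (\<Sum>j<n. ln (?\<Lambda> ((\<theta> ^^ j) x))))"
      let ?r = "measure (\<nu> x) (F.cyl x n z) / ?e"
      have \<mu>A: "measure (\<mu> x) A = (LINT u:A|\<nu> x. q x u)" if "A \<in> sets (fibre_borel (J x))" for A
        by (rule bspec[OF goodD(6)[OF g] that])
      note d = F.density_cyl_bounds[OF x z goodD(2)[OF g] ab[OF g xE] \<mu>A, of n]
      have lo: "a x * ?r \<le> measure (\<mu> x) (F.cyl x n z) / ?e"
        using divide_right_mono[OF d(1), of ?e] by simp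
      have up: "measure (\<mu> x) (F.cyl x n z) / ?e \<le> b x * ?r"
        using divide_right_mono[OF d(2), of ?e] by simp
      have bK: "b x \<le> K x" and aK: "inverse (a x) \<le> K x" by (simp_all add: K_def)
      have a0: "a x > 0" by (rule ab(1)[OF g xE])
      have r0: "?r \<ge> 0" by simp
      have K0: "K u \<ge> 0" for u using K1[of u] by linarith
      have big: "K x * ?c ?y \<le> ?c x * K x * (?c ?y * K ?y)"
      proof -
        have "1 * (K x * ?c ?y) * 1 \<le> ?c x * (K x * ?c ?y) * K ?y"
          by (intro mult_mono ge K1 order_refl mult_nonneg_nonneg K0 less_imp_le[OF cpos]) simp_all
        then show ?thesis by (simp only: mult_1 mult_1_right ac_simps)
      qed
      have Kc: "0 < K x * ?c ?y" using cpos[of ?y] K1[of x] by (intro mult_pos_pos) linarith+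
      have "inverse (?c x * K x * (?c ?y * K ?y)) \<le> inverse (K x * ?c ?y)"
        by (rule le_imp_inverse_le[OF big Kc])
      also have "\<dots> = inverse (K x) * inverse (?c ?y)" by simp
      also have "\<dots> \<le> a x * ?r"
      proof (rule mult_mono[OF _ F.gibbs_nu(1)[OF x z]])
        have "inverse (K x) \<le> inverse (inverse (a x))" by (rule le_imp_inverse_le[OF aK]) (use a0 in simp)
        then show "inverse (K x) \<le> a x" by simp
        show "0 \<le> a x" using a0 by simp
        show "0 \<le> inverse (?c ?y)" using cpos[of ?y] by simp
      qed
      also note lo
      finally have 1: "inverse (?c x * K x * (?c ?y * K ?y)) \<le> measure (\<mu> x) (F.cyl x n z) / ?e" .
      note up
      also have "b x * ?r \<le> K x * ?c ?y" by (rule mult_mono[OF bK F.gibbs_nu(2)[OF x z] K0 r0])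
      also note big
      finally have 2: "measure (\<mu> x) (F.cyl x n z) / ?e \<le> ?c x * K x * (?c ?y * K ?y)" .
      show "inverse (?c x * K x * (?c ?y * K ?y)) \<le> measure (\<mu> x) (F.cyl x n z) / ?e \<and>
        measure (\<mu> x) (F.cyl x n z) / ?e \<le> ?c x * K x * (?c ?y * K ?y)"
        using 1 2 by (rule conjI)
    qed
  qed
qed

text \<open>Some common sublevel set \<open>A L\<close> of both Gibbs constants and of the cover
  cardinality has positive measure, so almost every orbit visits it infinitely often. At these times
  the comparison of cylinder masses has constants depending on \<open>x\<close> and \<open>L\<close>
  but not on \<open>n\<close>, and it is symmetric in the two measures.\<close>

lemma gibbs_family_equivalent:
  assumes erg: "ergodic_map M \<theta>"
    and AE_G: "AE x in M. x \<in> G" and Gsub: "G \<subseteq> space M"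
    and GF: "gibbs_fibres \<theta> J T \<eta> \<xi> \<gamma> G \<phi> \<nu> \<Lambda> B H \<alpha> N Q"
    and m: "gibbs_fibres.gibbs_const \<theta> J T B N Q \<in> borel_measurable M"
    and cover: "measurable_cover_cardinality M J \<xi>"
    and gf: "gibbs_family M \<theta> J T \<eta> \<xi> \<phi> \<nu>'"
  shows "AE x in M. equivalent_measures (\<nu>' x) (\<nu> x)"
proof -
  interpret prob_space M by (rule ergodic_mapD(1)[OF erg])
  interpret F: gibbs_fibres \<theta> J T \<eta> \<xi> \<gamma> G \<phi> \<nu> \<Lambda> B H \<alpha> N Q by (rule GF)
  obtain D P where D: "D \<in> borel_measurable M"
    and pr: "AE x in M. borel_probability_on (J x) (\<nu>' x)"
    and g': "AE x in M. \<forall>n. \<forall>z\<in>mspace (J x).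
      inverse (D x * D ((\<theta> ^^ n) x)) \<le> measure (\<nu>' x) (F.cyl x n z) /
        exp ((\<Sum>j<n. \<phi> ((\<theta> ^^ j) x) (F.iter j x z)) - (\<Sum>j<n. P ((\<theta> ^^ j) x))) \<and>
      measure (\<nu>' x) (F.cyl x n z) /
        exp ((\<Sum>j<n. \<phi> ((\<theta> ^^ j) x) (F.iter j x z)) - (\<Sum>j<n. P ((\<theta> ^^ j) x))) \<le> D x * D ((\<theta> ^^ n) x)"
    and D1: "\<forall>x\<in>space M. D x \<ge> 1"
    by (rule gibbs_familyE[OF gf])
  obtain a :: "_ \<Rightarrow> nat" where a: "a \<in> measurable M (count_space UNIV)"
    and cov: "\<forall>x\<in>space M. \<exists>w :: nat \<Rightarrow> _.
        (\<forall>j\<in>{1..a x}. w j \<in> mspace (J x)) \<and>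
        (\<Union>j\<in>{1..a x}. mball_of (J x) (w j) \<xi>) = mspace (J x)"
    using cover unfolding measurable_cover_cardinality_def by (elim bexE)
  let ?c = "F.gibbs_const"
  define A where "A L = {x \<in> space M. D x \<le> real L \<and> ?c x \<le> real L \<and> a x \<le> L}" for L :: nat
  note [measurable] = D a m
  have A: "A L \<in> sets M" for L unfolding A_def by measurable
  have "space M \<subseteq> (\<Union>L. A L)"
  proof
    fix x assume x: "x \<in> space M"
    obtain L1 :: nat where L1: "D x \<le> real L1" using real_arch_simple by blast
    obtain L2 :: nat where L2: "?c x \<le> real L2" using real_arch_simple by blast
    have "x \<in> A (max (a x) (max L1 L2))" unfolding A_def using x L1 L2 by (simp add: of_nat_max le_max_iff_disj)
    then show "x \<in> (\<Union>L. A L)" by (rule UN_I[OF UNIV_I])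
  qed
  then have UA: "(\<Union>L. A L) = space M" unfolding A_def by blast
  have "\<exists>L. measure M (A L) > 0"
  proof (rule ccontr)
    assume "\<not> ?thesis"
    then have "\<not> measure M (A L) > 0" for L by blast
    then have "measure M (A L) = 0" for L using measure_nonneg[of M "A L"] by (simp add: not_less order_antisym)
    then have "AE x in M. x \<notin> A L" for L using A by (simp add: prob_eq_0)
    then have "AE x in M. \<forall>L. x \<notin> A L" by (simp add: AE_all_countable)
    then have "AE x in M. False" using AE_space
    proof eventually_elim
      fix x assume x: "\<forall>L. x \<notin> A L" "x \<in> space M"
      then have "x \<in> (\<Union>L. A L)" using UA by simp
      then show False using x(1) by blast
    qed
    then show False by simp
  qed
  then obtain L where L: "measure M (A L) > 0" by (rule exE)
  from ergodic_infinitely_often[OF erg A L]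
  have io: "AE x in M. \<forall>k. \<exists>n\<ge>k. (\<theta> ^^ n) x \<in> A L" .
  show ?thesis using AE_G pr g' io
  proof eventually_elim
    fix x assume x: "x \<in> G" and p': "borel_probability_on (J x) (\<nu>' x)"
      and gx: "\<forall>n. \<forall>z\<in>mspace (J x).
      inverse (D x * D ((\<theta> ^^ n) x)) \<le> measure (\<nu>' x) (F.cyl x n z) /
        exp ((\<Sum>j<n. \<phi> ((\<theta> ^^ j) x) (F.iter j x z)) - (\<Sum>j<n. P ((\<theta> ^^ j) x))) \<and>
      measure (\<nu>' x) (F.cyl x n z) /
        exp ((\<Sum>j<n. \<phi> ((\<theta> ^^ j) x) (F.iter j x z)) - (\<Sum>j<n. P ((\<theta> ^^ j) x))) \<le> D x * D ((\<theta> ^^ n) x)"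
      and iox: "\<forall>k. \<exists>n\<ge>k. (\<theta> ^^ n) x \<in> A L"
    have xs: "x \<in> space M" using x Gsub by blast
    \<comment> \<open>\<open>D x * real L\<close> bounds the Gibbs constant of \<open>\<nu>'\<close>
      at the visiting times; for \<open>\<nu>\<close> only the end point matters, so
      \<open>real L\<close> suffices.\<close>
    define k where "k = max 1 (max (real L) (D x * real L))"
    have k1: "k \<ge> 1" by (simp add: k_def)
    have widen: "inverse k \<le> r \<and> r \<le> k" if "inverse t \<le> r" "r \<le> t" "0 < t" "t \<le> k" for r t
      using le_imp_inverse_le[OF that(4,3)] that by linarith
    have both: "(\<forall>z\<in>mspace (J x). measure (\<nu>' x) (F.cyl x n z) \<le> k ^ 4 * real L * measure (\<nu> x) (F.cyl x n z)) \<and>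
        (\<forall>z\<in>mspace (J x). measure (\<nu> x) (F.cyl x n z) \<le> k ^ 4 * real L * measure (\<nu>' x) (F.cyl x n z)) \<and>
        (\<exists>b w. b \<le> L \<and> (\<forall>j\<in>{1..b}. w j \<in> mspace (J ((\<theta> ^^ n) x))) \<and>
          mspace (J ((\<theta> ^^ n) x)) \<subseteq> (\<Union>j\<in>{1..b}. mball_of (J ((\<theta> ^^ n) x)) (w j) \<xi>))"
      if n: "(\<theta> ^^ n) x \<in> A L" for n
    proof -
      let ?y = "(\<theta> ^^ n) x"
      let ?S = "\<lambda>z. \<Sum>j<n. \<phi> ((\<theta> ^^ j) x) (F.iter j x z)"
      let ?p' = "\<Sum>j<n. P ((\<theta> ^^ j) x)" and ?p = "\<Sum>j<n. ln (\<Lambda> ((\<theta> ^^ j) x))"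
      have y: "?y \<in> space M" "D ?y \<le> real L" "?c ?y \<le> real L" "a ?y \<le> L"
        using n unfolding A_def by simp_all
      from bspec[OF cov y(1)] obtain w where w: "\<forall>j\<in>{1..a ?y}. w j \<in> mspace (J ?y)"
        and wc: "(\<Union>j\<in>{1..a ?y}. mball_of (J ?y) (w j) \<xi>) = mspace (J ?y)"
        by (elim exE conjE)
      have Dx: "D x \<ge> 1" "D ?y \<ge> 1" by (rule bspec[OF D1 xs], rule bspec[OF D1 y(1)])
      have DD: "0 < D x * D ?y" using Dx by (intro mult_pos_pos) linarith+
      have "D x * D ?y \<le> D x * real L" by (rule mult_left_mono[OF y(2)]) (use Dx in linarith)
      then have DDk: "D x * D ?y \<le> k" by (simp add: k_def)
      have ck: "?c ?y \<le> k" using y(3) by (simp add: k_def)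
      have c0: "0 < ?c ?y" by (simp add: F.gibbs_const_def)
      have 1: "inverse k \<le> measure (\<nu>' x) (F.cyl x n z) / exp (?S z - ?p') \<and>
          measure (\<nu>' x) (F.cyl x n z) / exp (?S z - ?p') \<le> k" if "z \<in> mspace (J x)" for z
        using bspec[OF spec[OF gx, of n] that] by (elim conjE) (rule widen[OF _ _ DD DDk])
      have 2: "inverse k \<le> measure (\<nu> x) (F.cyl x n z) / exp (?S z - ?p) \<and>
          measure (\<nu> x) (F.cyl x n z) / exp (?S z - ?p) \<le> k" if "z \<in> mspace (J x)" for z
        by (rule widen[OF F.gibbs_nu[OF x that] c0 ck])
      have aL: "k ^ 4 * real (a ?y) * measure \<rho> B \<le> k ^ 4 * real L * measure \<rho> B" for \<rho> :: "'c measure" and B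
        by (intro mult_right_mono mult_left_mono) (use y(4) k1 in simp_all)
      have "measure (\<nu>' x) (F.cyl x n z) \<le> k ^ 4 * real L * measure (\<nu> x) (F.cyl x n z)" if "z \<in> mspace (J x)" for z
        by (rule order_trans[OF F.gibbs_cyl_le[OF x p' F.nu[OF x] k1 1 2 bspec[OF w] equalityD2[OF wc] that] aL])
      moreover have "measure (\<nu> x) (F.cyl x n z) \<le> k ^ 4 * real L * measure (\<nu>' x) (F.cyl x n z)" if "z \<in> mspace (J x)" for z
        by (rule order_trans[OF F.gibbs_cyl_le[OF x F.nu[OF x] p' k1 2 1 bspec[OF w] equalityD2[OF wc] that] aL])
      ultimately show ?thesis
        using y(4) equalityD2[OF wc] by (intro conjI ballI exI[of _ "a ?y"] exI[of _ w] bspec[OF w])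
    qed
    have c0: "0 \<le> k ^ 4 * real L" using k1 by simp
    have "absolutely_continuous (\<nu> x) (\<nu>' x)"
    proof (rule F.absolutely_continuous_cyl[OF x p' F.nu[OF x] c0])
      fix m
      obtain n where n: "n \<ge> m" "(\<theta> ^^ n) x \<in> A L" using spec[OF iox, of m] by (elim exE conjE)
      show "\<exists>n\<ge>m. (\<forall>z\<in>mspace (J x). measure (\<nu>' x) (F.cyl x n z) \<le> k ^ 4 * real L * measure (\<nu> x) (F.cyl x n z)) \<and>
        (\<exists>b w. b \<le> L \<and> (\<forall>j\<in>{1..b}. w j \<in> mspace (J ((\<theta> ^^ n) x))) \<and>
          mspace (J ((\<theta> ^^ n) x)) \<subseteq> (\<Union>j\<in>{1..b}. mball_of (J ((\<theta> ^^ n) x)) (w j) \<xi>))"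
        using both[OF n(2)] n(1) by (intro exI[of _ n]) (elim conjE, intro conjI)
    qed
    moreover have "absolutely_continuous (\<nu>' x) (\<nu> x)"
    proof (rule F.absolutely_continuous_cyl[OF x F.nu[OF x] p' c0])
      fix m
      obtain n where n: "n \<ge> m" "(\<theta> ^^ n) x \<in> A L" using spec[OF iox, of m] by (elim exE conjE)
      show "\<exists>n\<ge>m. (\<forall>z\<in>mspace (J x). measure (\<nu> x) (F.cyl x n z) \<le> k ^ 4 * real L * measure (\<nu>' x) (F.cyl x n z)) \<and>
        (\<exists>b w. b \<le> L \<and> (\<forall>j\<in>{1..b}. w j \<in> mspace (J ((\<theta> ^^ n) x))) \<and>
          mspace (J ((\<theta> ^^ n) x)) \<subseteq> (\<Union>j\<in>{1..b}. mball_of (J ((\<theta> ^^ n) x)) (w j) \<xi>))"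
        using both[OF n(2)] n(1) by (intro exI[of _ n]) (elim conjE, intro conjI)
    qed
    ultimately show "equivalent_measures (\<nu>' x) (\<nu> x)"
      unfolding equivalent_measures_def by (intro conjI)
  qed
qed

theorem theorem3p3:
  fixes M :: "'x measure" and \<theta> :: "'x \<Rightarrow> 'x"
    and J :: "'x \<Rightarrow> 'z metric" and T :: "'x \<Rightarrow> 'z \<Rightarrow> 'z"
    and \<eta> :: "'x \<Rightarrow> real" and \<xi> \<alpha> :: real
    and \<phi> :: "'x \<Rightarrow> 'z \<Rightarrow> real" and \<nu> :: "'x \<Rightarrow> 'z measure"
  assumes "ergodic_base M \<theta>"
    and "expanding_random_map M \<theta> J T \<eta> \<xi>"
    and "unique_inverse_branches M \<theta> J T \<eta> \<xi>"
    and "0 < \<alpha>" and "\<alpha> \<le> 1"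
    and "\<phi> \<in> holder_space M J \<eta> \<alpha>"
    and "eigenmeasures M \<theta> J T \<phi> \<nu>"
  shows "gibbs_family M \<theta> J T \<eta> \<xi> \<phi> \<nu> \<and>
    (\<forall>q \<mu>. eigenfunction M \<theta> J T \<phi> \<nu> q \<and> measurable_fibre_inf M J q \<and> has_densities M J \<nu> q \<mu> \<longrightarrow>
       gibbs_family M \<theta> J T \<eta> \<xi> \<phi> \<mu>) \<and>
    (measurable_cover_cardinality M J \<xi> \<longrightarrow>
       (\<forall>\<nu>'. gibbs_family M \<theta> J T \<eta> \<xi> \<phi> \<nu>' \<longrightarrow>
          (AE x in M. equivalent_measures (\<nu>' x) (\<nu> x))))"
proof -
  obtain \<gamma> B H N Q G where G: "AE x in M. x \<in> G" "G \<subseteq> space M"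
    and GF: "gibbs_fibres \<theta> J T \<eta> \<xi> \<gamma> G \<phi> \<nu> (eigenvalue \<theta> J T \<phi> \<nu>) B H \<alpha> N Q"
    and m: "gibbs_fibres.gibbs_const \<theta> J T B N Q \<in> borel_measurable M"
    and ge: "\<forall>x. gibbs_fibres.gibbs_const \<theta> J T B N Q x \<ge> 1"
    by (rule gibbs_setup[OF assms(1-4,6,7)])
  have erg: "ergodic_map M \<theta>" by (rule ergodic_map_base[OF assms(1)])
  show ?thesis
  proof (intro conjI allI impI)
    show "gibbs_family M \<theta> J T \<eta> \<xi> \<phi> \<nu>" by (rule gibbs_family_eigenmeasures[OF G(1) GF m spec[OF ge]])
    show "gibbs_family M \<theta> J T \<eta> \<xi> \<phi> \<mu>"
      if "eigenfunction M \<theta> J T \<phi> \<nu> q \<and> measurable_fibre_inf M J q \<and> has_densities M J \<nu> q \<mu>" for q \<mu>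
      using that by (elim conjE) (rule gibbs_family_densities[OF ergodic_mapD(1-3)[OF erg] G GF m spec[OF ge]])
    show "AE x in M. equivalent_measures (\<nu>' x) (\<nu> x)"
      if "measurable_cover_cardinality M J \<xi>" "gibbs_family M \<theta> J T \<eta> \<xi> \<phi> \<nu>'" for \<nu>'
      by (rule gibbs_family_equivalent[OF erg G GF m that])
  qed
qed

end
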